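(* Let $X$ be a positive random variable and let $\psi(s):=\mathbb E e^{-sX}$ be its Laplace transform. Suppose that $0<\nu<3/2$ and that $$\frac1{\Gamma(\nu)}\int_0^\infty e^{-xs}\,\psi(s^{3/2})\,s^{\nu-1}\,ds=\Psi(x),\qquad x>0,$$ where $\Psi$ is an analytic function in the sector $\{z\in\mathbb C:|\arg z|<5\pi/6\}$ such that $$\Psi(z)=o(|z|^{-\nu})\quad\text{as } z\to0\text{ with }|\arg z|<5\pi/6,$$ $$\Psi(z)=O(1)\quad\text{as } |z|\to\infty\text{ with }|\arg z|<5\pi/6.$$ Let $$\Psi^*(z):=e^{2\pi\nu\mathbf i/3}\,\Psi\bigl(e^{2\pi\mathbf i/3}z\bigr)-e^{-2\pi\nu\mathbf i/3}\,\Psi\bigl(e^{-2\pi\mathbf i/3}z\bigr),\qquad |\arg z|<\pi/6.$$ Finally, assume that $$\Psi^*(z)=O(|z|^{-6})\quad\text{as }|z|\to\infty\text{ with }|\arg z|<\pi/6.$$ Then $X$ is absolutely continuous with a continuous density function $f$ given by, for $x>0$ and every $\xi>0$, $$f(x)=\frac{3\Gamma(\nu)}{8\pi^2\mathbf i}\,\xi^{5/2-\nu}x^{2\nu/3-5/3}\int_{\theta=-\pi/2}^{\pi/2}\int_{r=0}^\infty\exp\Bigl(\xi x^{-2/3}\sec\theta\,e^{\mathbf i\theta}-e^{\mathbf i\theta}(\xi\sec\theta)^{3/2}r^{-3/2}\Bigr)\,e^{(1-2\nu/3)\mathbf i\theta}(\sec\theta)^{7/2-\nu}\,r^{\nu-5/2}\,\Psi^*\bigl(re^{\mathbf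 i\theta/3}\bigr)\,dr\,d\theta .$$
   Context: $\mathbf i$ is the imaginary unit. Fractional powers of complex numbers are principal values, defined on $\mathbb C\setminus(-\infty,0]$. The $o$ and $O$ estimates are uniform over the indicated sectors. *)

theory Defs
  imports "HOL-Probability.Probability" "HOL-Library.Landau_Symbols"
begin

definition laplace_transform :: "'a measure \<Rightarrow> ('a \<Rightarrow> real) \<Rightarrow> real \<Rightarrow> real" where
  "laplace_transform M X s = (\<integral>\<omega>. exp (- s * X \<omega>) \<partial>M)"

(* Arg 0 = 0 in the library, so the vertex has to be removed explicitly. *)
definition sector :: "real \<Rightarrow> complex set" where
  "sector \<alpha> = {z. z \<noteq> 0 \<and> \<bar>Arg z\<bar> < \<alpha>}"

(* z tends to infinity inside the sector; estimates along this filter are uniform in Arg z. *)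
definition sector_at_infinity :: "real \<Rightarrow> complex filter" where
  "sector_at_infinity \<alpha> = inf at_infinity (principal (sector \<alpha>))"

(* Only meaningful for z in sector (pi/6), where both rotated arguments lie in sector (5*pi/6). *)
definition Psi_star :: "real \<Rightarrow> (complex \<Rightarrow> complex) \<Rightarrow> complex \<Rightarrow> complex" where
  "Psi_star \<nu> \<Psi> z =
     exp (of_real (2 * pi * \<nu> / 3) * \<i>) * \<Psi> (exp (of_real (2 * pi / 3) * \<i>) * z)
     - exp (- of_real (2 * pi * \<nu> / 3) * \<i>) * \<Psi> (exp (- of_real (2 * pi / 3) * \<i>) * z)"

definition sec :: "real \<Rightarrow> real" where
  "sec \<theta> = 1 / cos \<theta>"

definition density_integrand ::
    "real \<Rightarrow> (complex \<Rightarrow> complex) \<Rightarrow> real \<Rightarrow> real \<Rightarrow> real \<Rightarrow> real \<Rightarrow> complex" where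
  "density_integrand \<nu> \<Psi> \<xi> x \<theta> r =
     exp (of_real (\<xi> * x powr (-2/3) * sec \<theta>) * exp (\<i> * of_real \<theta>)
          - exp (\<i> * of_real \<theta>) * of_real ((\<xi> * sec \<theta>) powr (3/2) * r powr (-3/2)))
     * exp (of_real (1 - 2 * \<nu> / 3) * \<i> * of_real \<theta>)
     * of_real (sec \<theta> powr (7/2 - \<nu>) * r powr (\<nu> - 5/2))
     * Psi_star \<nu> \<Psi> (of_real r * exp (\<i> * of_real (\<theta> / 3)))"

end

theory Submission
  imports Defs "HOL-Complex_Analysis.Complex_Analysis" "HOL-Real_Asymp.Real_Asymp"
begin

text \<open>
  Write \<open>\<chi>\<close> for the characteristic function of \<open>X\<close> and \<open>Y = X^(-2/3)\<close>. Rotating the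
  ray of integration in the gamma--Laplace integral to argument \<open>\<plusminus>\<pi>/3\<close> turns \<open>\<psi>(s^(3/2))\<close> into
  values of \<open>\<chi>\<close> and, by the identity theorem, represents \<open>\<Psi>\<close> on the whole sector. Both terms of
  \<open>Psi_star\<close> thereby become integrals of \<open>\<chi>\<close>. In the inner \<open>r\<close>-integral of the density formula Fubini
  produces, for each fixed value of \<open>X\<close>, a difference of two line integrals of an explicit
  meromorphic kernel with exactly one pole between the lines. Its residue is, up to an explicit factor,
  \<open>Y^\<nu> exp (- u Y)\<close> with \<open>u = \<xi> sec \<theta> exp (\<i>\<theta>)\<close>, so the inner integral is the Laplace transform of the
  measure \<open>Y^\<nu> dP\<close> at the point \<open>u\<close> of the line \<open>Re u = \<xi>\<close>, parametrised by \<open>\<theta>\<close>. The decay of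
  \<open>Psi_star\<close> makes this transform integrable along the line, and Levy inversion yields the density.
\<close>

section \<open>Change of variables and contour shifts\<close>

text \<open>The angle pi/3 is forced from two sides. It is the largest rotation at which
  \<open>s^(3/2)\<close> stays in the closed right half-plane, where the Laplace transform of a
  positive variable is bounded by 1; and the half-planes with axes at arguments pi/3 and -pi/3
  together make up the sector of half-angle 5 pi/6. The pole of the kernel has argument
  \<open>2\<theta>/3\<close>, so it lies strictly between the two rays. Origin of the prefactor: the
  substitution \<open>s = r^(-3/2)\<close> contributes 2/3 and the residue 4 pi i/3, so the inner
  integral carries \<open>8 pi i / (9 Gamma \<nu>)\<close>. Inversion contributes 1/(2 pi) and the
  Jacobian of \<open>y^(-2/3)\<close> another 2/3, that is 1/(3 pi). The quotient of the two is
  \<open>3 Gamma \<nu> / (8 pi^2 i)\<close>. The delicate point is absolute integrability in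
  \<open>(\<theta>, r)\<close> jointly, since \<open>sec \<theta>\<close> is unbounded; powers of
  \<open>sec \<theta>\<close> and of \<open>r\<close> have to be balanced against each other. Each
  \<open>\<xi>\<close> produces a density of its own. That they coincide is not computed: they are
  continuous densities of one and the same law.\<close>

lemma set_lborel_substitution:
  fixes f :: "real \<Rightarrow> 'a::euclidean_space" and g g' :: "real \<Rightarrow> real"
  assumes S: "S \<in> sets borel"
    and der: "\<And>x. x \<in> S \<Longrightarrow> (g has_real_derivative g' x) (at x)"
    and inj: "inj_on g S" and T: "g ` S = T"
    and f: "set_borel_measurable borel T f"
    and fg: "set_borel_measurable borel S (\<lambda>x. \<bar>g' x\<bar> *\<^sub>R f (g x))"
  shows "set_integrable lborel S (\<lambda>x. \<bar>g' x\<bar> *\<^sub>R f (g x)) \<longleftrightarrow> set_integrable lborel T f" (is ?th1)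
    and "(LBINT x:S. \<bar>g' x\<bar> *\<^sub>R f (g x)) = (LBINT x:T. f x)"
proof -
  have leb: "S \<in> sets lebesgue" using S by (simp add: borel_measurable_indicator_iff sets_completionI_sets)
  have der': "\<And>x. x \<in> S \<Longrightarrow> (g has_real_derivative g' x) (at x within S)"
    using der has_field_derivative_at_within by blast
  note eq = has_absolute_integral_change_of_variables_real[OF leb der' inj, of f, unfolded T]
  have i1: "set_integrable lebesgue S (\<lambda>x. \<bar>g' x\<bar> *\<^sub>R f (g x)) \<longleftrightarrow> set_integrable lborel S (\<lambda>x. \<bar>g' x\<bar> *\<^sub>R f (g x))"
    using fg unfolding set_integrable_def set_borel_measurable_def by (intro integrable_completion) simp
  have i2: "set_integrable lebesgue T f \<longleftrightarrow> set_integrable lborel T f"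
    using f unfolding set_integrable_def set_borel_measurable_def by (intro integrable_completion) simp
  show th1: ?th1
    using eq i1 i2 by blast
  show "(LBINT x:S. \<bar>g' x\<bar> *\<^sub>R f (g x)) = (LBINT x:T. f x)"
  proof (cases "set_integrable lborel T f")
    case True
    then show ?thesis using th1 eq i1 i2 by (simp add: set_borel_integral_eq_integral(2))
  next
    \<comment> \<open>Then neither side is integrable, and both Bochner integrals have the default
      value 0.\<close>
    case False
    then show ?thesis using th1
      by (simp add: set_lebesgue_integral_def set_integrable_def not_integrable_integral_eq)
  qed
qed

text \<open>Logarithmic coordinates turn rays from the origin into horizontal lines, so that
  rotating a ray of integration becomes a vertical shift.\<close>

lemma integral_exp_substitution:
  fixes f :: "real \<Rightarrow> 'a::euclidean_space"
  assumes f: "set_borel_measurable borel {0<..} f"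
  shows "integrable lborel (\<lambda>t. exp t *\<^sub>R f (exp t)) \<longleftrightarrow> set_integrable lborel {0<..} f"
    and "(\<integral>t. exp t *\<^sub>R f (exp t) \<partial>lborel) = (LBINT x:{0<..}. f x)"
proof -
  have m: "(\<lambda>t. \<bar>exp t\<bar> *\<^sub>R (indicator {0<..} (exp t) *\<^sub>R f (exp t))) \<in> borel_measurable borel"
    by (intro borel_measurable_scaleR measurable_compose[OF _ f[unfolded set_borel_measurable_def]]) auto
  have im: "exp ` (UNIV::real set) = {0<..}" 
  proof (intro set_eqI iffI)
    fix x :: real assume "x \<in> {0<..}" then have "x = exp (ln x)" by simp
    then show "x \<in> range exp" by blast
  qed auto
  have fg: "set_borel_measurable borel UNIV (\<lambda>x. \<bar>exp x\<bar> *\<^sub>R f (exp x))"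
    using m by (simp add: set_borel_measurable_def)
  note * = set_lborel_substitution[where S=UNIV and g=exp and g'=exp and T="{0<..}" and f=f,
      OF _ DERIV_exp _ im f fg]
  have "set_integrable lborel UNIV (\<lambda>x. \<bar>exp x\<bar> *\<^sub>R f (exp x)) \<longleftrightarrow> set_integrable lborel {0<..} f"
       "(LBINT x:UNIV. \<bar>exp x\<bar> *\<^sub>R f (exp x)) = (LBINT x:{0<..}. f x)"
    by (rule *; simp add: inj_on_def)+
  then show "integrable lborel (\<lambda>t. exp t *\<^sub>R f (exp t)) \<longleftrightarrow> set_integrable lborel {0<..} f"
    and "(\<integral>t. exp t *\<^sub>R f (exp t) \<partial>lborel) = (LBINT x:{0<..}. f x)"
    by (simp_all add: set_integrable_def set_lebesgue_integral_def)
qed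

lemma contour_integral_linepath_same_Im:
  assumes "a < b"
  shows   "contour_integral (linepath (Complex a c) (Complex b c)) f =
           integral {a..b} (\<lambda>x. f (Complex x c))"
proof -
  have "contour_integral (linepath (Complex a c) (Complex b c)) f =
         (Complex b c - Complex a c) * integral {0..1} (\<lambda>x. f (linepath (Complex a c) (Complex b c) x))"
    by (simp add: contour_integral_integral)
  also have "Complex b c - Complex a c = of_real (b - a)"
    by (simp add: Complex_eq algebra_simps)
  also have "integral {0..1} (\<lambda>x. f (linepath (Complex a c) (Complex b c) x)) =
             integral {0..(b - a) / (b - a)} (\<lambda>x. f (Complex (a + (b - a) * x) c))"
    using assms by (simp add: linepath_def Complex_eq scaleR_conv_of_real algebra_simps)
  also have "{0..(b - a) / (b - a)} = (\<lambda>x. x / (b - a)) ` {0..b - a}"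
    using \<open>a < b\<close> by simp
  also have "integral \<dots> (\<lambda>x. f (Complex (a + (b - a) * x) c)) =
             integral {a-a..b-a} (\<lambda>x. f (Complex (x + a) c)) / of_real (b - a)"
    using \<open>a < b\<close> by (subst integral_stretch_real) (auto simp: scaleR_conv_of_real add_ac)
  also have "\<dots> = integral {a..b} (\<lambda>x. f (Complex x c)) / of_real (b - a)"
    by (subst integral_shift_real_ivl) (rule refl)
  finally show ?thesis
    using \<open>a < b\<close> by simp
qed

lemma integral_symmetric_interval_tendsto:
  fixes h :: "real \<Rightarrow> 'a::euclidean_space"
  assumes "integrable lborel h"
  shows "(\<lambda>n. integral {-real n..real n} h) \<longlonglongrightarrow> (\<integral>t. h t \<partial>lborel)"
proof -
  have *: "integral {-real n..real n} h = (\<integral>t. indicator {-real n..real n} t *\<^sub>R h t \<partial>lborel)" for n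
  proof -
    have "set_integrable lborel {-real n..real n} h"
      using assms set_integrable_subset[of lborel UNIV h] by (simp add: set_integrable_def)
    then show ?thesis
      by (simp add: set_borel_integral_eq_integral(2)[symmetric] set_lebesgue_integral_def)
  qed
  have "(\<lambda>n. \<integral>t. indicator {-real n..real n} t *\<^sub>R h t \<partial>lborel) \<longlonglongrightarrow> (\<integral>t. h t \<partial>lborel)"
  proof (rule integral_dominated_convergence[where w="\<lambda>t. norm (h t)"])
    show "AE x in lborel. (\<lambda>i. indicat_real {-real i..real i} x *\<^sub>R h x) \<longlonglongrightarrow> h x"
    proof (intro AE_I2 tendsto_eventually)
      fix x :: real
      obtain N :: nat where N: "\<bar>x\<bar> \<le> real N" using real_arch_simple by blast
      show "\<forall>\<^sub>F n in sequentially. indicat_real {-real n..real n} x *\<^sub>R h x = h x"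
        unfolding eventually_sequentially
      proof (intro exI[of _ N] allI impI)
        fix n :: nat assume "N \<le> n"
        then have "\<bar>x\<bar> \<le> real n" using N by linarith
        then show "indicat_real {-real n..real n} x *\<^sub>R h x = h x" by (simp add: abs_le_iff)
      qed
    qed
    show "AE x in lborel. norm (indicat_real {-real i..real i} x *\<^sub>R h x) \<le> norm (h x)" for i
      by (auto simp: indicator_def)
  qed (use assms in auto)
  then show ?thesis by (simp add: *)
qed

text \<open>The residue theorem on rectangles that grow to the left and right: the vertical sides
  keep the length \<open>b - a\<close> while \<open>B\<close> tends to 0 along them. The margins
  \<open>a' < a\<close> and \<open>b < b'\<close> provide an open set around the closed rectangle.
  The lower line is the one traversed from left to right, which fixes the sign.\<close>

lemma strip_residue:
  fixes f :: "complex \<Rightarrow> complex"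
  assumes hol: "f holomorphic_on {z. a' < Im z \<and> Im z < b'} - {p}"
    and ab: "a' < a" "a < Im p" "Im p < b" "b < b'"
    and int_a: "integrable lborel (\<lambda>t. f (Complex t a))"
    and int_b: "integrable lborel (\<lambda>t. f (Complex t b))"
    and side: "\<And>t y. a \<le> y \<Longrightarrow> y \<le> b \<Longrightarrow> K \<le> \<bar>t\<bar> \<Longrightarrow> norm (f (Complex t y)) \<le> B t"
    and B: "(B \<longlongrightarrow> 0) at_top" "(B \<longlongrightarrow> 0) at_bot"
  shows "(\<integral>t. f (Complex t a) \<partial>lborel) - (\<integral>t. f (Complex t b) \<partial>lborel) = 2 * pi * \<i> * residue f p"
proof -
  define U where "U = {z. a' < Im z \<and> Im z < b'}"
  have U: "U = {z. a' < Im z} \<inter> {z. Im z < b'}" by (auto simp: U_def)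
  have "open U" unfolding U by (intro open_Int open_halfspace_Im_gt open_halfspace_Im_lt)
  have "convex U" unfolding U by (intro convex_Int convex_halfspace_Im_gt convex_halfspace_Im_lt)
  then have "connected U" by (rule convex_connected)
  have cont: "continuous_on (U - {p}) f" using hol holomorphic_on_imp_continuous_on unfolding U_def by blast
  define I where "I n = integral {-real n..real n} (\<lambda>t. f (Complex t a)) -
      integral {-real n..real n} (\<lambda>t. f (Complex t b))" for n
  \<comment> \<open>The defect of the truncated residue formula. For large \<open>n\<close> it is,
    up to sign, the contribution of the two vertical sides.\<close>
  define E where "E n = I n - 2 * pi * \<i> * residue f p" for n
  have bd: "norm (E n) \<le> (norm (B (real n)) + norm (B (- real n))) * (b - a)"
    if n: "\<bar>Re p\<bar> < real n" "K \<le> real n" "0 < real n" for n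
  proof -
    let ?a1 = "Complex (- real n) a" and ?a2 = "Complex (real n) a"
    let ?a3 = "Complex (real n) b" and ?a4 = "Complex (- real n) b"
    have R: "rectpath ?a1 ?a3 = linepath ?a1 ?a2 +++ linepath ?a2 ?a3 +++ linepath ?a3 ?a4 +++ linepath ?a4 ?a1"
      by (simp add: rectpath_def Let_def)
    have img: "path_image (rectpath ?a1 ?a3) \<subseteq> U - {p}"
      using ab n by (subst path_image_rectpath) (auto simp: U_def)
    have img': "path_image (rectpath ?a1 ?a3) = closed_segment ?a1 ?a2 \<union> closed_segment ?a2 ?a3
        \<union> closed_segment ?a3 ?a4 \<union> closed_segment ?a4 ?a1"
      unfolding R by (simp add: path_image_join Un_assoc)
    have res: "contour_integral (rectpath ?a1 ?a3) f
        = 2 * pi * \<i> * (\<Sum>p\<in>{p}. winding_number (rectpath ?a1 ?a3) p * residue f p)"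
    proof (rule Residue_theorem[where S=U])
      show "f holomorphic_on U - {p}" using hol by (simp add: U_def)
      show "\<forall>z. z \<notin> U \<longrightarrow> winding_number (rectpath ?a1 ?a3) z = 0"
      proof (intro allI impI)
        fix z assume "z \<notin> U"
        then have "z \<notin> cbox ?a1 ?a3" using ab by (auto simp: U_def in_cbox_complex_iff)
        then show "winding_number (rectpath ?a1 ?a3) z = 0"
          using ab n by (intro winding_number_rectpath_outside) auto
      qed
    qed (use \<open>open U\<close> \<open>connected U\<close> img in \<open>auto simp: rectpath_def Let_def\<close>)
    have "winding_number (rectpath ?a1 ?a3) p = 1"
      using ab n by (intro winding_number_rectpath) (auto simp: in_box_complex_iff)
    with res have res: "contour_integral (rectpath ?a1 ?a3) f = 2 * pi * \<i> * residue f p" by simp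
    have ci: "f contour_integrable_on linepath x y" if "closed_segment x y \<subseteq> path_image (rectpath ?a1 ?a3)" for x y
      using that img by (intro contour_integrable_continuous_linepath continuous_on_subset[OF cont]) auto
    have c1: "f contour_integrable_on linepath ?a1 ?a2" "f contour_integrable_on linepath ?a2 ?a3"
             "f contour_integrable_on linepath ?a3 ?a4" "f contour_integrable_on linepath ?a4 ?a1"
             "f contour_integrable_on linepath ?a4 ?a3"
      unfolding atomize_conj using img' closed_segment_commute[of ?a3 ?a4] by (intro conjI ci) blast+
    have "contour_integral (rectpath ?a1 ?a3) f = contour_integral (linepath ?a1 ?a2) f + contour_integral (linepath ?a2 ?a3) f
        + contour_integral (linepath ?a3 ?a4) f + contour_integral (linepath ?a4 ?a1) f"
      unfolding R using c1 by (simp add: contour_integrable_join valid_path_join)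
    also have "contour_integral (linepath ?a3 ?a4) f = - contour_integral (linepath ?a4 ?a3) f"
    proof (rule contour_integral_reverse_linepath)
      show "continuous_on (closed_segment ?a3 ?a4) f"
        using img img' by (intro continuous_on_subset[OF cont]) auto
    qed
    also have "contour_integral (linepath ?a4 ?a3) f = integral {-real n..real n} (\<lambda>t. f (Complex t b))"
      using n by (intro contour_integral_linepath_same_Im) auto
    also have "contour_integral (linepath ?a1 ?a2) f = integral {-real n..real n} (\<lambda>t. f (Complex t a))"
      using n by (intro contour_integral_linepath_same_Im) auto
    finally have "E n = - contour_integral (linepath ?a2 ?a3) f - contour_integral (linepath ?a4 ?a1) f"
      unfolding E_def I_def using res by (simp add: algebra_simps)
    then have "norm (E n) \<le> norm (contour_integral (linepath ?a2 ?a3) f) + norm (contour_integral (linepath ?a4 ?a1) f)"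
      by (metis norm_minus_cancel norm_triangle_ineq4)
    also have "\<dots> \<le> norm (B (real n)) * norm (?a3 - ?a2) + norm (B (- real n)) * norm (?a1 - ?a4)"
    proof (intro add_mono contour_integral_bound_linepath c1)
      fix x assume "x \<in> closed_segment ?a2 ?a3"
      then have "Re x = real n" "a \<le> Im x" "Im x \<le> b" using ab by (auto simp: closed_segment_same_Re closed_segment_eq_real_ivl)
      then show "norm (f x) \<le> norm (B (real n))"
        using side[of "Im x" "Re x"] n unfolding complex_surj by simp
    next
      fix x assume "x \<in> closed_segment ?a4 ?a1"
      then have "Re x = - real n" "a \<le> Im x" "Im x \<le> b" using ab by (auto simp: closed_segment_same_Re closed_segment_eq_real_ivl)
      then show "norm (f x) \<le> norm (B (- real n))"
        using side[of "Im x" "Re x"] n unfolding complex_surj by force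
    qed auto
    also have "?a3 - ?a2 = \<i> * of_real (b - a)" by (simp add: complex_eq_iff)
    also have "norm \<dots> = b - a" using ab by (simp add: norm_mult del: of_real_diff)
    also have "?a1 - ?a4 = - (\<i> * of_real (b - a))" by (simp add: complex_eq_iff)
    also have "norm \<dots> = b - a" using ab by (simp add: norm_mult del: of_real_diff)
    finally show ?thesis by (simp add: algebra_simps)
  qed
  have ev: "\<forall>\<^sub>F n in sequentially. norm (E n) \<le> (norm (B (real n)) + norm (B (- real n))) * (b - a)"
  proof -
    obtain N :: nat where N: "max (\<bar>Re p\<bar>) (max K 0) < real N" using reals_Archimedean2 by blast
    show ?thesis unfolding eventually_sequentially
    proof (intro exI[of _ N] allI impI bd)
      fix n assume "N \<le> n" then have "real N \<le> real n" by simp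
      then show "\<bar>Re p\<bar> < real n" "K \<le> real n" "0 < real n" using N by linarith+
    qed
  qed
  have "(\<lambda>n. (norm (B (real n)) + norm (B (- real n))) * (b - a)) \<longlonglongrightarrow> (norm (0::real) + norm (0::real)) * (b - a)"
    by (intro tendsto_intros filterlim_compose[OF B(1)] filterlim_compose[OF B(2)] filterlim_real_sequentially
        filterlim_compose[OF filterlim_uminus_at_bot_at_top])
  then have "E \<longlonglongrightarrow> 0" by (intro Lim_null_comparison[OF ev]) simp
  moreover have "E \<longlonglongrightarrow> (\<integral>t. f (Complex t a) \<partial>lborel) - (\<integral>t. f (Complex t b) \<partial>lborel) - 2 * pi * \<i> * residue f p"
    unfolding E_def I_def by (intro tendsto_intros integral_symmetric_interval_tendsto int_a int_b)
  ultimately show ?thesis using LIMSEQ_unique by fastforce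
qed

section \<open>Densities from integrable characteristic functions\<close>

lemma continuous_inverse_Fourier:
  fixes \<phi> :: "real \<Rightarrow> complex"
  assumes "integrable lborel \<phi>"
  shows "continuous_on UNIV (\<lambda>x. \<integral>t. iexp (-(t * x)) * \<phi> t \<partial>lborel)"
  unfolding continuous_on_eq_continuous_within
proof
  have [measurable]: "\<phi> \<in> borel_measurable borel" using assms by auto
  fix x :: real
  show "isCont (\<lambda>x. \<integral>t. iexp (-(t * x)) * \<phi> t \<partial>lborel) x"
    unfolding continuous_at_sequentially
  proof (intro allI impI)
    fix X :: "nat \<Rightarrow> real" assume X: "X \<longlonglongrightarrow> x"
    show "((\<lambda>x. \<integral>t. iexp (-(t * x)) * \<phi> t \<partial>lborel) \<circ> X) \<longlonglongrightarrow> (\<integral>t. iexp (-(t * x)) * \<phi> t \<partial>lborel)"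
      unfolding o_def
    proof (rule integral_dominated_convergence[where w="\<lambda>t. norm (\<phi> t)"])
      show "AE t in lborel. (\<lambda>i. iexp (-(t * X i)) * \<phi> t) \<longlonglongrightarrow> iexp (-(t * x)) * \<phi> t"
        by (intro AE_I2 tendsto_intros X)
    qed (use assms in \<open>auto simp: norm_mult norm_exp_i_times simp del: of_real_minus of_real_mult\<close>)
  qed
qed

text \<open>Levy inversion yields a limit of truncated integrals. Its kernel is bounded by
  \<open>b - a\<close>, so integrability of \<open>char M\<close> removes the truncation by
  dominated convergence. The kernel is moreover the integral of \<open>iexp (-(t * x))\<close> over
  \<open>x\<close> in \<open>{a..b}\<close>, and Fubini brings that integral outside.\<close>

lemma (in real_distribution) integrable_char_measure_Ioc:
  assumes int: "integrable lborel (char M)" and ab: "a \<le> b"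
    and atoms: "measure M {a} = 0" "measure M {b} = 0"
  shows "complex_of_real (measure M {a<..b}) =
     (LBINT x:{a..b}. (\<integral>t. iexp (-(t * x)) * char M t \<partial>lborel) / (2 * pi))"
proof -
  let ?k = "\<lambda>t. (iexp (-(t * a)) - iexp (-(t * b))) / (\<i> * t)"
  have [measurable]: "char M \<in> borel_measurable borel" using int by auto
  have bound: "norm (?k t * char M t) \<le> (b - a) * norm (char M t)" for t
  proof (cases "t = 0")
    case False
    then have "norm (?k t) \<le> b - a"
      using Levy_Inversion_aux2[of "-b" "-a" t] ab by simp
    then show ?thesis unfolding norm_mult by (intro mult_right_mono) auto
  qed (use ab in simp)
  have int_k: "integrable lborel (\<lambda>t. ?k t * char M t)"
    by (rule Bochner_Integration.integrable_bound[where f="\<lambda>t. (b - a) * norm (char M t)"])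
       (use int bound ab in \<open>auto intro!: AE_I2\<close>)
  have "(\<lambda>T. 1 / (2 * pi) * (CLBINT t=-real T..real T. ?k t * char M t)) \<longlonglongrightarrow> measure M {a<..b}"
    using Levy_Inversion[OF ab atoms] by simp
  moreover have "(\<lambda>T. 1 / (2 * pi) * (CLBINT t=-real T..real T. ?k t * char M t))
     \<longlonglongrightarrow> 1 / (2 * pi) * (\<integral>t. ?k t * char M t \<partial>lborel)"
  proof (intro tendsto_intros)
    have "(CLBINT t=-real T..real T. ?k t * char M t) = (\<integral>t. indicator {-real T<..<real T} t *\<^sub>R (?k t * char M t) \<partial>lborel)" for T
      by (simp add: interval_lebesgue_integral_def set_lebesgue_integral_def)
    moreover have "(\<lambda>T. \<integral>t. indicator {-real T<..<real T} t *\<^sub>R (?k t * char M t) \<partial>lborel) \<longlonglongrightarrow> (\<integral>t. ?k t * char M t \<partial>lborel)"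
    proof (rule integral_dominated_convergence[where w="\<lambda>t. norm (?k t * char M t)"])
      show "AE x in lborel. (\<lambda>i. indicat_real {-real i<..<real i} x *\<^sub>R (?k x * char M x)) \<longlonglongrightarrow> ?k x * char M x"
      proof (intro AE_I2 tendsto_eventually)
        fix x :: real
        obtain N :: nat where N: "\<bar>x\<bar> < real N" using reals_Archimedean2 by blast
        show "\<forall>\<^sub>F n in sequentially. indicat_real {-real n<..<real n} x *\<^sub>R (?k x * char M x) = ?k x * char M x"
          unfolding eventually_sequentially
        proof (intro exI[of _ N] allI impI)
          fix n :: nat assume "N \<le> n"
          then have "\<bar>x\<bar> < real n" using N by linarith
          then have "indicat_real {-real n<..<real n} x = 1" by (auto simp: indicator_def)
          then show "indicat_real {-real n<..<real n} x *\<^sub>R (?k x * char M x) = ?k x * char M x" by simp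
        qed
      qed
      show "AE x in lborel. norm (indicat_real {-real i<..<real i} x *\<^sub>R (?k x * char M x)) \<le> norm (?k x * char M x)" for i
        by (intro AE_I2) (auto simp: indicator_def)
    qed (use int_k in auto)
    ultimately show "(\<lambda>T. CLBINT t=-real T..real T. ?k t * char M t) \<longlonglongrightarrow> (\<integral>t. ?k t * char M t \<partial>lborel)"
      by simp
  qed
  ultimately have eq: "complex_of_real (measure M {a<..b}) = 1 / (2 * pi) * (\<integral>t. ?k t * char M t \<partial>lborel)"
    using LIMSEQ_unique by blast
  have kint: "(\<integral>x. indicator {a..b} x *\<^sub>R iexp (-(t * x)) \<partial>lborel) = ?k t" if "t \<noteq> 0" for t
  proof -
    have "(\<integral>x. indicator {a..b} x *\<^sub>R iexp (-(t * x)) \<partial>lborel) = (iexp (-(t * b)) / (- \<i> * t)) - (iexp (-(t * a)) / (- \<i> * t))"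
    proof (rule integral_FTC_atLeastAtMost[OF ab])
      show "((\<lambda>x. iexp (-(t * x)) / (- \<i> * t)) has_vector_derivative iexp (-(t * x))) (at x within {a..b})" for x
        using that by (auto intro!: derivative_eq_intros has_vector_derivative_real_field simp: field_simps)
      show "continuous_on {a..b} (\<lambda>x. iexp (-(t * x)))" by (intro continuous_intros)
    qed
    then show ?thesis using that by (simp add: field_simps)
  qed
  have intp: "integrable (lborel \<Otimes>\<^sub>M lborel) (\<lambda>(x, t). indicator {a..b} x *\<^sub>R (iexp (-(t * x)) * char M t))"
  proof (rule lborel_pair.Fubini_integrable)
    have n1: "norm (indicator {a..b} x *\<^sub>R (iexp (-(t * x)) * char M t)) = indicator {a..b} x * norm (char M t)" for x t
      by (simp only: norm_scaleR norm_mult norm_exp_i_times) simp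
    show "integrable lborel (\<lambda>x. \<integral>t. norm (case (x, t) of (x, t) \<Rightarrow> indicator {a..b} x *\<^sub>R (iexp (-(t * x)) * char M t)) \<partial>lborel)"
      unfolding prod.case n1 integral_mult_right_zero
      by (intro integrable_mult_left integrable_real_indicator) (use ab in auto)
    show "AE x in lborel. integrable lborel (\<lambda>y. case (x, y) of (x, t) \<Rightarrow> indicat_real {a..b} x *\<^sub>R (iexp (- (t * x)) * char M t))"
    proof (intro AE_I2)
      fix x
      have "integrable lborel (\<lambda>t. iexp (- (t * x)) * char M t)"
        by (rule Bochner_Integration.integrable_bound[OF int])
           (measurable, intro AE_I2, simp only: norm_mult norm_exp_i_times mult_1 order_refl)
      then show "integrable lborel (\<lambda>y. case (x, y) of (x, t) \<Rightarrow> indicat_real {a..b} x *\<^sub>R (iexp (- (t * x)) * char M t))"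
        by simp
    qed
  qed simp
  have "(LBINT x:{a..b}. (\<integral>t. iexp (-(t * x)) * char M t \<partial>lborel) / (2 * pi))
      = 1 / (2 * pi) * (\<integral>x. (\<integral>t. indicator {a..b} x *\<^sub>R (iexp (-(t * x)) * char M t) \<partial>lborel) \<partial>lborel)"
    by (simp add: set_lebesgue_integral_def field_simps)
  also have "(\<integral>x. (\<integral>t. indicator {a..b} x *\<^sub>R (iexp (-(t * x)) * char M t) \<partial>lborel) \<partial>lborel)
      = (\<integral>t. (\<integral>x. indicator {a..b} x *\<^sub>R (iexp (-(t * x)) * char M t) \<partial>lborel) \<partial>lborel)"
    by (rule lborel_pair.Fubini_integral[OF intp, symmetric])
  also have "\<dots> = (\<integral>t. (\<integral>x. indicator {a..b} x *\<^sub>R iexp (-(t * x)) \<partial>lborel) * char M t \<partial>lborel)"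
    by (intro Bochner_Integration.integral_cong refl, subst integral_mult_left_zero[symmetric]) (simp add: mult_ac)
  also have "\<dots> = (\<integral>t. ?k t * char M t \<partial>lborel)"
  \<comment> \<open>At \<open>t = 0\<close> the quotient is 0 by the convention for division,
    whereas the inner integral is \<open>b - a\<close>; hence an identity almost everywhere.\<close>
  proof (rule integral_cong_AE)
    show "AE t in lborel. (\<integral>x. indicator {a..b} x *\<^sub>R iexp (-(t * x)) \<partial>lborel) * char M t = ?k t * char M t"
      using AE_lborel_singleton[of 0] by eventually_elim (simp add: kint del: of_real_minus of_real_mult)
  qed measurable
  finally show ?thesis using eq by simp
qed

lemma (in real_distribution) cnj_char: "cnj (char M t) = char M (- t)"
proof -
  have "cnj (\<integral>x. iexp (t * x) \<partial>M) = (\<integral>x. cnj (iexp (t * x)) \<partial>M)" by (rule Bochner_Integration.integral_cnj[symmetric])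
  also have "\<dots> = (\<integral>x. iexp (- t * x) \<partial>M)" by (intro Bochner_Integration.integral_cong refl) (simp add: exp_cnj)
  finally show ?thesis by (simp only: char_def)
qed

text \<open>The inversion formula needs endpoints that are not atoms. All but countably many points
  qualify, and on intervals with such endpoints the mass is at most \<open>C\<close> times the
  length. Shrinking these intervals around a point excludes atoms altogether, after which the
  formula holds for every interval and determines the measure.\<close>

lemma (in real_distribution) integrable_char_density:
  assumes int: "integrable lborel (char M)"
  defines "q \<equiv> \<lambda>x. (\<integral>t. iexp (-(t * x)) * char M t \<partial>lborel) / (2 * pi)"
  shows "continuous_on UNIV q" "\<And>x. complex_of_real (Re (q x)) = q x" "\<And>x. 0 \<le> Re (q x)"
    and "M = density lborel (\<lambda>x. ennreal (Re (q x)))"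
proof -
  have [measurable]: "char M \<in> borel_measurable borel" using int by auto
  show cont: "continuous_on UNIV q"
    unfolding q_def by (intro continuous_intros continuous_inverse_Fourier int) auto
  have contR: "continuous_on A (\<lambda>x. Re (q x))" for A
    by (intro continuous_intros continuous_on_subset[OF cont]) auto
  have [measurable]: "q \<in> borel_measurable borel"
    using cont by (rule borel_measurable_continuous_onI)
  \<comment> \<open>The reflection of \<open>t\<close> to \<open>- t\<close> carries the conjugate
    integral back to the original one.\<close>
  show real: "complex_of_real (Re (q x)) = q x" for x
  proof -
    have "cnj (\<integral>t. iexp (-(t * x)) * char M t \<partial>lborel) = (\<integral>t. cnj (iexp (-(t * x)) * char M t) \<partial>lborel)"
      by (rule Bochner_Integration.integral_cnj[symmetric])
    also have "\<dots> = (\<integral>t. iexp (t * x) * char M (- t) \<partial>lborel)"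
      by (intro Bochner_Integration.integral_cong refl) (simp add: exp_cnj cnj_char)
    also have "\<dots> = (\<integral>t. iexp (-(t * x)) * char M t \<partial>lborel)"
      by (subst lborel_integral_real_affine[where c="-1" and t=0]) auto
    finally have "cnj (q x) = q x" by (simp add: q_def)
    then show ?thesis by (simp add: complex_eq_iff)
  qed
  define C where "C = (\<integral>t. norm (char M t) \<partial>lborel) / (2 * pi)"
  have C: "norm (q x) \<le> C" for x
  proof -
    have "norm (\<integral>t. iexp (-(t * x)) * char M t \<partial>lborel) \<le> (\<integral>t. norm (iexp (-(t * x)) * char M t) \<partial>lborel)"
      by (rule integral_norm_bound)
    also have "\<dots> = (\<integral>t. norm (char M t) \<partial>lborel)"
      unfolding norm_mult norm_exp_i_times by simp
    finally show ?thesis by (simp add: q_def C_def norm_divide divide_right_mono)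
  qed
  then have "0 \<le> C" using norm_ge_zero order_trans by blast
  have intq: "set_integrable lborel {a..b} (\<lambda>x. Re (q x))" for a b
    by (intro borel_integrable_atLeastAtMost' contR)
  have Ioc: "measure M {a<..b} = (LBINT x:{a..b}. Re (q x))"
    if "a \<le> b" "measure M {a} = 0" "measure M {b} = 0" for a b
  proof -
    have "complex_of_real (measure M {a<..b}) = (LBINT x:{a..b}. q x)"
      using integrable_char_measure_Ioc[OF int that] by (simp add: q_def)
    also have "\<dots> = (LBINT x:{a..b}. complex_of_real (Re (q x)))" unfolding real ..
    also have "\<dots> = complex_of_real (LBINT x:{a..b}. Re (q x))"
      by (rule set_integral_complex_of_real)
    finally show ?thesis by (simp only: of_real_eq_iff)
  qed
  have Ibd: "(LBINT x:{a..b}. Re (q x)) \<le> C * (b - a)" if "a \<le> b" for a b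
  proof -
    have "(LBINT x:{a..b}. Re (q x)) \<le> (LBINT x:{a..b}. C)"
    proof (intro set_integral_mono intq)
      show "Re (q x) \<le> C" for x using complex_Re_le_cmod[of "q x"] C[of x] by linarith
    qed (simp add: borel_integrable_atLeastAtMost')
    also have "\<dots> = C * (b - a)" using that by (simp add: set_lebesgue_integral_def)
    finally show ?thesis .
  qed
  have cnt: "countable {x. measure M {x} \<noteq> 0}" by (rule countable_support)
  have dense: "\<exists>z. a < z \<and> z < b \<and> measure M {z} = 0" if "a < b" for a b :: real
  proof -
    have "uncountable ({a<..<b} - {x. measure M {x} \<noteq> 0})"
      using that uncountable_minus_countable[OF _ cnt] uncountable_open_interval by blast
    then have "{a<..<b} - {x. measure M {x} \<noteq> 0} \<noteq> {}" by (metis countable_empty)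
    then show ?thesis by auto
  qed
  have atomless: "measure M {x} = 0" for x
  proof -
    have "measure M {x} \<le> 0 + e" if e: "0 < e" for e
    proof -
      \<comment> \<open>An interval of length below \<open>2 * d\<close> then has mass at most
        \<open>(C + 1) * (2 * d) = e\<close>; the summand 1 guards against
        \<open>C = 0\<close>.\<close>
      define d where "d = e / (2 * (C + 1))"
      have d: "0 < d" using e \<open>0 \<le> C\<close> by (simp add: d_def)
      obtain a b where ab: "x - d < a" "a < x" "measure M {a} = 0" "x < b" "b < x + d" "measure M {b} = 0"
        using dense[of "x - d" x] dense[of x "x + d"] d
        by (metis diff_less_eq less_add_same_cancel1)
      have "measure M {x} \<le> measure M {a<..b}" using ab by (intro finite_measure_mono) auto
      also have "\<dots> \<le> C * (b - a)" using ab Ioc[of a b] Ibd[of a b] by linarith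
      also have "\<dots> \<le> (C + 1) * (2 * d)" using ab \<open>0 \<le> C\<close> d by (intro mult_mono) auto
      also have "\<dots> = e" using \<open>0 \<le> C\<close> by (simp add: d_def field_simps)
      finally show ?thesis by simp
    qed
    then show ?thesis by (meson field_le_epsilon measure_nonneg order_antisym)
  qed
  show nn: "0 \<le> Re (q x)" for x
  proof (rule ccontr)
    assume "\<not> 0 \<le> Re (q x)"
    then have neg: "Re (q x) < 0" by simp
    \<comment> \<open>Half the depth of the supposed negative value: by continuity the density stays
      below \<open>- c\<close> on a short interval, whose mass would be negative.\<close>
    define c where "c = - Re (q x) / 2"
    have c: "0 < c" using neg by (simp add: c_def)
    obtain d where d: "0 < d" "\<And>y. dist y x < d \<Longrightarrow> dist (Re (q y)) (Re (q x)) < c"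
      using contR[of UNIV] c unfolding continuous_on_iff by (metis UNIV_I)
    have "0 \<le> measure M {x<..x + d / 2}" by simp
    also have "\<dots> = (LBINT y:{x..x + d/2}. Re (q y))" using d atomless by (intro Ioc) auto
    also have "\<dots> \<le> (LBINT y:{x..x + d/2}. - c)"
    proof (intro set_integral_mono intq)
      fix y assume "y \<in> {x..x + d / 2}"
      then have "dist y x < d" using d by (auto simp: dist_real_def)
      from d(2)[OF this] show "Re (q y) \<le> - c" by (auto simp: dist_real_def c_def abs_if field_simps split: if_splits)
    qed (simp add: borel_integrable_atLeastAtMost')
    also have "\<dots> = - c * (d / 2)" using d by (simp add: set_lebesgue_integral_def)
    also have "\<dots> < 0" using c d by simp
    finally show False by simp
  qed
  show "M = density lborel (\<lambda>x. ennreal (Re (q x)))"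
  proof (rule measure_eqI_generator_eq[where E="range (\<lambda>(a, b). {a<..b::real})" and A="\<lambda>i. {- real i<..real i}" and \<Omega>=UNIV])
    show "Int_stable (range (\<lambda>(a, b). {a<..b::real}))"
    proof (rule Int_stableI_image)
      fix i j :: "real \<times> real"
      have "(case i of (a, b) \<Rightarrow> {a<..b}) \<inter> (case j of (a, b) \<Rightarrow> {a<..b})
        = (case (max (fst i) (fst j), min (snd i) (snd j)) of (a, b) \<Rightarrow> {a<..b})"
        by (auto split: prod.splits)
      then show "\<exists>k\<in>UNIV. (case i of (a, b) \<Rightarrow> {a<..b}) \<inter> (case j of (a, b) \<Rightarrow> {a<..b}) = (case k of (a, b) \<Rightarrow> {a<..b})"
        by blast
    qed
    show "sets M = sigma_sets UNIV (range (\<lambda>(a, b). {a<..b::real}))"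
      by (simp add: borel_sigma_sets_Ioc)
    then show "sets (density lborel (\<lambda>x. ennreal (Re (q x)))) = sigma_sets UNIV (range (\<lambda>(a, b). {a<..b::real}))"
      by simp
    show "(\<Union>i. {- real i<..real i}) = UNIV"
    proof -
      have "\<exists>i. x \<in> {- real i<..real i}" for x
      proof -
        obtain n where "\<bar>x\<bar> < real n" using reals_Archimedean2 by blast
        then show ?thesis by (intro exI[of _ n]) auto
      qed
      then show ?thesis by blast
    qed
    fix X assume "X \<in> range (\<lambda>(a, b). {a<..b::real})"
    then obtain a b where X: "X = {a<..b}" by auto
    show "emeasure M X = emeasure (density lborel (\<lambda>x. ennreal (Re (q x)))) X"
    proof (cases "a \<le> b")
      case True
      have "emeasure (density lborel (\<lambda>x. ennreal (Re (q x)))) X = (\<integral>\<^sup>+x. ennreal (Re (q x)) * indicator {a<..b} x \<partial>lborel)"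
        by (simp add: X emeasure_density)
      also have "\<dots> = (\<integral>\<^sup>+x. ennreal (indicator {a..b} x *\<^sub>R Re (q x)) \<partial>lborel)"
        by (intro nn_integral_cong_AE, use AE_lborel_singleton[of a] in eventually_elim) (auto simp: indicator_def)
      also have "\<dots> = ennreal (LBINT x:{a..b}. Re (q x))"
        unfolding set_lebesgue_integral_def using intq[of a b] nn
        by (intro nn_integral_eq_integral) (auto simp: set_integrable_def)
      also have "\<dots> = emeasure M X"
        using True atomless by (simp add: X emeasure_eq_measure Ioc)
      finally show ?thesis ..
    qed (simp add: X)
  qed auto
qed

section \<open>Kernels in logarithmic coordinates\<close>

lemma exp_exp_tendsto_0:
  fixes c \<nu> :: real
  assumes "0 < c" "0 < \<nu>"
  shows "((\<lambda>t. exp (- c * exp t + \<nu> * t)) \<longlongrightarrow> 0) at_top" "((\<lambda>t. exp (- c * exp t + \<nu> * t)) \<longlongrightarrow> 0) at_bot"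
  using assms by real_asymp+

text \<open>The Gamma integrand \<open>s powr (\<nu> - 1) * exp (- c * s)\<close> at
  \<open>s = exp t\<close>. It is the majorant for all kernels in logarithmic coordinates.\<close>

lemma integrable_exp_exp:
  fixes c \<nu> :: real
  assumes "0 < c" "0 < \<nu>"
  shows "integrable lborel (\<lambda>t. exp (- c * exp t + \<nu> * t))"
proof -
  let ?f = "\<lambda>s. s powr (\<nu> - 1) * exp (- c * s)"
  have "(\<lambda>t. norm (complex_of_real t powr (of_real \<nu> - 1) / of_real (exp (c * t)))) absolutely_integrable_on {0<..}"
    using absolutely_integrable_Gamma_integral[of "of_real \<nu>" c] assms
    by (intro set_integrable_norm) simp
  moreover have "norm (complex_of_real t powr (of_real \<nu> - 1) / of_real (exp (c * t))) = ?f t" if "t \<in> {0<..}" for t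
    using that by (simp add: norm_divide norm_powr_real_powr exp_minus field_simps)
  ultimately have "?f absolutely_integrable_on {0<..}"
    by (subst (asm) set_integrable_cong[OF refl refl]) auto
  then have "set_integrable lborel {0<..} ?f"
    unfolding set_integrable_def by (subst (asm) integrable_completion) auto
  then have "integrable lborel (\<lambda>t. exp t *\<^sub>R ?f (exp t))"
    by (subst integral_exp_substitution(1)) (auto simp: set_borel_measurable_def)
  moreover have "exp t *\<^sub>R ?f (exp t) = exp (- c * exp t + \<nu> * t)" for t :: real
  proof -
    have "exp t *\<^sub>R ?f (exp t) = exp (t + ((\<nu> - 1) * t + - c * exp t))" by (simp only: exp_add powr_def) simp
    also have "t + ((\<nu> - 1) * t + - c * exp t) = - c * exp t + \<nu> * t" by (simp add: algebra_simps)
    finally show ?thesis .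
  qed
  ultimately show ?thesis by simp
qed

text \<open>An entire function has residue 0 everywhere, so the midpoint of the strip can play the
  pole in \<open>strip_residue\<close>.\<close>

lemma strip_shift:
  fixes f :: "complex \<Rightarrow> complex"
  assumes hol: "f holomorphic_on UNIV" and "a < b"
    and bound: "\<And>t y. a \<le> y \<Longrightarrow> y \<le> b \<Longrightarrow> norm (f (Complex t y)) \<le> B t"
    and B: "integrable lborel B" "(B \<longlongrightarrow> 0) at_top" "(B \<longlongrightarrow> 0) at_bot"
  shows "(\<integral>t. f (Complex t a) \<partial>lborel) = (\<integral>t. f (Complex t b) \<partial>lborel)"
proof -
  have "continuous_on UNIV (\<lambda>t. f (Complex t y))" for y
    unfolding Complex_eq by (intro continuous_on_compose2[OF holomorphic_on_imp_continuous_on[OF hol]] continuous_intros) auto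
  then have [measurable]: "(\<lambda>t. f (Complex t y)) \<in> borel_measurable borel" for y
    by (rule borel_measurable_continuous_onI)
  have int: "integrable lborel (\<lambda>t. f (Complex t y))" if "a \<le> y" "y \<le> b" for y
  proof (rule Bochner_Integration.integrable_bound[OF B(1)])
    show "AE t in lborel. norm (f (Complex t y)) \<le> norm (B t)"
      using bound[OF that] by (intro AE_I2) (smt (verit) real_norm_def)
  qed simp
  have "(\<integral>t. f (Complex t a) \<partial>lborel) - (\<integral>t. f (Complex t b) \<partial>lborel) = 2 * pi * \<i> * residue f (Complex 0 ((a + b) / 2))"
    using \<open>a < b\<close>
    by (intro strip_residue[where a'="a - 1" and b'="b + 1" and B=B and K=0] bound int B
          holomorphic_on_subset[OF hol]) auto
  also have "residue f (Complex 0 ((a + b) / 2)) = 0"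
    using hol by (intro residue_holo[of UNIV]) auto
  finally show ?thesis by simp
qed

lemma cos_ge_half: "1 / 2 \<le> cos y" if "\<bar>y\<bar> \<le> pi / 3" for y :: real
proof -
  have "cos (pi / 3) \<le> cos \<bar>y\<bar>" using that pi_gt_zero by (intro cos_monotone_0_pi_le) auto
  then show ?thesis by (simp add: cos_60)
qed

text \<open>For \<open>\<bar>\<gamma>\<bar> \<le> pi / 3\<close> the angle
  \<open>3 / 2 * \<gamma>\<close> stays within pi/2 of the real axis, so the term with
  \<open>y\<close> has the favourable sign, and \<open>cos \<gamma> \<ge> 1 / 2\<close> preserves
  half of the decay rate \<open>x\<close>. The resulting majorant does not depend on
  \<open>y\<close>, which Fubini will require.\<close>

lemma rotated_Laplace_kernel:
  fixes x y \<nu> \<gamma> :: real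
  assumes "0 < x" "0 \<le> y" "0 < \<nu>" "\<bar>\<gamma>\<bar> \<le> pi / 3"
  defines "f \<equiv> \<lambda>\<zeta>. exp (- of_real x * exp \<zeta> - of_real y * exp (3 / 2 * \<zeta>) + of_real \<nu> * \<zeta>)"
  shows "norm (f (Complex t \<gamma>)) \<le> exp (- (x / 2) * exp t + \<nu> * t)"
    and "(\<integral>t. f (Complex t \<gamma>) \<partial>lborel) = (\<integral>t. f (of_real t) \<partial>lborel)"
proof -
  have bound: "norm (f (Complex t \<gamma>)) \<le> exp (- (x / 2) * exp t + \<nu> * t)" if "\<bar>\<gamma>\<bar> \<le> pi / 3" for t \<gamma>
  proof -
    have "0 \<le> cos (3 / 2 * \<gamma>)" using that by (intro cos_ge_zero) auto
    then have 1: "0 \<le> y * (exp (3 / 2 * t) * cos (3 / 2 * \<gamma>))" using assms by simp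
    have "exp t * (1 / 2) \<le> exp t * cos \<gamma>" using cos_ge_half[OF that] by (intro mult_left_mono) auto
    then have 2: "x * (exp t * (1 / 2)) \<le> x * (exp t * cos \<gamma>)" using assms by (intro mult_left_mono) auto
    show ?thesis using 1 2 by (simp add: f_def Re_exp Im_exp)
  qed
  then show "norm (f (Complex t \<gamma>)) \<le> exp (- (x / 2) * exp t + \<nu> * t)" using assms by simp
  have hol: "f holomorphic_on UNIV" unfolding f_def by (intro holomorphic_intros)
  have B: "integrable lborel (\<lambda>t. exp (- (x / 2) * exp t + \<nu> * t))"
    "((\<lambda>t. exp (- (x / 2) * exp t + \<nu> * t)) \<longlongrightarrow> 0) at_top" "((\<lambda>t. exp (- (x / 2) * exp t + \<nu> * t)) \<longlongrightarrow> 0) at_bot"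
    using assms integrable_exp_exp[of "x/2" \<nu>] exp_exp_tendsto_0[of "x/2" \<nu>] by auto
  have "(\<integral>t. f (Complex t \<gamma>) \<partial>lborel) = (\<integral>t. f (Complex t 0) \<partial>lborel)"
  proof (cases \<gamma> "0::real" rule: linorder_cases)
    case less
    then show ?thesis using assms by (intro strip_shift[OF hol less _ B] bound) auto
  next
    case greater
    then show ?thesis using assms by (intro strip_shift[OF hol greater _ B, symmetric] bound) auto
  qed simp
  then show "(\<integral>t. f (Complex t \<gamma>) \<partial>lborel) = (\<integral>t. f (of_real t) \<partial>lborel)" by (simp add: complex_of_real_def)
qed

text \<open>
  With \<open>s = exp \<zeta>\<close>, the two lines are the rays \<open>arg s = \<plusminus>\<pi>/3\<close> and \<open>p\<close> is the only zero of the
  denominator between them.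
\<close>

lemma residue_kernel:
  fixes \<theta> c x \<nu> :: real
  assumes \<theta>: "\<bar>\<theta>\<bar> < pi / 2" and "0 < c" "0 < x" "0 < \<nu>"
  defines "w \<equiv> of_real c * exp (\<i> * of_real \<theta>)"
  defines "p \<equiv> Complex (2 / 3 * ln (c / x)) (2 / 3 * \<theta>)"
  defines "g \<equiv> \<lambda>\<zeta>. exp (- exp (\<zeta> + \<i> * of_real (\<theta> / 3)) + of_real \<nu> * \<zeta>)"
  defines "f \<equiv> \<lambda>\<zeta>. g \<zeta> / (w - of_real x * exp (3 / 2 * \<zeta>))"
  shows "(\<integral>t. f (Complex t (pi / 3)) \<partial>lborel) - (\<integral>t. f (Complex t (- pi / 3)) \<partial>lborel) = 4 * pi * \<i> / 3 * g p / w"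
proof -
  \<comment> \<open>The smallest value of \<open>cos (y + \<theta> / 3)\<close> that the strip
    \<open>\<bar>y\<bar> \<le> pi / 3\<close> allows; the angle is below pi/2 because
    \<open>\<bar>\<theta>\<bar> < pi / 2\<close>.\<close>
  define \<kappa> where "\<kappa> = cos (pi / 3 + \<bar>\<theta>\<bar> / 3)"
  have \<kappa>: "0 < \<kappa>" unfolding \<kappa>_def using \<theta> by (intro cos_gt_zero_pi) auto
  have gbound: "norm (g (Complex t y)) \<le> exp (- \<kappa> * exp t + \<nu> * t)" if "\<bar>y\<bar> \<le> pi / 3" for t y
  proof -
    have "\<kappa> \<le> cos \<bar>y + \<theta> / 3\<bar>" unfolding \<kappa>_def using that \<theta> by (intro cos_monotone_0_pi_le) auto
    then have "\<kappa> * exp t \<le> cos (y + \<theta> / 3) * exp t" by (intro mult_right_mono) auto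
    then show ?thesis by (simp add: g_def Re_exp algebra_simps)
  qed
  have rew: "Re w = c * cos \<theta>" "norm w = c" using assms by (auto simp: w_def Re_exp norm_mult)
  have Rew: "0 < Re w" unfolding rew using assms by (intro mult_pos_pos cos_gt_zero_pi) auto
  have exp_p: "of_real x * exp (3 / 2 * p) = w"
  proof -
    have "3 / 2 * p = of_real (ln (c / x)) + \<i> * of_real \<theta>"
      by (simp add: p_def complex_eq_iff)
    then have "exp (3 / 2 * p) = exp (of_real (ln (c / x)) + \<i> * of_real \<theta>)" by (rule arg_cong)
    also have "\<dots> = of_real (c / x) * exp (\<i> * of_real \<theta>)"
      using assms by (simp only: exp_add exp_of_real) (simp add: exp_of_real)
    finally show ?thesis using assms by (simp add: w_def)
  qed
  \<comment> \<open>The zeros of the denominator differ by multiples of 4 pi i/3. Since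
    \<open>\<bar>Im p\<bar> < pi / 3\<close>, points of \<open>U\<close> have imaginary parts within
    distance pi of \<open>Im p\<close>. So this strip leaves a margin around the lines at height
    pi/3 and -pi/3 and still contains no other zero.\<close>
  define U where "U = {z. - (2 * pi / 3) < Im z \<and> Im z < 2 * pi / 3}"
  have U: "U = {z. - (2 * pi / 3) < Im z} \<inter> {z. Im z < 2 * pi / 3}" by (auto simp: U_def)
  have "open U" unfolding U by (intro open_Int open_halfspace_Im_gt open_halfspace_Im_lt)
  have "convex U" unfolding U by (intro convex_Int convex_halfspace_Im_gt convex_halfspace_Im_lt)
  then have "connected U" by (rule convex_connected)
  have pU: "p \<in> U" using \<theta> by (auto simp: U_def p_def)
  have nz: "w - of_real x * exp (3 / 2 * \<zeta>) \<noteq> 0" if "\<zeta> \<in> U - {p}" for \<zeta>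
  proof
    assume "w - of_real x * exp (3 / 2 * \<zeta>) = 0"
    then have "exp (3 / 2 * \<zeta>) = exp (3 / 2 * p)" using exp_p assms by auto
    then obtain n :: int where n: "3 / 2 * \<zeta> = 3 / 2 * p + of_int (2 * n) * pi * \<i>" unfolding exp_eq by auto
    then have "Re \<zeta> = Re p" "3 / 2 * Im \<zeta> = 3 / 2 * Im p + 2 * (n * pi)"
      by (auto simp: complex_eq_iff)
    moreover have "\<bar>Im \<zeta>\<bar> < 2 * pi / 3" "\<bar>Im p\<bar> < pi / 3" using that \<theta> by (auto simp: U_def p_def)
    ultimately have "\<bar>real_of_int n * pi\<bar> < 1 * pi" by argo
    then have "\<bar>real_of_int n\<bar> < 1" by (simp add: abs_mult)
    then have "n = 0" by linarith
    with n that show False by simp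
  qed
  have hol_g: "g holomorphic_on A" for A unfolding g_def by (intro holomorphic_intros)
  have "residue f p = g p / (- (of_real x * (exp (3 / 2 * p) * (3 / 2))))"
    unfolding f_def
  proof (rule residue_simple_pole_deriv[where s=U])
    show "((\<lambda>w'. w - of_real x * exp (3 / 2 * w')) has_field_derivative - (of_real x * (exp (3 / 2 * p) * (3 / 2)))) (at p)"
      by (auto intro!: derivative_eq_intros)
    show "(\<lambda>w'. w - of_real x * exp (3 / 2 * w')) holomorphic_on U" by (intro holomorphic_intros)
    show "g p \<noteq> 0" by (simp add: g_def)
    show "w - of_real x * exp (3 / 2 * p) = 0" using exp_p by simp
    show "- (of_real x * (exp (3 / 2 * p) * (3 / 2))) \<noteq> 0" using \<open>0 < x\<close> by simp
  qed fact+
  also have "\<dots> = - (2 / 3) * g p / w" unfolding exp_p[symmetric] using assms by (simp add: field_simps)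
  finally have res: "residue f p = - (2 / 3) * g p / w" .
  have contg: "continuous_on UNIV (\<lambda>t. g (Complex t y))" for y
    unfolding Complex_eq g_def by (intro continuous_intros)
  then have [measurable]: "(\<lambda>t. g (Complex t y)) \<in> borel_measurable borel" for y
    by (rule borel_measurable_continuous_onI)
  have "continuous_on UNIV (\<lambda>t. exp (3 / 2 * Complex t y))" for y
    unfolding Complex_eq by (intro continuous_intros)
  then have [measurable]: "(\<lambda>t. exp (3 / 2 * Complex t y)) \<in> borel_measurable borel" for y
    by (rule borel_measurable_continuous_onI)
  have [measurable]: "(\<lambda>t. f (Complex t y)) \<in> borel_measurable borel" for y
    unfolding f_def by measurable
  have intB: "integrable lborel (\<lambda>t. exp (- \<kappa> * exp t + \<nu> * t))" by (rule integrable_exp_exp) fact+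
  have int: "integrable lborel (\<lambda>t. f (Complex t y))" if "y = pi / 3 \<or> y = - pi / 3" for y
  proof (rule Bochner_Integration.integrable_bound[where f="\<lambda>t. exp (- \<kappa> * exp t + \<nu> * t) / Re w"])
    show "AE t in lborel. norm (f (Complex t y)) \<le> norm (exp (- \<kappa> * exp t + \<nu> * t) / Re w)"
    proof (intro AE_I2)
      fix t
      \<comment> \<open>On the two boundary lines \<open>exp (3 / 2 * \<zeta>)\<close> is purely
        imaginary, so the real part of the denominator is \<open>Re w\<close>.\<close>
      have "3 / 2 * y = pi / 2 \<or> 3 / 2 * y = - (pi / 2)" using that by auto
      then have "cos (3 / 2 * y) = 0" by (metis cos_minus cos_pi_half)
      then have "Re (exp (3 / 2 * Complex t y)) = 0" by (simp add: Re_exp)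
      then have "Re w \<le> norm (w - of_real x * exp (3 / 2 * Complex t y))"
        using complex_Re_le_cmod[of "w - of_real x * exp (3 / 2 * Complex t y)"] by simp
      moreover have "\<bar>y\<bar> \<le> pi / 3" using that by (auto simp: abs_if)
      ultimately have "norm (f (Complex t y)) \<le> exp (- \<kappa> * exp t + \<nu> * t) / Re w"
        unfolding f_def norm_divide using Rew by (intro frac_le gbound) auto
      then show "norm (f (Complex t y)) \<le> norm (exp (- \<kappa> * exp t + \<nu> * t) / Re w)" using Rew by simp
    qed
  qed (use intB in auto)
  \<comment> \<open>Beyond \<open>K\<close> the modulus \<open>x * exp (3 / 2 * t)\<close> is at
    least \<open>2 * c\<close> or at most \<open>c / 2\<close>, while \<open>norm w = c\<close>.
    This keeps the denominator away from 0 on the whole vertical side.\<close>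
  define K where "K = \<bar>ln (2 * c / x)\<bar> + \<bar>ln (c / (2 * x))\<bar>"
  have side: "norm (f (Complex t y)) \<le> 2 / c * exp (- \<kappa> * exp t + \<nu> * t)"
    if "- pi / 3 \<le> y" "y \<le> pi / 3" "K \<le> \<bar>t\<bar>" for t y
  proof -
    have n1: "norm (of_real x * exp (3 / 2 * Complex t y)) = x * exp (3 / 2 * t)" using assms by (simp add: norm_mult)
    have "c / 2 \<le> norm (w - of_real x * exp (3 / 2 * Complex t y))"
    proof (cases "t \<ge> 0")
      case True
      then have "ln (2 * c / x) \<le> 3 / 2 * t" using that by (auto simp: K_def)
      then have "2 * c / x \<le> exp (3 / 2 * t)" using assms by (metis divide_pos_pos exp_le_cancel_iff exp_ln mult_pos_pos zero_less_numeral)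
      then have "2 * c \<le> x * exp (3 / 2 * t)" using assms by (simp add: field_simps)
      then show ?thesis using n1 norm_triangle_ineq3[of "of_real x * exp (3 / 2 * Complex t y)" w] rew assms
        by (simp add: norm_minus_commute)
    next
      case False
      then have "3 / 2 * t \<le> ln (c / (2 * x))" using that by (auto simp: K_def)
      then have "exp (3 / 2 * t) \<le> c / (2 * x)" using assms by (metis divide_pos_pos exp_le_cancel_iff exp_ln mult_pos_pos zero_less_numeral)
      then have "x * exp (3 / 2 * t) \<le> c / 2" using assms by (simp add: field_simps)
      then show ?thesis using n1 norm_triangle_ineq3[of w "of_real x * exp (3 / 2 * Complex t y)"] rew assms
        by simp
    qed
    then have "norm (f (Complex t y)) \<le> exp (- \<kappa> * exp t + \<nu> * t) / (c / 2)"
      unfolding f_def norm_divide using that assms by (intro frac_le gbound) auto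
    then show ?thesis by (simp add: field_simps)
  qed
  have lim: "((\<lambda>t. 2 / c * exp (- \<kappa> * exp t + \<nu> * t)) \<longlongrightarrow> 2 / c * 0) at_top"
       "((\<lambda>t. 2 / c * exp (- \<kappa> * exp t + \<nu> * t)) \<longlongrightarrow> 2 / c * 0) at_bot"
    by (intro tendsto_intros exp_exp_tendsto_0 \<kappa> assms)+
  have "(\<integral>t. f (Complex t (- pi / 3)) \<partial>lborel) - (\<integral>t. f (Complex t (pi / 3)) \<partial>lborel) = 2 * pi * \<i> * residue f p"
  proof (rule strip_residue[where a'="- (2 * pi / 3)" and b'="2 * pi / 3" and K=K and B="\<lambda>t. 2 / c * exp (- \<kappa> * exp t + \<nu> * t)"])
    show "f holomorphic_on {z. - (2 * pi / 3) < Im z \<and> Im z < 2 * pi / 3} - {p}"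
      unfolding f_def using nz by (intro holomorphic_intros hol_g) (auto simp: U_def)
    show "- pi / 3 < Im p" "Im p < pi / 3" using \<theta> by (auto simp: p_def)
  qed (use int side lim in auto)
  then show ?thesis by (simp add: res algebra_simps)
qed

section \<open>Parameter integrals\<close>

lemma (in pair_sigma_finite) Fubini_dominated:
  fixes f :: "'a \<Rightarrow> 'b \<Rightarrow> 'c::{banach, second_countable_topology}"
  assumes f [measurable]: "case_prod f \<in> borel_measurable (M1 \<Otimes>\<^sub>M M2)"
    and g: "integrable M1 g" and h: "integrable M2 h"
    and bound: "\<And>x y. norm (f x y) \<le> g x * (h y :: real)"
  shows "integrable (M1 \<Otimes>\<^sub>M M2) (case_prod f)"
    and "(\<integral>y. (\<integral>x. f x y \<partial>M1) \<partial>M2) = (\<integral>x. (\<integral>y. f x y \<partial>M2) \<partial>M1)"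
proof -
  have [measurable]: "g \<in> borel_measurable M1" "h \<in> borel_measurable M2" using g h by auto
  have "integrable (M1 \<Otimes>\<^sub>M M2) (\<lambda>(x, y). g x * h y)"
  proof (rule Fubini_integrable)
    show "integrable M1 (\<lambda>x. \<integral>y. norm (case (x, y) of (x, y) \<Rightarrow> g x * h y) \<partial>M2)"
      using g by (simp add: abs_mult)
    show "AE x in M1. integrable M2 (\<lambda>y. case (x, y) of (x, y) \<Rightarrow> g x * h y)"
      using h by simp
  qed simp
  then show "integrable (M1 \<Otimes>\<^sub>M M2) (case_prod f)"
  proof (rule Bochner_Integration.integrable_bound)
    show "AE z in M1 \<Otimes>\<^sub>M M2. norm (case_prod f z) \<le> norm (case z of (x, y) \<Rightarrow> g x * h y)"
      using bound by (intro AE_I2) (auto split: prod.splits intro: order_trans[OF _ abs_ge_self])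
  qed simp
  then show "(\<integral>y. (\<integral>x. f x y \<partial>M1) \<partial>M2) = (\<integral>x. (\<integral>y. f x y \<partial>M2) \<partial>M1)"
    by (rule Fubini_integral)
qed

text \<open>An integrable local bound on \<open>f\<close> alone suffices: Cauchy's inequality turns
  it into a bound on the derivative on the ball of half the radius, and the mean value inequality
  into a bound on the difference quotients, to which dominated convergence applies.\<close>

lemma holomorphic_on_integral:
  fixes f :: "complex \<Rightarrow> 'a \<Rightarrow> complex"
  assumes "open U"
    and hol: "\<And>x. (\<lambda>z. f z x) holomorphic_on U"
    and meas: "\<And>z. z \<in> U \<Longrightarrow> f z \<in> borel_measurable M"
    and dom: "\<And>z. z \<in> U \<Longrightarrow> \<exists>r>0. \<exists>B. cball z r \<subseteq> U \<and> integrable M B \<and> (\<forall>w\<in>cball z r. \<forall>x. norm (f w x) \<le> B x)"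
  shows "(\<lambda>z. \<integral>x. f z x \<partial>M) holomorphic_on U"
proof (unfold holomorphic_on_open[OF \<open>open U\<close>], intro ballI)
  fix z assume z: "z \<in> U"
  obtain r B where r: "0 < r" "cball z r \<subseteq> U" and B: "integrable M B"
    and bd: "\<And>w x. w \<in> cball z r \<Longrightarrow> norm (f w x) \<le> B x"
    using dom[OF z] by metis
  have int: "integrable M (f w)" if "w \<in> cball z r" for w
  proof (rule Bochner_Integration.integrable_bound[OF B])
    show "f w \<in> borel_measurable M" using that r by (intro meas) auto
    show "AE x in M. norm (f w x) \<le> norm (B x)" using bd[OF that] by (intro AE_I2) (smt (verit) real_norm_def)
  qed
  have diff: "((\<lambda>w. f w x) has_field_derivative deriv (\<lambda>w. f w x) w) (at w)" if "w \<in> U" for w x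
    using holomorphic_derivI[OF hol \<open>open U\<close> that] .
  have deriv_bd: "norm (deriv (\<lambda>w. f w x) w) \<le> B x / (r / 2)" if "w \<in> ball z (r / 2)" for w x
  proof -
    have sub: "cball w (r / 2) \<subseteq> cball z r"
    proof
      fix u assume "u \<in> cball w (r / 2)"
      then show "u \<in> cball z r" using that dist_triangle[of z u w] by simp
    qed
    have h: "(\<lambda>w. f w x) holomorphic_on cball w (r / 2)"
      using sub r by (intro holomorphic_on_subset[OF hol]) auto
    have "norm ((deriv ^^ 1) (\<lambda>w. f w x) w) \<le> fact 1 * B x / (r / 2) ^ 1"
    proof (rule Cauchy_inequality)
      show "norm (f u x) \<le> B x" if "norm (w - u) = r / 2" for u
        using that sub by (intro bd) (auto simp: dist_norm)
      show "continuous_on (cball w (r / 2)) (\<lambda>w. f w x)" using h by (rule holomorphic_on_imp_continuous_on)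
      show "(\<lambda>w. f w x) holomorphic_on ball w (r / 2)" using h by (rule holomorphic_on_subset) auto
    qed (use r in auto)
    then show ?thesis by simp
  qed
  have quot: "norm (f w x - f z x) \<le> B x / (r / 2) * norm (w - z)" if "w \<in> ball z (r / 2)" for w x
  proof (rule field_differentiable_bound[where S="ball z (r / 2)" and f'="deriv (\<lambda>w. f w x)"])
    fix u assume u: "u \<in> ball z (r / 2)"
    then have "u \<in> cball z r" using r by simp
    with r(2) have uU: "u \<in> U" by (rule subsetD)
    show "((\<lambda>w. f w x) has_field_derivative deriv (\<lambda>w. f w x) u) (at u within ball z (r / 2))"
      by (rule has_field_derivative_at_within[OF diff[OF uU, of x]])
    show "norm (deriv (\<lambda>w. f w x) u) \<le> B x / (r / 2)" using u by (rule deriv_bd)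
  qed (use r that in simp_all)
  have "((\<lambda>w. ((\<integral>x. f w x \<partial>M) - (\<integral>x. f z x \<partial>M)) / (w - z)) \<longlongrightarrow> (\<integral>x. deriv (\<lambda>w. f w x) z \<partial>M)) (at z)"
    unfolding tendsto_at_iff_sequentially o_def
  proof (intro allI impI)
    fix X :: "nat \<Rightarrow> complex" assume X: "\<forall>i. X i \<in> UNIV - {z}" "X \<longlonglongrightarrow> z"
    have "\<forall>\<^sub>F n in sequentially. X n \<in> ball z (r / 2)"
      using X(2) r by (intro topological_tendstoD) auto
    then obtain N where N: "\<And>n. n \<ge> N \<Longrightarrow> X n \<in> ball z (r / 2)" unfolding eventually_sequentially by blast
    \<comment> \<open>Dropping the first \<open>N\<close> terms puts the whole sequence into the
      half ball, where \<open>quot\<close> dominates.\<close>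
    define Y where "Y n = X (n + N)" for n
    have Yb: "Y n \<in> ball z (r / 2)" for n using N by (simp add: Y_def)
    have Yc: "Y n \<in> cball z r" for n using Yb[of n] r by simp
    have Yz: "Y n \<noteq> z" for n using X(1) by (simp add: Y_def)
    have Ylim: "Y \<longlonglongrightarrow> z" unfolding Y_def by (rule LIMSEQ_ignore_initial_segment[OF X(2)])
    have pt: "(\<lambda>n. (f (Y n) x - f z x) / (Y n - z)) \<longlonglongrightarrow> deriv (\<lambda>w. f w x) z" for x
    proof -
      have "((\<lambda>w. (f w x - f z x) / (w - z)) \<longlongrightarrow> deriv (\<lambda>w. f w x) z) (at z)"
        using diff[OF z, of x] by (simp add: has_field_derivative_iff)
      then show ?thesis unfolding tendsto_at_iff_sequentially o_def using Yz Ylim by auto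
    qed
    have mq: "(\<lambda>x. (f (Y n) x - f z x) / (Y n - z)) \<in> borel_measurable M" for n
      using Yc[of n] r z by (intro borel_measurable_divide borel_measurable_diff meas) auto
    have "(\<lambda>n. \<integral>x. (f (Y n) x - f z x) / (Y n - z) \<partial>M) \<longlonglongrightarrow> (\<integral>x. deriv (\<lambda>w. f w x) z \<partial>M)"
    proof (rule integral_dominated_convergence[where w="\<lambda>x. B x / (r / 2)"])
      show "(\<lambda>x. deriv (\<lambda>w. f w x) z) \<in> borel_measurable M"
        by (rule borel_measurable_LIMSEQ_metric[OF mq pt])
      show "AE x in M. norm ((f (Y n) x - f z x) / (Y n - z)) \<le> B x / (r / 2)" for n
        using quot[OF Yb] Yz[of n] by (intro AE_I2) (simp add: norm_divide divide_le_eq)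
    qed (use mq B pt in auto)
    moreover have "(\<integral>x. (f (Y n) x - f z x) / (Y n - z) \<partial>M) = ((\<integral>x. f (Y n) x \<partial>M) - (\<integral>x. f z x \<partial>M)) / (Y n - z)" for n
      using int[OF Yc[of n]] int[of z] r by simp
    ultimately have "(\<lambda>n. ((\<integral>x. f (Y n) x \<partial>M) - (\<integral>x. f z x \<partial>M)) / (Y n - z)) \<longlonglongrightarrow> (\<integral>x. deriv (\<lambda>w. f w x) z \<partial>M)"
      by (simp only:)
    then show "(\<lambda>n. ((\<integral>x. f (X n) x \<partial>M) - (\<integral>x. f z x \<partial>M)) / (X n - z)) \<longlonglongrightarrow> (\<integral>x. deriv (\<lambda>w. f w x) z \<partial>M)"
      unfolding Y_def by (rule LIMSEQ_offset)
  qed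
  then show "\<exists>f'. ((\<lambda>z. \<integral>x. f z x \<partial>M) has_field_derivative f') (at z)"
    unfolding has_field_derivative_iff by blast
qed

section \<open>Continuation of the gamma--Laplace transform\<close>

text \<open>
  The gamma--Laplace integral along the ray \<open>s = exp (a - \<i>\<epsilon>\<pi>/3)\<close>. On this ray the principal power
  \<open>s^(3/2)\<close> equals \<open>- \<i>\<epsilon> exp (3a/2)\<close>, so the Laplace transform becomes the characteristic function.
\<close>

definition ray_transform :: "real measure \<Rightarrow> real \<Rightarrow> real \<Rightarrow> complex \<Rightarrow> complex" where
  "ray_transform M \<nu> \<epsilon> z =
     (\<integral>a. exp (- z * exp (Complex a (- \<epsilon> * pi / 3)) + of_real \<nu> * Complex a (- \<epsilon> * pi / 3))
        * char M (\<epsilon> * exp (3 / 2 * a)) \<partial>lborel)"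

lemma borel_measurable_Complex [measurable (raw)]:
  assumes "f \<in> borel_measurable M" "g \<in> borel_measurable M"
  shows "(\<lambda>x. Complex (f x) (g x)) \<in> borel_measurable M"
  unfolding Complex_eq using assms by measurable

lemma exp_Complex_split: "exp (Complex a b) = of_real (exp a) * exp (\<i> * of_real b)"
  by (simp add: Complex_eq exp_add exp_of_real)

text \<open>As \<open>char M\<close> is bounded by 1, convergence is governed by the real part
  \<open>k\<close> of \<open>z\<close> times the direction of the ray, and on the ball of radius
  \<open>k / 2\<close> this real part stays above \<open>k / 2\<close>.\<close>

lemma (in real_distribution) holomorphic_ray_transform:
  assumes "0 < \<nu>"
  shows "ray_transform M \<nu> \<epsilon> holomorphic_on {z. 0 < Re (z * exp (\<i> * of_real (- \<epsilon> * pi / 3)))}"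
  unfolding ray_transform_def
proof (rule holomorphic_on_integral)
  let ?e = "exp (\<i> * of_real (- \<epsilon> * pi / 3))"
  let ?U = "{z. 0 < Re (z * ?e)}"
  let ?f = "\<lambda>z a. exp (- z * exp (Complex a (- \<epsilon> * pi / 3)) + of_real \<nu> * Complex a (- \<epsilon> * pi / 3))
        * char M (\<epsilon> * exp (3 / 2 * a))"
  show "open ?U" by (intro open_Collect_less continuous_intros)
  show "(\<lambda>z. ?f z a) holomorphic_on ?U" for a by (intro holomorphic_intros)
  show "?f z \<in> borel_measurable lborel" for z by measurable
  fix z assume "z \<in> ?U"
  define k where "k = Re (z * ?e)"
  have k: "0 < k" using \<open>z \<in> ?U\<close> by (simp add: k_def)
  have low: "k / 2 \<le> Re (w * ?e)" if "w \<in> cball z (k / 2)" for w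
  proof -
    have "Re ((z - w) * ?e) \<le> norm ((z - w) * ?e)" by (rule complex_Re_le_cmod)
    also have "\<dots> = norm (z - w)" unfolding norm_mult norm_exp_i_times by simp
    also have "\<dots> \<le> k / 2" using that by (simp add: dist_norm)
    finally show ?thesis by (simp only: k_def left_diff_distrib minus_complex.sel)
  qed
  show "\<exists>r>0. \<exists>B. cball z r \<subseteq> ?U \<and> integrable lborel B \<and> (\<forall>w\<in>cball z r. \<forall>a. norm (?f w a) \<le> B a)"
  proof (intro exI[of _ "k / 2"] exI[of _ "\<lambda>a. exp (- (k / 2) * exp a + \<nu> * a)"] conjI ballI allI)
    show "cball z (k / 2) \<subseteq> ?U" using low k by fastforce
    show "integrable lborel (\<lambda>a. exp (- (k / 2) * exp a + \<nu> * a))"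
      using k assms by (intro integrable_exp_exp) auto
    fix w a assume w: "w \<in> cball z (k / 2)"
    have "exp a * (k / 2) \<le> exp a * Re (w * ?e)" by (intro mult_left_mono low w) simp
    also have "\<dots> = Re (w * exp (Complex a (- \<epsilon> * pi / 3)))"
      unfolding exp_Complex_split by (simp add: algebra_simps)
    finally have "norm (exp (- w * exp (Complex a (- \<epsilon> * pi / 3)) + of_real \<nu> * Complex a (- \<epsilon> * pi / 3)))
        \<le> exp (- (k / 2) * exp a + \<nu> * a)"
      by (simp add: mult.commute)
    then have "norm (?f w a) \<le> exp (- (k / 2) * exp a + \<nu> * a) * 1"
      unfolding norm_mult by (intro mult_mono cmod_char_le_1) auto
    then show "norm (?f w a) \<le> exp (- (k / 2) * exp a + \<nu> * a)" by simp
  qed (use k in simp)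
qed

text \<open>The ray is rotated inside the expectation: Fubini moves the integral over the ray
  inward, for each fixed value \<open>y\<close> the kernel is entire and the line can be shifted,
  and Fubini moves it out again. On the rotated ray the expectation is a value of
  \<open>char M\<close>.\<close>

lemma (in real_distribution) ray_transform_of_real:
  assumes pos: "AE y in M. 0 < y" and "0 < \<nu>" "0 < x" and \<epsilon>: "\<epsilon> = 1 \<or> \<epsilon> = - 1"
  shows "ray_transform M \<nu> \<epsilon> (of_real x) =
    of_real (LBINT s:{0<..}. exp (- x * s) * laplace_transform M (\<lambda>y. y) (s powr (3/2)) * s powr (\<nu> - 1))"
proof -
  \<comment> \<open>Truncation by \<open>max 0 y\<close> makes the kernel bounds valid for every
    \<open>y\<close> and changes the integrand only on a null set.\<close>
  define k where "k y \<zeta> = exp (- of_real x * exp \<zeta> - of_real (max 0 y) * exp (3 / 2 * \<zeta>) + of_real \<nu> * \<zeta>)" for y and \<zeta> :: complex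
  define \<gamma> where "\<gamma> = - \<epsilon> * pi / 3"
  have \<gamma>: "\<bar>\<gamma>\<bar> \<le> pi / 3" using \<epsilon> by (auto simp: \<gamma>_def)
  interpret P: pair_sigma_finite M lborel ..
  have L: "laplace_transform M (\<lambda>y. y) s = (\<integral>y. exp (- s * max 0 y) \<partial>M)" for s
    unfolding laplace_transform_def
  proof (rule integral_cong_AE)
    show "AE y in M. exp (- s * y) = exp (- s * max 0 y)" using pos by eventually_elim simp
  qed measurable
  have [measurable]: "laplace_transform M (\<lambda>y. y) \<in> borel_measurable borel"
    unfolding laplace_transform_def by measurable
  have [measurable]: "(\<lambda>(y, a). k y (Complex a \<gamma>)) \<in> borel_measurable (M \<Otimes>\<^sub>M lborel)" for \<gamma>
    unfolding k_def by measurable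
  have swap: "(\<integral>a. (\<integral>y. k y (Complex a \<gamma>) \<partial>M) \<partial>lborel) = (\<integral>y. (\<integral>a. k y (Complex a \<gamma>) \<partial>lborel) \<partial>M)"
    if "\<bar>\<gamma>\<bar> \<le> pi / 3" for \<gamma>
  proof (rule P.Fubini_dominated(2)[where g="\<lambda>_. 1" and h="\<lambda>a. exp (- (x / 2) * exp a + \<nu> * a)"])
    show "integrable lborel (\<lambda>a. exp (- (x / 2) * exp a + \<nu> * a))"
      using assms by (intro integrable_exp_exp) auto
    show "norm (k y (Complex a \<gamma>)) \<le> 1 * exp (- (x / 2) * exp a + \<nu> * a)" for y a
      using rotated_Laplace_kernel(1)[of x "max 0 y" \<nu> \<gamma> a] assms that by (simp add: k_def)
  qed auto
  have "(LBINT s:{0<..}. exp (- x * s) * laplace_transform M (\<lambda>y. y) (s powr (3/2)) * s powr (\<nu> - 1))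
      = (\<integral>a. exp a *\<^sub>R (exp (- x * exp a) * laplace_transform M (\<lambda>y. y) (exp a powr (3/2)) * exp a powr (\<nu> - 1)) \<partial>lborel)"
    by (subst integral_exp_substitution(2)) (auto simp: set_borel_measurable_def)
  also have "\<dots> = (\<integral>a. (\<integral>y. exp (- x * exp a - max 0 y * exp (3 / 2 * a) + \<nu> * a) \<partial>M) \<partial>lborel)"
  proof (intro Bochner_Integration.integral_cong refl)
    fix a :: real
    have "exp a * exp a powr (\<nu> - 1) = exp (\<nu> * a)" by (simp add: powr_def algebra_simps flip: exp_add)
    then have "exp a *\<^sub>R (exp (- x * exp a) * laplace_transform M (\<lambda>y. y) (exp a powr (3/2)) * exp a powr (\<nu> - 1))
      = exp (- x * exp a) * exp (\<nu> * a) * laplace_transform M (\<lambda>y. y) (exp a powr (3/2))" by (simp add: mult_ac)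
    also have "\<dots> = (\<integral>y. exp (- x * exp a) * exp (\<nu> * a) * exp (- (exp a powr (3/2)) * max 0 y) \<partial>M)"
      unfolding L by simp
    also have "\<dots> = (\<integral>y. exp (- x * exp a - max 0 y * exp (3 / 2 * a) + \<nu> * a) \<partial>M)"
      by (intro Bochner_Integration.integral_cong refl) (simp add: powr_def mult_ac flip: exp_add)
    finally show "exp a *\<^sub>R (exp (- x * exp a) * laplace_transform M (\<lambda>y. y) (exp a powr (3/2)) * exp a powr (\<nu> - 1))
       = (\<integral>y. exp (- x * exp a - max 0 y * exp (3 / 2 * a) + \<nu> * a) \<partial>M)" .
  qed
  finally have "complex_of_real (LBINT s:{0<..}. exp (- x * s) * laplace_transform M (\<lambda>y. y) (s powr (3/2)) * s powr (\<nu> - 1))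
     = (\<integral>a. (\<integral>y. complex_of_real (exp (- x * exp a - max 0 y * exp (3 / 2 * a) + \<nu> * a)) \<partial>M) \<partial>lborel)"
    by (simp only: integral_complex_of_real)
  also have "\<dots> = (\<integral>a. (\<integral>y. k y (Complex a 0) \<partial>M) \<partial>lborel)"
  proof (intro Bochner_Integration.integral_cong refl)
    fix a y :: real
    have "exp (3 / 2 * Complex a 0) = of_real (exp (3 / 2 * a))"
      by (simp add: Complex_eq flip: exp_of_real)
    then show "complex_of_real (exp (- x * exp a - max 0 y * exp (3 / 2 * a) + \<nu> * a)) = k y (Complex a 0)"
      unfolding k_def by (simp add: Complex_eq flip: exp_of_real)
  qed
  also have "\<dots> = (\<integral>y. (\<integral>a. k y (Complex a 0) \<partial>lborel) \<partial>M)" by (rule swap) simp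
  also have "\<dots> = (\<integral>y. (\<integral>a. k y (Complex a \<gamma>) \<partial>lborel) \<partial>M)"
  proof -
    have "(\<integral>a. k y (Complex a \<gamma>) \<partial>lborel) = (\<integral>a. k y (of_real a) \<partial>lborel)" if "\<bar>\<gamma>\<bar> \<le> pi / 3" for y \<gamma>
      unfolding k_def using assms that by (intro rotated_Laplace_kernel(2)) auto
    then have "(\<integral>a. k y (Complex a 0) \<partial>lborel) = (\<integral>a. k y (Complex a \<gamma>) \<partial>lborel)" for y
      using \<gamma> by simp
    then show ?thesis by (simp only:)
  qed
  also have "\<dots> = (\<integral>a. (\<integral>y. k y (Complex a \<gamma>) \<partial>M) \<partial>lborel)" by (rule swap[symmetric]) fact
  also have "\<dots> = (\<integral>a. exp (- of_real x * exp (Complex a \<gamma>) + of_real \<nu> * Complex a \<gamma>) * char M (\<epsilon> * exp (3 / 2 * a)) \<partial>lborel)"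
  proof (intro Bochner_Integration.integral_cong refl)
    fix a :: real
    have e: "exp (3 / 2 * Complex a \<gamma>) = - \<i> * of_real (\<epsilon> * exp (3 / 2 * a))"
    proof -
      have "3 / 2 * Complex a \<gamma> = Complex (3 / 2 * a) (- \<epsilon> * (pi / 2))" by (simp add: complex_eq_iff \<gamma>_def)
      then show ?thesis using \<epsilon> by (auto simp: exp_Complex_split complex_eq_iff Re_exp Im_exp)
    qed
    have "(\<integral>y. k y (Complex a \<gamma>) \<partial>M) = (\<integral>y. exp (- of_real x * exp (Complex a \<gamma>) + of_real \<nu> * Complex a \<gamma>) * iexp (\<epsilon> * exp (3 / 2 * a) * y) \<partial>M)"
    proof (rule integral_cong_AE)
      show "AE y in M. k y (Complex a \<gamma>) = exp (- of_real x * exp (Complex a \<gamma>) + of_real \<nu> * Complex a \<gamma>) * iexp (\<epsilon> * exp (3 / 2 * a) * y)"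
        using pos
      proof eventually_elim
        case (elim y)
        then have "k y (Complex a \<gamma>) = exp (- of_real x * exp (Complex a \<gamma>) + of_real \<nu> * Complex a \<gamma> + \<i> * of_real (\<epsilon> * exp (3 / 2 * a) * y))"
          unfolding k_def e by (simp add: algebra_simps)
        then show ?case by (simp only: exp_add)
      qed
    qed (unfold k_def, measurable)
    then show "(\<integral>y. k y (Complex a \<gamma>) \<partial>M) = exp (- of_real x * exp (Complex a \<gamma>) + of_real \<nu> * Complex a \<gamma>) * char M (\<epsilon> * exp (3 / 2 * a))"
      by (simp only: char_def integral_mult_right_zero)
  qed
  finally show ?thesis by (simp add: ray_transform_def \<gamma>_def)
qed

text \<open>The half-plane has its axis at argument \<open>\<epsilon> * pi / 3\<close>, and pi/3 +
  pi/2 = 5 pi/6.\<close>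

lemma sector_halfplane:
  assumes \<epsilon>: "\<epsilon> = 1 \<or> \<epsilon> = - 1" and z: "0 < Re (z * exp (\<i> * of_real (- \<epsilon> * pi / 3)))"
  shows "z \<in> sector (5 * pi / 6)"
proof -
  have "z \<noteq> 0" using z by auto
  have "z = of_real (norm z) * exp (\<i> * of_real (Arg z))" using Arg_eq[of z] \<open>z \<noteq> 0\<close> by simp
  then have "z * exp (\<i> * of_real (- \<epsilon> * pi / 3)) = of_real (norm z) * exp (\<i> * of_real (Arg z - \<epsilon> * pi / 3))"
    by (metis (no_types, lifting) mult.assoc exp_add of_real_add distrib_left diff_conv_add_uminus minus_mult_left minus_divide_left)
  then have "Re (z * exp (\<i> * of_real (- \<epsilon> * pi / 3))) = norm z * cos (Arg z - \<epsilon> * pi / 3)"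
    by (simp only: Re_complex_of_real Re_exp exp_Complex_split Re_divide) (simp add: Re_exp)
  with z have "0 < norm z * cos (Arg z - \<epsilon> * pi / 3)" by (simp only:)
  then have pos: "0 < cos (Arg z - \<epsilon> * pi / 3)" using \<open>z \<noteq> 0\<close> by (metis zero_less_mult_pos zero_less_norm_iff)
  have "\<bar>Arg z\<bar> < 5 * pi / 6"
  proof (rule ccontr)
    assume c: "\<not> \<bar>Arg z\<bar> < 5 * pi / 6"
    have b: "- pi < Arg z" "Arg z \<le> pi" using Arg_bounded by auto
    \<comment> \<open>The difference \<open>Arg z - \<epsilon> * pi / 3\<close> can exceed pi in
      modulus when \<open>Arg z\<close> lies on the other side of the cut. Subtracting the modulus
      from pi treats both sides at once.\<close>
    define u where "u = pi - \<bar>Arg z - \<epsilon> * pi / 3\<bar>"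
    have "- (pi / 2) \<le> u" "u \<le> pi / 2"
      using c b \<epsilon> unfolding u_def by (auto simp: abs_if split: if_splits)
    then have "0 \<le> cos u" by (rule cos_ge_zero)
    moreover have "cos u = - cos (Arg z - \<epsilon> * pi / 3)"
      unfolding u_def by simp
    ultimately show False using pos by simp
  qed
  then show ?thesis using \<open>z \<noteq> 0\<close> by (simp add: sector_def)
qed

text \<open>Passing to the law of \<open>X\<close> lets the identity on the real line play the role
  of \<open>X\<close> and gives access to \<open>char M\<close>.\<close>

locale gamma_Laplace_law = real_distribution M for M +
  fixes \<nu> :: real and \<Psi> :: "complex \<Rightarrow> complex"
  assumes pos: "AE y in M. 0 < y" and \<nu>_pos: "0 < \<nu>" and analytic: "\<Psi> analytic_on sector (5 * pi / 6)"
    and gamma_Laplace: "0 < x \<Longrightarrow> of_real (1 / Gamma \<nu> *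
      (LBINT s:{0<..}. exp (- x * s) * laplace_transform M (\<lambda>y. y) (s powr (3/2)) * s powr (\<nu> - 1))) = \<Psi> (of_real x)"

text \<open>Both sides are holomorphic on a half-plane that is convex, hence connected, and contains
  the positive reals because pi/3 < pi/2. There they agree by \<open>ray_transform_of_real\<close>,
  so the identity theorem applies.\<close>

lemma (in gamma_Laplace_law) gamma_Laplace_eq_ray_transform:
  assumes \<epsilon>: "\<epsilon> = 1 \<or> \<epsilon> = - 1" and z: "0 < Re (z * exp (\<i> * of_real (- \<epsilon> * pi / 3)))"
  shows "of_real (Gamma \<nu>) * \<Psi> z = ray_transform M \<nu> \<epsilon> z"
proof -
  define e where "e = exp (\<i> * of_real (- \<epsilon> * pi / 3))"
  let ?U = "{z. 0 < Re (z * e)}"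
  have Re_e: "Re e = 1 / 2" using \<epsilon> by (auto simp: e_def Re_exp cos_60)
  have reals: "of_real x \<in> ?U" if "0 < x" for x :: real using that by (simp add: Re_e)
  have "of_real (Gamma \<nu>) * \<Psi> z - ray_transform M \<nu> \<epsilon> z = 0"
  proof (rule analytic_continuation[where S="?U" and U="of_real ` {0::real<..}" and \<xi>=1
        and f="\<lambda>z. of_real (Gamma \<nu>) * \<Psi> z - ray_transform M \<nu> \<epsilon> z"])
    show "open ?U" by (intro open_Collect_less continuous_intros)
    have "?U = {z. inner (cnj e) z > 0}" by (simp add: inner_complex_def algebra_simps)
    then have "convex ?U" using convex_halfspace_gt[of 0 "cnj e"] by simp
    then show "connected ?U" by (rule convex_connected)
    have "?U \<subseteq> sector (5 * pi / 6)" using sector_halfplane[OF \<epsilon>] by (auto simp: e_def)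
    then have "\<Psi> holomorphic_on ?U"
      using analytic analytic_imp_holomorphic holomorphic_on_subset by blast
    then show "(\<lambda>z. of_real (Gamma \<nu>) * \<Psi> z - ray_transform M \<nu> \<epsilon> z) holomorphic_on ?U"
      using holomorphic_ray_transform[OF \<nu>_pos, of \<epsilon>] unfolding e_def by (intro holomorphic_intros)
    show "of_real ` {0::real<..} \<subseteq> ?U" using reals by auto
    show "1 \<in> ?U" using reals[of 1] by simp
    show "z \<in> ?U" using z by (simp add: e_def)
    show "(1::complex) islimpt of_real ` {0::real<..}"
      unfolding islimpt_approachable
    proof (intro allI impI)
      fix d :: real assume "0 < d"
      then show "\<exists>x'\<in>complex_of_real ` {0<..}. x' \<noteq> 1 \<and> dist x' 1 < d"
        by (intro bexI[of _ "of_real (1 + d / 2)"] imageI) (auto simp: dist_norm simp flip: of_real_divide)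
    qed
    fix w assume "w \<in> complex_of_real ` {0<..}"
    then obtain x :: real where x: "0 < x" "w = of_real x" by auto
    have "Gamma \<nu> \<noteq> 0" using Gamma_real_pos[OF \<nu>_pos] by simp
    then show "of_real (Gamma \<nu>) * \<Psi> w - ray_transform M \<nu> \<epsilon> w = 0"
      unfolding x using gamma_Laplace[OF x(1), symmetric] ray_transform_of_real[OF pos \<nu>_pos x(1) \<epsilon>] by simp
  qed
  then show ?thesis by simp
qed

text \<open>
  Up to the factor \<open>\<epsilon> Gamma \<nu>\<close>, the \<open>\<epsilon>\<close>-term of \<open>Psi_star \<nu> \<Psi>\<close> at \<open>r exp (\<i>\<theta>/3)\<close>.
\<close>

definition cut_integral :: "real measure \<Rightarrow> real \<Rightarrow> real \<Rightarrow> real \<Rightarrow> real \<Rightarrow> complex" where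
  "cut_integral M \<nu> \<theta> \<epsilon> r =
     (\<integral>a. exp (- of_real r * exp (Complex a (\<epsilon> * pi / 3) + \<i> * of_real (\<theta> / 3))
           + of_real \<nu> * Complex a (\<epsilon> * pi / 3)) * char M (\<epsilon> * exp (3 / 2 * a)) \<partial>lborel)"

text \<open>The inequality \<open>sin (3 * \<phi>) \<le> 3 * sin \<phi>\<close> at
  \<open>\<phi> = pi / 6 - \<bar>\<theta>\<bar> / 3\<close>. It converts the decay rate along a
  rotated ray, which degenerates as \<open>\<bar>\<theta>\<bar>\<close> approaches pi/2, into a
  power of \<open>cos \<theta>\<close>.\<close>

lemma cos_third_ge:
  fixes \<theta> :: real
  assumes "\<bar>\<theta>\<bar> < pi / 2"
  shows "cos \<theta> / 3 \<le> cos (pi / 3 + \<bar>\<theta>\<bar> / 3)"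
proof -
  define \<phi> where "\<phi> = pi / 6 - \<bar>\<theta>\<bar> / 3"
  have \<phi>: "0 \<le> sin \<phi>" using assms by (intro sin_ge_zero) (auto simp: \<phi>_def abs_if)
  have "cos \<theta> = cos \<bar>\<theta>\<bar>" by simp
  also have "\<dots> = sin (3 * \<phi>)" by (simp add: \<phi>_def sin_cos_eq algebra_simps)
  also have "\<dots> = sin (2 * \<phi> + \<phi>)" by simp
  also have "\<dots> = sin \<phi> * (2 * (cos \<phi>)\<^sup>2 + cos (2 * \<phi>))"
    unfolding sin_add sin_double by (simp add: algebra_simps power2_eq_square)
  also have "\<dots> \<le> sin \<phi> * (2 * 1 + 1)"
    using \<phi> by (intro mult_left_mono add_mono) (auto simp: abs_square_le_1)
  also have "sin \<phi> = cos (pi / 3 + \<bar>\<theta>\<bar> / 3)" by (simp add: \<phi>_def sin_cos_eq algebra_simps)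
  finally show ?thesis by simp
qed

text \<open>The product has argument \<open>\<theta> / 3 + \<epsilon> * pi / 3\<close>, of modulus
  below pi/6 + pi/3 = pi/2.\<close>

lemma rotation_in_halfplane:
  fixes \<epsilon> r \<theta> :: real
  assumes \<epsilon>: "\<epsilon> = 1 \<or> \<epsilon> = - 1" and r: "0 < r" and \<theta>: "\<bar>\<theta>\<bar> < pi / 2"
  shows "0 < Re (exp (of_real (\<epsilon> * (2 * pi / 3)) * \<i>) * (of_real r * exp (\<i> * of_real (\<theta> / 3))) * exp (\<i> * of_real (- \<epsilon> * pi / 3)))"
proof -
  have "exp (of_real (\<epsilon> * (2 * pi / 3)) * \<i>) * (of_real r * exp (\<i> * of_real (\<theta> / 3))) * exp (\<i> * of_real (- \<epsilon> * pi / 3))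
      = of_real r * exp (\<i> * of_real (\<theta> / 3 + \<epsilon> * pi / 3))"
    by (simp add: exp_add[symmetric] mult_ac) (simp add: mult_exp_exp algebra_simps)
  then have "Re (exp (of_real (\<epsilon> * (2 * pi / 3)) * \<i>) * (of_real r * exp (\<i> * of_real (\<theta> / 3))) * exp (\<i> * of_real (- \<epsilon> * pi / 3)))
      = r * cos (\<theta> / 3 + \<epsilon> * pi / 3)" by (simp only:) (simp add: Re_exp)
  also have "\<dots> > 0" using \<epsilon> r \<theta> by (intro mult_pos_pos cos_gt_zero_pi) (auto simp: abs_if split: if_splits)
  finally show ?thesis .
qed

text \<open>Both phases in \<open>Psi_star\<close> move the ray from argument
  \<open>- \<epsilon> * pi / 3\<close> to \<open>\<epsilon> * pi / 3\<close>: the rotation of the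
  argument of \<open>\<Psi>\<close> does so in the exponential, the prefactor does so in the power
  \<open>s^\<nu>\<close>.\<close>

lemma (in gamma_Laplace_law) Psi_star_eq_cut_integral:
  assumes r: "0 < r" and \<theta>: "\<bar>\<theta>\<bar> < pi / 2"
  shows "Psi_star \<nu> \<Psi> (of_real r * exp (\<i> * of_real (\<theta> / 3))) =
    (cut_integral M \<nu> \<theta> 1 r - cut_integral M \<nu> \<theta> (- 1) r) / of_real (Gamma \<nu>)"
proof -
  define z where "z = of_real r * exp (\<i> * of_real (\<theta> / 3))"
  have main: "of_real (Gamma \<nu>) * (exp (of_real (\<epsilon> * (2 * pi * \<nu> / 3)) * \<i>) * \<Psi> (exp (of_real (\<epsilon> * (2 * pi / 3)) * \<i>) * z))
      = cut_integral M \<nu> \<theta> \<epsilon> r" if \<epsilon>: "\<epsilon> = 1 \<or> \<epsilon> = - 1" for \<epsilon>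
  proof -
    have "of_real (Gamma \<nu>) * \<Psi> (exp (of_real (\<epsilon> * (2 * pi / 3)) * \<i>) * z)
        = ray_transform M \<nu> \<epsilon> (exp (of_real (\<epsilon> * (2 * pi / 3)) * \<i>) * z)"
      unfolding z_def by (intro gamma_Laplace_eq_ray_transform rotation_in_halfplane \<epsilon> r \<theta>)
    then have "of_real (Gamma \<nu>) * (exp (of_real (\<epsilon> * (2 * pi * \<nu> / 3)) * \<i>) * \<Psi> (exp (of_real (\<epsilon> * (2 * pi / 3)) * \<i>) * z))
        = exp (of_real (\<epsilon> * (2 * pi * \<nu> / 3)) * \<i>) * ray_transform M \<nu> \<epsilon> (exp (of_real (\<epsilon> * (2 * pi / 3)) * \<i>) * z)"
      by (simp add: mult_ac)
    also have "\<dots> = cut_integral M \<nu> \<theta> \<epsilon> r"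
      unfolding ray_transform_def cut_integral_def integral_mult_right_zero[symmetric] mult.assoc[symmetric] exp_add[symmetric]
    proof (intro Bochner_Integration.integral_cong refl arg_cong2[where f="(*)"] arg_cong[where f=exp])
      fix a :: real
      have "exp (of_real (\<epsilon> * (2 * pi / 3)) * \<i>) * z * exp (Complex a (- \<epsilon> * pi / 3))
          = of_real r * (exp (of_real (\<epsilon> * (2 * pi / 3)) * \<i>) * exp (\<i> * of_real (\<theta> / 3)) * exp (Complex a (- \<epsilon> * pi / 3)))"
        by (simp add: z_def)
      also have "exp (of_real (\<epsilon> * (2 * pi / 3)) * \<i>) * exp (\<i> * of_real (\<theta> / 3)) * exp (Complex a (- \<epsilon> * pi / 3))
          = exp (Complex a (\<epsilon> * pi / 3) + \<i> * of_real (\<theta> / 3))"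
        unfolding exp_add[symmetric] by (rule arg_cong[where f=exp]) (simp add: complex_eq_iff)
      finally have "- (exp (of_real (\<epsilon> * (2 * pi / 3)) * \<i>) * z) * exp (Complex a (- \<epsilon> * pi / 3))
         = - of_real r * exp (Complex a (\<epsilon> * pi / 3) + \<i> * of_real (\<theta> / 3))" by simp
      moreover have "of_real (\<epsilon> * (2 * pi * \<nu> / 3)) * \<i> + of_real \<nu> * Complex a (- \<epsilon> * pi / 3) = of_real \<nu> * Complex a (\<epsilon> * pi / 3)"
        by (simp add: complex_eq_iff field_simps)
      ultimately show "of_real (\<epsilon> * (2 * pi * \<nu> / 3)) * \<i> + (- (exp (of_real (\<epsilon> * (2 * pi / 3)) * \<i>) * z) * exp (Complex a (- \<epsilon> * pi / 3))
          + of_real \<nu> * Complex a (- \<epsilon> * pi / 3))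
        = - of_real r * exp (Complex a (\<epsilon> * pi / 3) + \<i> * of_real (\<theta> / 3)) + of_real \<nu> * Complex a (\<epsilon> * pi / 3)"
        by (metis add.left_commute)
    qed
    finally show ?thesis .
  qed
  have "Gamma \<nu> \<noteq> 0" using Gamma_real_pos[OF \<nu>_pos] by simp
  then show ?thesis using main[of 1] main[of "-1"]
    unfolding Psi_star_def z_def[symmetric] by (simp add: field_simps)
qed

text \<open>Translation by \<open>- ln k\<close>. For positive \<open>\<nu>\<close> the integral on
  the right is \<open>Gamma \<nu>\<close>.\<close>

lemma integral_exp_exp_scale:
  fixes k \<nu> :: real
  assumes "0 < k"
  shows "(\<integral>a. exp (- k * exp a + \<nu> * a) \<partial>lborel) = k powr (- \<nu>) * (\<integral>a. exp (- exp a + \<nu> * a) \<partial>lborel)"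
proof -
  have "(\<integral>a. exp (- k * exp a + \<nu> * a) \<partial>lborel) = (\<integral>a. exp (- k * exp (- ln k + 1 * a) + \<nu> * (- ln k + 1 * a)) \<partial>lborel)"
    by (subst lborel_integral_real_affine[where c=1 and t="- ln k"]) auto
  also have "\<dots> = (\<integral>a. k powr (- \<nu>) * exp (- exp a + \<nu> * a) \<partial>lborel)"
  proof (intro Bochner_Integration.integral_cong refl)
    fix a :: real
    have "k * exp (- ln k + 1 * a) = exp a" using assms by (simp add: exp_diff)
    then show "exp (- k * exp (- ln k + 1 * a) + \<nu> * (- ln k + 1 * a)) = k powr (- \<nu>) * exp (- exp a + \<nu> * a)"
      using assms by (simp add: powr_def algebra_simps flip: exp_add)
  qed
  finally show ?thesis by simp
qed

text \<open>
  The growth hypotheses on \<open>\<Psi>\<close> say nothing about bounded annuli near the boundary of the sector;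
  there this bound is what controls \<open>Psi_star\<close>.
\<close>

lemma (in real_distribution) norm_cut_integral_le:
  assumes \<nu>: "0 < \<nu>" and r: "0 < r" and \<theta>: "\<bar>\<theta>\<bar> < pi / 2" and \<epsilon>: "\<epsilon> = 1 \<or> \<epsilon> = - 1"
  shows "norm (cut_integral M \<nu> \<theta> \<epsilon> r) \<le> 3 powr \<nu> * (\<integral>a. exp (- exp a + \<nu> * a) \<partial>lborel) * (r powr (- \<nu>) * cos \<theta> powr (- \<nu>))"
proof -
  define \<kappa> where "\<kappa> = cos (pi / 3 + \<bar>\<theta>\<bar> / 3)"
  have cpos: "0 < cos \<theta>" using \<theta> by (intro cos_gt_zero_pi) auto
  have \<kappa>: "cos \<theta> / 3 \<le> \<kappa>" unfolding \<kappa>_def by (rule cos_third_ge[OF \<theta>])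
  then have \<kappa>0: "0 < \<kappa>" using cpos by linarith
  have int: "integrable lborel (\<lambda>a. exp (- (r * \<kappa>) * exp a + \<nu> * a))" using r \<kappa>0 \<nu> by (intro integrable_exp_exp) auto
  let ?f = "\<lambda>a. exp (- of_real r * exp (Complex a (\<epsilon> * pi / 3) + \<i> * of_real (\<theta> / 3)) + of_real \<nu> * Complex a (\<epsilon> * pi / 3))
        * char M (\<epsilon> * exp (3 / 2 * a))"
  have bd: "norm (?f a) \<le> exp (- (r * \<kappa>) * exp a + \<nu> * a)" for a
  proof -
    have "\<kappa> \<le> cos \<bar>\<epsilon> * pi / 3 + \<theta> / 3\<bar>" unfolding \<kappa>_def using \<epsilon> \<theta> by (intro cos_monotone_0_pi_le) (auto simp: abs_if split: if_splits)
    then have "r * (exp a * \<kappa>) \<le> r * (exp a * cos (\<epsilon> * pi / 3 + \<theta> / 3))" using r by (intro mult_left_mono) auto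
    then have "norm (exp (- of_real r * exp (Complex a (\<epsilon> * pi / 3) + \<i> * of_real (\<theta> / 3)) + of_real \<nu> * Complex a (\<epsilon> * pi / 3)))
      \<le> exp (- (r * \<kappa>) * exp a + \<nu> * a)"
      by (simp add: Re_exp mult_ac)
    then have "norm (exp (- of_real r * exp (Complex a (\<epsilon> * pi / 3) + \<i> * of_real (\<theta> / 3)) + of_real \<nu> * Complex a (\<epsilon> * pi / 3))
        * char M (\<epsilon> * exp (3 / 2 * a))) \<le> exp (- (r * \<kappa>) * exp a + \<nu> * a) * 1"
      unfolding norm_mult by (intro mult_mono cmod_char_le_1) auto
    then show "norm (exp (- of_real r * exp (Complex a (\<epsilon> * pi / 3) + \<i> * of_real (\<theta> / 3)) + of_real \<nu> * Complex a (\<epsilon> * pi / 3))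
        * char M (\<epsilon> * exp (3 / 2 * a))) \<le> exp (- (r * \<kappa>) * exp a + \<nu> * a)" by simp
  qed
  have "norm (cut_integral M \<nu> \<theta> \<epsilon> r) \<le> (\<integral>a. exp (- (r * \<kappa>) * exp a + \<nu> * a) \<partial>lborel)"
    unfolding cut_integral_def
  proof (rule Bochner_Integration.integral_norm_bound_integral[OF _ int bd])
    show "integrable lborel ?f"
      by (rule Bochner_Integration.integrable_bound[OF int]) (use bd in \<open>auto intro!: AE_I2\<close>)
  qed
  also have "\<dots> = (r * \<kappa>) powr (- \<nu>) * (\<integral>a. exp (- exp a + \<nu> * a) \<partial>lborel)"
    using r \<kappa>0 by (intro integral_exp_exp_scale) simp
  also have "\<dots> \<le> (r * (cos \<theta> / 3)) powr (- \<nu>) * (\<integral>a. exp (- exp a + \<nu> * a) \<partial>lborel)"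
    using r \<kappa> \<kappa>0 \<nu> cpos by (intro mult_right_mono powr_mono2') (auto intro: mult_left_mono)
  also have "(r * (cos \<theta> / 3)) powr (- \<nu>) = 3 powr \<nu> * (r powr (- \<nu>) * cos \<theta> powr (- \<nu>))"
    using r cpos by (simp add: powr_mult powr_divide powr_minus field_simps)
  finally show ?thesis by (simp add: mult_ac)
qed

text \<open>The integral of \<open>exp (- v * s)\<close> over positive \<open>s\<close>, written
  with \<open>s = exp p\<close>.\<close>

lemma integral_exp_neg:
  fixes v :: complex
  assumes "0 < Re v"
  shows "(\<integral>p. of_real (exp p) * exp (- v * of_real (exp p)) \<partial>lborel) = 1 / v"
    and "integrable lborel (\<lambda>p. of_real (exp p) * exp (- v * of_real (exp p)))"
proof -
  have v: "v \<noteq> 0" using assms by auto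
  have "integrable lborel (\<lambda>p. exp (- Re v * exp p + 1 * p))" using assms by (intro integrable_exp_exp) auto
  then show int: "integrable lborel (\<lambda>p. of_real (exp p) * exp (- v * of_real (exp p)))"
    by (rule Bochner_Integration.integrable_bound) (auto intro!: AE_I2 simp: norm_mult mult_ac simp flip: exp_add)
  have tend: "((\<lambda>p. exp (- v * of_real (exp p))) \<longlongrightarrow> 0) at_top"
  proof (rule tendsto_norm_zero_cancel)
    have "((\<lambda>p. exp (- Re v * exp p)) \<longlongrightarrow> 0) at_top" using assms by real_asymp
    then show "((\<lambda>p. norm (exp (- v * of_real (exp p)))) \<longlongrightarrow> 0) at_top" by simp
  qed
  have tend2: "((\<lambda>p. exp (- v * of_real (exp p))) \<longlongrightarrow> exp (- v * of_real 0)) at_bot"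
    by (intro tendsto_intros exp_at_bot)
  have "(LBINT p=-\<infinity>..\<infinity>. of_real (exp p) * exp (- v * of_real (exp p))) = - 0 / v - (- exp (- v * of_real 0) / v)"
  proof (rule interval_integral_FTC_integrable)
    show "((\<lambda>p. - exp (- v * of_real (exp p)) / v) has_vector_derivative of_real (exp x) * exp (- v * of_real (exp x))) (at x)" for x :: real
      using v by (auto intro!: derivative_eq_intros has_vector_derivative_real_field simp: field_simps simp flip: exp_of_real)
    show "(((\<lambda>p. - exp (- v * of_real (exp p)) / v) \<circ> real_of_ereal) \<longlongrightarrow> - 0 / v) (at_left \<infinity>)"
      unfolding ereal_tendsto_simps using tend by (intro tendsto_intros)  (use v in auto)
    show "(((\<lambda>p. - exp (- v * of_real (exp p)) / v) \<circ> real_of_ereal) \<longlongrightarrow> - exp (- v * of_real 0) / v) (at_right (-\<infinity>))"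
      unfolding ereal_tendsto_simps by (rule tendsto_divide[OF tendsto_minus[OF tend2] tendsto_const v])
    show "set_integrable lborel (einterval (-\<infinity>) \<infinity>) (\<lambda>p. of_real (exp p) * exp (- v * of_real (exp p)))"
      using int by (simp add: set_integrable_def)
  qed (auto intro!: continuous_intros)
  then show "(\<integral>p. of_real (exp p) * exp (- v * of_real (exp p)) \<partial>lborel) = 1 / v"
    by (simp add: interval_lebesgue_integral_def set_lebesgue_integral_def)
qed

section \<open>The inner integral\<close>

text \<open>Here \<open>exp p\<close> stands for \<open>r^(-3/2)\<close>. For a fixed value
  \<open>y\<close> of the variable, the Laplace transform at \<open>w\<close> of the oscillation
  contributed by \<open>char M\<close> is
  \<open>1 / (w - \<i> * \<epsilon> * exp (3 / 2 * a) * y)\<close>, and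
  \<open>\<i> * \<epsilon> * exp (3 / 2 * a)\<close> is the value of
  \<open>exp (3 / 2 * \<zeta>)\<close> on the line. This is how the meromorphic kernel of
  \<open>residue_kernel\<close> arises.\<close>

lemma (in real_distribution) Laplace_cut_integral:
  fixes \<theta> c \<nu> \<epsilon> :: real
  assumes \<theta>: "\<bar>\<theta>\<bar> < pi / 2" and c: "0 < c" and \<nu>: "0 < \<nu>" and \<epsilon>: "\<epsilon> = 1 \<or> \<epsilon> = - 1"
  defines "w \<equiv> of_real c * exp (\<i> * of_real \<theta>)"
  defines "g \<equiv> \<lambda>\<zeta>. exp (- exp (\<zeta> + \<i> * of_real (\<theta> / 3)) + of_real \<nu> * \<zeta>)"
  defines "k \<equiv> \<lambda>y a. g (Complex a (\<epsilon> * pi / 3)) / (w - of_real y * exp (3 / 2 * Complex a (\<epsilon> * pi / 3)))"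
  shows "(\<integral>p. of_real (exp p) * exp (- w * of_real (exp p)) *
            (\<integral>a. g (Complex a (\<epsilon> * pi / 3)) * char M (\<epsilon> * exp (3 / 2 * a) * exp p) \<partial>lborel) \<partial>lborel)
        = (\<integral>y. (\<integral>a. k y a \<partial>lborel) \<partial>M)"
    and "integrable M (\<lambda>y. \<integral>a. k y a \<partial>lborel)"
    and "integrable lborel (\<lambda>p. of_real (exp p) * exp (- w * of_real (exp p)) *
            (\<integral>a. g (Complex a (\<epsilon> * pi / 3)) * char M (\<epsilon> * exp (3 / 2 * a) * exp p) \<partial>lborel))"
proof -
  define \<kappa> where "\<kappa> = cos (pi / 3 + \<bar>\<theta>\<bar> / 3)"
  have \<kappa>: "0 < \<kappa>" unfolding \<kappa>_def using \<theta> by (intro cos_gt_zero_pi) auto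
  have "0 < c * cos \<theta>" using c \<theta> by (intro mult_pos_pos cos_gt_zero_pi) auto
  then have Rew: "0 < Re w" by (simp add: w_def Re_exp)
  define G where "G a = g (Complex a (\<epsilon> * pi / 3))" for a
  have [measurable]: "G \<in> borel_measurable borel" unfolding G_def g_def by measurable
  have Gb: "norm (G a) \<le> exp (- \<kappa> * exp a + \<nu> * a)" for a
  proof -
    have "\<kappa> \<le> cos \<bar>\<epsilon> * pi / 3 + \<theta> / 3\<bar>" unfolding \<kappa>_def using \<epsilon> \<theta> by (intro cos_monotone_0_pi_le) (auto simp: abs_if split: if_splits)
    then have "\<kappa> * exp a \<le> cos (\<epsilon> * pi / 3 + \<theta> / 3) * exp a" by (intro mult_right_mono) auto
    then show ?thesis by (simp add: G_def g_def Re_exp algebra_simps)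
  qed
  have intB: "integrable lborel (\<lambda>a. exp (- \<kappa> * exp a + \<nu> * a))" using \<kappa> \<nu> by (rule integrable_exp_exp)
  define E where "E p = of_real (exp p) * exp (- w * of_real (exp p))" for p :: real
  have [measurable]: "E \<in> borel_measurable borel" unfolding E_def by measurable
  have intE: "integrable lborel E" unfolding E_def by (rule integral_exp_neg(2)[OF Rew])
  then have intnE: "integrable lborel (\<lambda>p. norm (E p))" by simp
  interpret P: pair_sigma_finite lborel M ..
  interpret Q: pair_sigma_finite M lborel ..
  have e32: "exp (3 / 2 * Complex a (\<epsilon> * pi / 3)) = \<i> * of_real (\<epsilon> * exp (3 / 2 * a))" for a
  proof -
    have "3 / 2 * Complex a (\<epsilon> * pi / 3) = Complex (3 / 2 * a) (\<epsilon> * (pi / 2))" by (simp add: complex_eq_iff)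
    then show ?thesis using \<epsilon> by (auto simp: exp_Complex_split complex_eq_iff Re_exp Im_exp)
  qed
  have inner: "(\<integral>p. E p * char M (\<epsilon> * exp (3 / 2 * a) * exp p) \<partial>lborel)
      = (\<integral>y. 1 / (w - of_real y * exp (3 / 2 * Complex a (\<epsilon> * pi / 3))) \<partial>M)" for a
  proof -
    define s where "s = \<epsilon> * exp (3 / 2 * a)"
    have "(\<integral>p. E p * char M (s * exp p) \<partial>lborel) = (\<integral>p. (\<integral>y. E p * iexp (s * exp p * y) \<partial>M) \<partial>lborel)"
      by (simp only: char_def integral_mult_right_zero)
    also have "\<dots> = (\<integral>y. (\<integral>p. E p * iexp (s * exp p * y) \<partial>lborel) \<partial>M)"
    proof (rule P.Fubini_dominated(2)[symmetric, where h="\<lambda>_. 1", OF _ intnE])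
      show "norm (E p * iexp (s * exp p * y)) \<le> norm (E p) * 1" for p y
        unfolding norm_mult norm_exp_i_times by simp
    qed auto
    also have "\<dots> = (\<integral>y. 1 / (w - of_real y * exp (3 / 2 * Complex a (\<epsilon> * pi / 3))) \<partial>M)"
    proof (intro Bochner_Integration.integral_cong refl)
      fix y :: real
      have "E p * iexp (s * exp p * y) = of_real (exp p) * exp (- (w - \<i> * of_real (s * y)) * of_real (exp p))" for p
      proof -
        have "- (w - \<i> * of_real (s * y)) * of_real (exp p) = - w * of_real (exp p) + \<i> * of_real (s * exp p * y)"
          by (simp add: algebra_simps)
        then show ?thesis by (simp only: E_def exp_add mult.assoc)
      qed
      then have "(\<integral>p. E p * iexp (s * exp p * y) \<partial>lborel) = 1 / (w - \<i> * of_real (s * y))"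
        using integral_exp_neg(1)[of "w - \<i> * of_real (s * y)"] Rew by (simp only:) simp
      then show "(\<integral>p. E p * iexp (s * exp p * y) \<partial>lborel) = 1 / (w - of_real y * exp (3 / 2 * Complex a (\<epsilon> * pi / 3)))"
        by (simp only: e32 s_def) (simp add: mult_ac)
    qed
    finally show ?thesis by (simp only: s_def)
  qed
  \<comment> \<open>For real \<open>y\<close> the subtracted term is purely imaginary, so
    \<open>Re w\<close> bounds the denominator from below uniformly in \<open>y\<close> and
    \<open>a\<close>.\<close>
  have kb: "norm (k y a) \<le> 1 * (exp (- \<kappa> * exp a + \<nu> * a) / Re w)" for y a
  proof -
    have "Re w \<le> norm (w - of_real y * exp (3 / 2 * Complex a (\<epsilon> * pi / 3)))"
      using complex_Re_le_cmod[of "w - of_real y * exp (3 / 2 * Complex a (\<epsilon> * pi / 3))"] unfolding e32 by simp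
    then show ?thesis unfolding k_def norm_divide using Gb[of a] Rew by (simp only: mult_1, intro frac_le) (auto simp: G_def)
  qed
  have km [measurable]: "(\<lambda>(y, a). k y a) \<in> borel_measurable (M \<Otimes>\<^sub>M lborel)"
    unfolding k_def G_def[symmetric] by measurable
  note Qk = Q.Fubini_dominated[OF km, where g="\<lambda>_. 1" and h="\<lambda>a. exp (- \<kappa> * exp a + \<nu> * a) / Re w", OF _ _ kb]
  have "integrable (M \<Otimes>\<^sub>M lborel) (\<lambda>(y, a). k y a)" by (rule Qk(1)) (use intB in auto)
  then show "integrable M (\<lambda>y. \<integral>a. k y a \<partial>lborel)" by (rule Q.integrable_fst)
  have EGb: "norm (E p * (G a * char M (\<epsilon> * exp (3 / 2 * a) * exp p))) \<le> norm (E p) * exp (- \<kappa> * exp a + \<nu> * a)" for p a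
  proof -
    have "norm (G a) * norm (char M (\<epsilon> * exp (3 / 2 * a) * exp p)) \<le> exp (- \<kappa> * exp a + \<nu> * a) * 1"
      by (intro mult_mono Gb cmod_char_le_1) auto
    then show ?thesis unfolding norm_mult by (intro mult_left_mono) auto
  qed
  note EG = lborel_pair.Fubini_dominated[OF _ intnE intB EGb]
  have "integrable (lborel \<Otimes>\<^sub>M lborel) (\<lambda>(p, a). E p * (G a * char M (\<epsilon> * exp (3 / 2 * a) * exp p)))"
    by (rule EG(1)) measurable
  then have "integrable lborel (\<lambda>p. \<integral>a. E p * (G a * char M (\<epsilon> * exp (3 / 2 * a) * exp p)) \<partial>lborel)"
    by (rule lborel_pair.integrable_fst)
  then show "integrable lborel (\<lambda>p. of_real (exp p) * exp (- w * of_real (exp p)) *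
            (\<integral>a. g (Complex a (\<epsilon> * pi / 3)) * char M (\<epsilon> * exp (3 / 2 * a) * exp p) \<partial>lborel))"
    by (simp only: E_def G_def integral_mult_right_zero)
  have "(\<integral>p. E p * (\<integral>a. G a * char M (\<epsilon> * exp (3 / 2 * a) * exp p) \<partial>lborel) \<partial>lborel)
      = (\<integral>p. (\<integral>a. E p * (G a * char M (\<epsilon> * exp (3 / 2 * a) * exp p)) \<partial>lborel) \<partial>lborel)"
    by (simp only: integral_mult_right_zero)
  also have "\<dots> = (\<integral>a. (\<integral>p. E p * (G a * char M (\<epsilon> * exp (3 / 2 * a) * exp p)) \<partial>lborel) \<partial>lborel)"
    by (rule EG(2)[symmetric]) measurable
  also have "\<dots> = (\<integral>a. G a * (\<integral>p. E p * char M (\<epsilon> * exp (3 / 2 * a) * exp p) \<partial>lborel) \<partial>lborel)"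
    by (simp only: mult.left_commute[of "E _" "G _"] integral_mult_right_zero)
  also have "\<dots> = (\<integral>a. (\<integral>y. k y a \<partial>M) \<partial>lborel)"
    unfolding inner k_def G_def[symmetric] integral_mult_right_zero[symmetric] by simp
  also have "\<dots> = (\<integral>y. (\<integral>a. k y a \<partial>lborel) \<partial>M)"
    by (rule Qk(2)) (use intB in auto)
  finally show "(\<integral>p. of_real (exp p) * exp (- w * of_real (exp p)) *
            (\<integral>a. g (Complex a (\<epsilon> * pi / 3)) * char M (\<epsilon> * exp (3 / 2 * a) * exp p) \<partial>lborel) \<partial>lborel)
        = (\<integral>y. (\<integral>a. k y a \<partial>lborel) \<partial>M)"
    by (simp only: E_def G_def)
qed

text \<open>Translating \<open>a\<close> by \<open>- q\<close> removes \<open>r = exp q\<close> from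
  the double exponential. It reappears as the factor \<open>r^(-\<nu>)\<close> and as
  \<open>r^(-3/2)\<close> inside \<open>char M\<close>, which makes \<open>r^(-3/2)\<close> the
  natural variable of the Laplace transform.\<close>

lemma cut_integral_exp:
  "cut_integral M \<nu> \<theta> \<epsilon> (exp q) = of_real (exp (- \<nu> * q)) *
     (\<integral>a. exp (- exp (Complex a (\<epsilon> * pi / 3) + \<i> * of_real (\<theta> / 3)) + of_real \<nu> * Complex a (\<epsilon> * pi / 3))
        * char M (\<epsilon> * exp (3 / 2 * a) * exp (- 3 / 2 * q)) \<partial>lborel)"
proof -
  have "cut_integral M \<nu> \<theta> \<epsilon> (exp q) =
     (\<integral>a. exp (- of_real (exp q) * exp (Complex (- q + 1 * a) (\<epsilon> * pi / 3) + \<i> * of_real (\<theta> / 3))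
           + of_real \<nu> * Complex (- q + 1 * a) (\<epsilon> * pi / 3)) * char M (\<epsilon> * exp (3 / 2 * (- q + 1 * a))) \<partial>lborel)"
    unfolding cut_integral_def by (subst lborel_integral_real_affine[where c=1 and t="- q"]) auto
  also have "\<dots> = (\<integral>a. of_real (exp (- \<nu> * q)) *
     (exp (- exp (Complex a (\<epsilon> * pi / 3) + \<i> * of_real (\<theta> / 3)) + of_real \<nu> * Complex a (\<epsilon> * pi / 3))
        * char M (\<epsilon> * exp (3 / 2 * a) * exp (- 3 / 2 * q))) \<partial>lborel)"
  proof (intro Bochner_Integration.integral_cong refl)
    fix a :: real
    have 1: "Complex (- q + 1 * a) b = of_real (- q) + Complex a b" for b by (simp add: complex_eq_iff)
    have 2: "of_real (exp q) * exp (of_real (- q) + Complex a (\<epsilon> * pi / 3) + \<i> * of_real (\<theta> / 3))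
       = exp (Complex a (\<epsilon> * pi / 3) + \<i> * of_real (\<theta> / 3))"
      unfolding exp_of_real[symmetric] exp_add[symmetric] by (rule arg_cong[where f=exp]) simp
    have 3: "exp (3 / 2 * (- q + 1 * a)) = exp (3 / 2 * a) * exp (- 3 / 2 * q)"
      unfolding exp_add[symmetric] by (rule arg_cong[where f=exp]) simp
    have 4: "- of_real (exp q) * exp (of_real (- q) + Complex a (\<epsilon> * pi / 3) + \<i> * of_real (\<theta> / 3)) + of_real \<nu> * (of_real (- q) + Complex a (\<epsilon> * pi / 3))
       = of_real (- \<nu> * q) + (- exp (Complex a (\<epsilon> * pi / 3) + \<i> * of_real (\<theta> / 3)) + of_real \<nu> * Complex a (\<epsilon> * pi / 3))"
      unfolding mult_minus_left 2 by (simp add: algebra_simps)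
    show "exp (- of_real (exp q) * exp (Complex (- q + 1 * a) (\<epsilon> * pi / 3) + \<i> * of_real (\<theta> / 3))
           + of_real \<nu> * Complex (- q + 1 * a) (\<epsilon> * pi / 3)) * char M (\<epsilon> * exp (3 / 2 * (- q + 1 * a)))
      = of_real (exp (- \<nu> * q)) *
     (exp (- exp (Complex a (\<epsilon> * pi / 3) + \<i> * of_real (\<theta> / 3)) + of_real \<nu> * Complex a (\<epsilon> * pi / 3))
        * char M (\<epsilon> * exp (3 / 2 * a) * exp (- 3 / 2 * q)))"
      unfolding 1 4 3 by (simp only: exp_add exp_of_real mult.assoc)
  qed
  finally show ?thesis by (simp only: integral_mult_right_zero)
qed

section \<open>Integrability of the density integrand\<close>

text \<open>The inequality \<open>v / k \<le> exp (v / k)\<close>, raised to the power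
  \<open>k\<close> and inverted.\<close>

lemma exp_neg_le_powr:
  fixes v k :: real
  assumes "0 < v" "0 < k"
  shows "exp (- v) \<le> k powr k * v powr (- k)"
proof -
  have "v / k \<le> exp (v / k)" using exp_ge_add_one_self[of "v / k"] by linarith
  then have "(v / k) powr k \<le> exp (v / k) powr k" using assms by (intro powr_mono2) auto
  also have "\<dots> = exp v" using assms by (simp add: powr_def)
  finally have "v powr k / k powr k \<le> exp v" using assms by (simp add: powr_divide)
  then have "inverse (exp v) \<le> inverse (v powr k / k powr k)" using assms by (intro le_imp_inverse_le) auto
  then show ?thesis by (simp add: exp_minus powr_minus field_simps)
qed

lemma set_integrable_lborel_nonneg:
  fixes f :: "real \<Rightarrow> real"
  assumes "f integrable_on A" "\<And>x. x \<in> A \<Longrightarrow> 0 \<le> f x" "set_borel_measurable borel A f"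
  shows "set_integrable lborel A f"
proof -
  have "set_integrable lebesgue A f" by (rule nonnegative_absolutely_integrable_1) (use assms in auto)
  then show ?thesis
    using assms(3) unfolding set_integrable_def set_borel_measurable_def by (subst (asm) integrable_completion) auto
qed

text \<open>The radial factor of the majorant in \<open>norm_density_integrand_le\<close>.\<close>

lemma integrable_powr_cutoff:
  fixes R \<nu> :: real
  assumes "0 < R" "0 < \<nu>"
  shows "integrable lborel (\<lambda>r. indicator {0<..} r * (if r \<le> R then r powr 8 else r powr (- 1 - \<nu>)))"
proof -
  have "set_integrable lborel {0..R} (\<lambda>r. r powr 8)"
    by (rule set_integrable_lborel_nonneg) (use assms in \<open>auto intro!: integrable_on_powr_from_0 simp: set_borel_measurable_def\<close>)
  moreover have "set_integrable lborel {R..} (\<lambda>r. r powr (- 1 - \<nu>))"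
  proof (rule set_integrable_lborel_nonneg)
    show "(\<lambda>r. r powr (- 1 - \<nu>)) integrable_on {R..}"
      using has_integral_powr_to_inf[of "- 1 - \<nu>" R] assms by (auto simp: integrable_on_def)
  qed (auto simp: set_borel_measurable_def)
  ultimately have "integrable lborel (\<lambda>r. indicator {0..R} r *\<^sub>R r powr 8 + indicator {R..} r *\<^sub>R r powr (- 1 - \<nu>))"
    unfolding set_integrable_def by (rule Bochner_Integration.integrable_add)
  then show ?thesis
    by (rule Bochner_Integration.integrable_bound) (auto intro!: AE_I2 simp: indicator_def)
qed

text \<open>Taylor expansion gives \<open>sin x \<ge> x - x ^ 3 / 6\<close>, and
  \<open>x ^ 3 \<le> 4 * x\<close> leaves one third of \<open>x\<close>.\<close>

lemma sin_ge_third: "x / 3 \<le> sin x" if "0 \<le> x" "x \<le> 2" for x :: real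
proof -
  have "\<bar>sin x - (\<Sum>m<3. sin_coeff m * x ^ m)\<bar> \<le> inverse (fact 3) * \<bar>x\<bar> ^ 3"
    by (rule Maclaurin_sin_bound)
  then have "\<bar>sin x - x\<bar> \<le> x ^ 3 / 6"
    using that by (simp add: sin_coeff_def eval_nat_numeral)
  moreover have "x ^ 3 \<le> 4 * x"
  proof -
    have "x * x \<le> 2 * 2" using that by (intro mult_mono) auto
    then have "(x * x) * x \<le> 4 * x" using that by (intro mult_right_mono) auto
    then show ?thesis by (simp add: power3_eq_cube)
  qed
  ultimately show ?thesis by linarith
qed

text \<open>The cosine is at least a third of the distance to the nearer of the two endpoints, so
  the singularities are no worse than those of a power with exponent above -1.\<close>

lemma integrable_cos_powr:
  fixes p :: real
  assumes "0 < p" "p < 1"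
  shows "integrable lborel (\<lambda>\<theta>. indicator {- pi / 2<..<pi / 2} \<theta> * cos \<theta> powr (- p))"
proof -
  define u where "u t = indicator {0..pi} t *\<^sub>R t powr (- p)" for t :: real
  have u: "integrable lborel u"
  proof -
    have "set_integrable lborel {0..pi} (\<lambda>t. t powr (- p))"
      by (rule set_integrable_lborel_nonneg) (use assms in \<open>auto intro!: integrable_on_powr_from_0 simp: set_borel_measurable_def\<close>)
    then show ?thesis by (simp add: set_integrable_def u_def[abs_def])
  qed
  have "integrable lborel (\<lambda>\<theta>. 3 powr p * (u (pi / 2 + 1 * \<theta>) + u (pi / 2 + (- 1) * \<theta>)))"
    by (intro integrable_mult_right Bochner_Integration.integrable_add lborel_integrable_real_affine u) auto
  then show ?thesis
  proof (rule Bochner_Integration.integrable_bound)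
    show "AE \<theta> in lborel. norm (indicator {- pi / 2<..<pi / 2} \<theta> * cos \<theta> powr (- p)) \<le> norm (3 powr p * (u (pi / 2 + 1 * \<theta>) + u (pi / 2 + (- 1) * \<theta>)))"
    proof (intro AE_I2)
      fix \<theta> :: real
      have u0: "0 \<le> u t" for t by (simp add: u_def)
      show "norm (indicator {- pi / 2<..<pi / 2} \<theta> * cos \<theta> powr (- p)) \<le> norm (3 powr p * (u (pi / 2 + 1 * \<theta>) + u (pi / 2 + (- 1) * \<theta>)))"
      proof (cases "\<theta> \<in> {- pi / 2<..<pi / 2}")
        case True
        define \<phi> where "\<phi> = pi / 2 - \<bar>\<theta>\<bar>"
        have \<phi>: "0 < \<phi>" "\<phi> \<le> pi / 2" using True by (auto simp: \<phi>_def abs_if)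
        have "\<phi> / 3 \<le> sin \<phi>" using \<phi> pi_less_4 by (intro sin_ge_third) auto
        also have "sin \<phi> = cos \<bar>\<theta>\<bar>" by (simp add: \<phi>_def sin_cos_eq)
        finally have "\<phi> / 3 \<le> cos \<theta>" by simp
        then have "cos \<theta> powr (- p) \<le> (\<phi> / 3) powr (- p)" using \<phi> assms by (intro powr_mono2') auto
        also have "\<dots> = 3 powr p * \<phi> powr (- p)" using \<phi> by (simp add: powr_divide powr_minus field_simps)
        also have "\<phi> powr (- p) \<le> u (pi / 2 + 1 * \<theta>) + u (pi / 2 + (- 1) * \<theta>)"
        proof (cases "\<theta> \<ge> 0")
          case t: True
          then have "\<phi> powr (- p) = u (pi / 2 + (- 1) * \<theta>)" using True by (auto simp: u_def \<phi>_def indicator_def)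
          then show ?thesis using u0[of "pi / 2 + 1 * \<theta>"] by linarith
        next
          case f: False
          then have "\<phi> powr (- p) = u (pi / 2 + 1 * \<theta>)" using True by (auto simp: u_def \<phi>_def indicator_def)
          then show ?thesis using u0[of "pi / 2 + (- 1) * \<theta>"] by linarith
        qed
        finally have "cos \<theta> powr (- p) \<le> 3 powr p * (u (pi / 2 + 1 * \<theta>) + u (pi / 2 + (- 1) * \<theta>))" by simp
        then show ?thesis using True u0 by simp
      qed (use u0 in simp)
    qed
  qed simp
qed

text \<open>
  The exponential factor is \<open>exp (- v)\<close> with \<open>v\<close> proportional to \<open>(sec \<theta>)^(1/2) r^(-3/2)\<close>, and it is estimated by
  a multiple of \<open>v powr - j\<close>. For small \<open>r\<close> the choice \<open>j = 7\<close> removes \<open>\<theta>\<close> altogether. For large \<open>r\<close>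
  integrability in \<open>\<theta>\<close> needs \<open>j > 5 - 2\<nu>\<close> and integrability in \<open>r\<close> needs \<open>j < 5 - 2\<nu>/3\<close>, whence \<open>k\<close>.
\<close>

lemma norm_density_integrand_le:
  fixes \<theta> r x \<xi> \<nu> C R :: real
  assumes \<nu>: "0 < \<nu>" "\<nu> < 3 / 2" and \<theta>: "\<bar>\<theta>\<bar> < pi / 2" and r: "0 < r" and \<xi>: "0 < \<xi>" and C: "0 \<le> C"
    and P1: "norm (Psi_star \<nu> \<Psi> (of_real r * exp (\<i> * of_real (\<theta> / 3)))) \<le> C * (r powr (- \<nu>) * cos \<theta> powr (- \<nu>))"
    and P2: "R < r \<Longrightarrow> norm (Psi_star \<nu> \<Psi> (of_real r * exp (\<i> * of_real (\<theta> / 3)))) \<le> C * r powr (- 6)"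
  defines "k \<equiv> 5 - 4 * \<nu> / 3"
  defines "K \<equiv> exp (\<xi> * x powr (-2/3)) * C * (7 powr 7 * \<xi> powr (- 21 / 2) + k powr k * \<xi> powr (- 3 * k / 2))"
  shows "norm (density_integrand \<nu> \<Psi> \<xi> x \<theta> r) \<le>
     cos \<theta> powr (- (1 - \<nu> / 3)) * (K * (if r \<le> R then r powr 8 else r powr (- 1 - \<nu>)))"
proof -
  define S where "S = sec \<theta>"
  have cpos: "0 < cos \<theta>" using \<theta> by (intro cos_gt_zero_pi) auto
  have S0: "0 < S" using cpos by (simp add: S_def sec_def)
  have cS: "cos \<theta> = S powr (- 1)" using cpos by (simp add: S_def sec_def powr_minus_divide)
  have S1: "1 \<le> S" using cpos by (simp add: S_def sec_def)
  \<comment> \<open>Minus the real part of the second term in the exponent: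
    \<open>cos \<theta>\<close> lowers the power of \<open>sec \<theta>\<close> from 3/2 to
    1/2.\<close>
  define v where "v = \<xi> powr (3/2) * S powr (1/2) * r powr (- 3/2)"
  have v: "0 < v" using \<xi> S0 r by (simp add: v_def)
  have vk: "v powr (- j) = \<xi> powr (- 3 * j / 2) * S powr (- j / 2) * r powr (3 * j / 2)" for j
    unfolding v_def using \<xi> S0 r by (simp add: powr_mult powr_powr)
  have ex: "cos \<theta> * ((\<xi> * S) powr (3/2) * r powr (-3/2)) = v"
  proof -
    have "S powr (- 1) * S powr (3/2) = S powr (1/2)" unfolding powr_add[symmetric] by simp
    then show ?thesis
      unfolding v_def cS powr_mult[of \<xi> S] by (metis mult.assoc mult.left_commute divide_minus_left)
  qed
  have "norm (density_integrand \<nu> \<Psi> \<xi> x \<theta> r) =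
     exp (\<xi> * x powr (-2/3) * (S * cos \<theta>) - cos \<theta> * ((\<xi> * S) powr (3/2) * r powr (-3/2)))
       * (S powr (7/2 - \<nu>) * r powr (\<nu> - 5/2)) * norm (Psi_star \<nu> \<Psi> (of_real r * exp (\<i> * of_real (\<theta> / 3))))"
    unfolding density_integrand_def norm_mult S_def[symmetric] by (simp add: Re_exp abs_mult mult_ac norm_mult)
  also have "S * cos \<theta> = 1" using cpos by (simp add: S_def sec_def)
  finally have eq: "norm (density_integrand \<nu> \<Psi> \<xi> x \<theta> r) =
     exp (\<xi> * x powr (-2/3)) * (exp (- v) * (S powr (7/2 - \<nu>) * r powr (\<nu> - 5/2)) * norm (Psi_star \<nu> \<Psi> (of_real r * exp (\<i> * of_real (\<theta> / 3)))))"
    unfolding ex by (simp add: exp_diff exp_minus field_simps)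
  \<comment> \<open>\<open>k\<close> is the midpoint of the admissible exponents, between
    \<open>5 - 2 * \<nu>\<close> and \<open>5 - 2 * \<nu> / 3\<close>.\<close>
  have k: "0 < k" using \<nu> by (simp add: k_def)
  define B where "B = (if r \<le> R then r powr 8 else r powr (- 1 - \<nu>))"
  have bound: "exp (- v) * (S powr (7/2 - \<nu>) * r powr (\<nu> - 5/2)) * norm (Psi_star \<nu> \<Psi> (of_real r * exp (\<i> * of_real (\<theta> / 3))))
     \<le> C * (7 powr 7 * \<xi> powr (- 21 / 2) + k powr k * \<xi> powr (- 3 * k / 2)) * (S powr (1 - \<nu> / 3) * B)"
  proof (cases "r \<le> R")
    case True
    have "exp (- v) * (S powr (7/2 - \<nu>) * r powr (\<nu> - 5/2)) * norm (Psi_star \<nu> \<Psi> (of_real r * exp (\<i> * of_real (\<theta> / 3))))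
      \<le> (7 powr 7 * v powr (- 7)) * (S powr (7/2 - \<nu>) * r powr (\<nu> - 5/2)) * (C * (r powr (- \<nu>) * cos \<theta> powr (- \<nu>)))"
      using exp_neg_le_powr[OF v, of 7] C by (intro mult_mono P1) auto
    also have "\<dots> = C * (7 powr 7 * \<xi> powr (- 21 / 2)) * ((S powr (- 7 / 2) * S powr (7/2 - \<nu>) * S powr \<nu>) * (r powr (21 / 2) * r powr (\<nu> - 5/2) * r powr (- \<nu>)))"
      unfolding vk cS powr_powr by simp
    also have "S powr (- 7 / 2) * S powr (7/2 - \<nu>) * S powr \<nu> = 1" using S0 by (simp flip: powr_add)
    also have "r powr (21 / 2) * r powr (\<nu> - 5/2) * r powr (- \<nu>) = r powr 8" using r by (simp flip: powr_add)
    \<comment> \<open>Since \<open>S \<ge> 1\<close>, the extra factor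
      \<open>S powr (1 - \<nu> / 3)\<close> only enlarges the bound, and one angular factor serves
      small and large \<open>r\<close>.\<close>
    also have "C * (7 powr 7 * \<xi> powr (- 21 / 2)) * (1 * r powr 8) \<le> C * (7 powr 7 * \<xi> powr (- 21 / 2) + k powr k * \<xi> powr (- 3 * k / 2)) * (S powr (1 - \<nu> / 3) * B)"
      using C S1 True \<nu> by (intro mult_mono mult_nonneg_nonneg) (auto simp: B_def ge_one_powr_ge_zero)
    finally show ?thesis .
  next
    case False
    have "exp (- v) * (S powr (7/2 - \<nu>) * r powr (\<nu> - 5/2)) * norm (Psi_star \<nu> \<Psi> (of_real r * exp (\<i> * of_real (\<theta> / 3))))
      \<le> (k powr k * v powr (- k)) * (S powr (7/2 - \<nu>) * r powr (\<nu> - 5/2)) * (C * r powr (- 6))"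
      using exp_neg_le_powr[OF v k] C False by (intro mult_mono P2) auto
    also have "\<dots> = C * (k powr k * \<xi> powr (- 3 * k / 2)) * ((S powr (- k / 2) * S powr (7/2 - \<nu>)) * (r powr (3 * k / 2) * r powr (\<nu> - 5/2) * r powr (- 6)))"
      unfolding vk by simp
    also have "S powr (- k / 2) * S powr (7/2 - \<nu>) = S powr (1 - \<nu> / 3)"
      unfolding powr_add[symmetric] by (rule arg_cong[where f="\<lambda>z. S powr z"]) (simp add: k_def field_simps)
    also have "r powr (3 * k / 2) * r powr (\<nu> - 5/2) * r powr (- 6) = B"
    proof -
      have "r powr (3 * k / 2) * r powr (\<nu> - 5/2) * r powr (- 6) = r powr (- 1 - \<nu>)"
        unfolding powr_add[symmetric] by (rule arg_cong[where f="\<lambda>z. r powr z"]) (simp add: k_def field_simps)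
      then show ?thesis using False by (simp add: B_def)
    qed
    also have "C * (k powr k * \<xi> powr (- 3 * k / 2)) * (S powr (1 - \<nu> / 3) * B) \<le> C * (7 powr 7 * \<xi> powr (- 21 / 2) + k powr k * \<xi> powr (- 3 * k / 2)) * (S powr (1 - \<nu> / 3) * B)"
      using C by (intro mult_right_mono mult_left_mono) (auto simp: B_def)
    finally show ?thesis .
  qed
  have "cos \<theta> powr (- (1 - \<nu> / 3)) = S powr (1 - \<nu> / 3)" unfolding cS powr_powr by simp
  then show ?thesis
    unfolding eq using mult_left_mono[OF bound, of "exp (\<xi> * x powr (-2/3))"] by (simp add: K_def B_def mult_ac)
qed

text \<open>The substitution \<open>p = - 3 / 2 * q\<close> for \<open>r = exp q\<close> brings in
  2/3 and \<open>residue_kernel\<close> brings in 4 pi i/3, whence 8/9. The pole depends on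
  \<open>y\<close> only through \<open>c / y\<close>, so the expectation over \<open>y\<close>
  remains on the right.\<close>

lemma (in gamma_Laplace_law) Psi_star_Laplace:
  assumes \<theta>: "\<bar>\<theta>\<bar> < pi / 2" and c: "0 < c"
  defines "w \<equiv> of_real c * exp (\<i> * of_real \<theta>)"
  defines "g \<equiv> \<lambda>\<zeta>. exp (- exp (\<zeta> + \<i> * of_real (\<theta> / 3)) + of_real \<nu> * \<zeta>)"
  shows "(LBINT r:{0<..}. exp (- w * of_real (r powr (-3/2))) * of_real (r powr (\<nu> - 5/2))
            * Psi_star \<nu> \<Psi> (of_real r * exp (\<i> * of_real (\<theta> / 3))))
    = 8 * pi * \<i> / (9 * of_real (Gamma \<nu>)) * ((\<integral>y. g (Complex (2 / 3 * ln (c / y)) (2 / 3 * \<theta>)) \<partial>M) / w)"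
proof -
  define k where "k \<epsilon> y a = g (Complex a (\<epsilon> * pi / 3)) / (w - of_real y * exp (3 / 2 * Complex a (\<epsilon> * pi / 3)))" for \<epsilon> y a
  define h where "h \<epsilon> s = (\<integral>a. g (Complex a (\<epsilon> * pi / 3)) * char M (\<epsilon> * exp (3 / 2 * a) * s) \<partial>lborel)" for \<epsilon> s
  define F where "F p = of_real (exp p) * exp (- w * of_real (exp p)) * (h 1 (exp p) - h (- 1) (exp p))" for p
  have cm [measurable]: "cut_integral M \<nu> \<theta> \<epsilon> \<in> borel_measurable borel" for \<epsilon>
    unfolding cut_integral_def by measurable
  have L: "(\<integral>p. of_real (exp p) * exp (- w * of_real (exp p)) * h \<epsilon> (exp p) \<partial>lborel) = (\<integral>y. (\<integral>a. k \<epsilon> y a \<partial>lborel) \<partial>M)"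
    "integrable M (\<lambda>y. \<integral>a. k \<epsilon> y a \<partial>lborel)"
    "integrable lborel (\<lambda>p. of_real (exp p) * exp (- w * of_real (exp p)) * h \<epsilon> (exp p))"
    if "\<epsilon> = 1 \<or> \<epsilon> = - 1" for \<epsilon>
    unfolding w_def g_def h_def k_def by (rule Laplace_cut_integral[OF \<theta> c \<nu>_pos that])+
  have "(LBINT r:{0<..}. exp (- w * of_real (r powr (-3/2))) * of_real (r powr (\<nu> - 5/2))
            * Psi_star \<nu> \<Psi> (of_real r * exp (\<i> * of_real (\<theta> / 3))))
     = (LBINT r:{0<..}. exp (- w * of_real (r powr (-3/2))) * of_real (r powr (\<nu> - 5/2))
            * ((cut_integral M \<nu> \<theta> 1 r - cut_integral M \<nu> \<theta> (- 1) r) / of_real (Gamma \<nu>)))"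
    using Psi_star_eq_cut_integral[OF _ \<theta>] by (intro set_lebesgue_integral_cong) auto
  also have "\<dots> = (\<integral>q. exp q *\<^sub>R (exp (- w * of_real (exp q powr (-3/2))) * of_real (exp q powr (\<nu> - 5/2))
            * ((cut_integral M \<nu> \<theta> 1 (exp q) - cut_integral M \<nu> \<theta> (- 1) (exp q)) / of_real (Gamma \<nu>))) \<partial>lborel)"
    by (rule integral_exp_substitution(2)[symmetric]) (unfold set_borel_measurable_def, measurable)
  also have "\<dots> = (\<integral>q. F (0 + (- 3 / 2) * q) / of_real (Gamma \<nu>) \<partial>lborel)"
  proof (intro Bochner_Integration.integral_cong refl)
    fix q :: real
    have e: "exp q powr (-3/2) = exp (-3/2 * q)" by (simp add: powr_def)
    \<comment> \<open>The weight \<open>r powr (\<nu> - 5/2)\<close>, the factor \<open>r\<close>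
      from the substitution and the \<open>r^(-\<nu>)\<close> of \<open>cut_integral_exp\<close>
      combine to \<open>r^(-3/2) = exp p\<close>, the factor required by
      \<open>Laplace_cut_integral\<close>.\<close>
    have e2: "complex_of_real (exp q) * (of_real (exp q powr (\<nu> - 5/2)) * of_real (exp (- \<nu> * q))) = of_real (exp (-3/2 * q))"
      unfolding of_real_mult[symmetric] by (simp add: powr_def algebra_simps flip: exp_add)
    have cut: "cut_integral M \<nu> \<theta> \<epsilon> (exp q) = of_real (exp (- \<nu> * q)) * h \<epsilon> (exp (-3/2 * q))" for \<epsilon>
      unfolding h_def g_def by (rule cut_integral_exp)
    have "exp q *\<^sub>R (exp (- w * of_real (exp q powr (-3/2))) * of_real (exp q powr (\<nu> - 5/2))
            * ((cut_integral M \<nu> \<theta> 1 (exp q) - cut_integral M \<nu> \<theta> (- 1) (exp q)) / of_real (Gamma \<nu>)))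
       = (complex_of_real (exp q) * (of_real (exp q powr (\<nu> - 5/2)) * of_real (exp (- \<nu> * q))))
          * exp (- w * of_real (exp (-3/2 * q))) * (h 1 (exp (-3/2 * q)) - h (- 1) (exp (-3/2 * q))) / of_real (Gamma \<nu>)"
      unfolding cut e scaleR_conv_of_real by (simp only: right_diff_distrib left_diff_distrib diff_divide_distrib times_divide_eq_right mult_ac)
    also have "\<dots> = F (0 + (- 3 / 2) * q) / of_real (Gamma \<nu>)"
      unfolding e2 F_def by simp
    finally show "exp q *\<^sub>R (exp (- w * of_real (exp q powr (-3/2))) * of_real (exp q powr (\<nu> - 5/2))
            * ((cut_integral M \<nu> \<theta> 1 (exp q) - cut_integral M \<nu> \<theta> (- 1) (exp q)) / of_real (Gamma \<nu>)))
       = F (0 + (- 3 / 2) * q) / of_real (Gamma \<nu>)" .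
  qed
  also have "\<dots> = (2 / 3) * (\<integral>p. F p \<partial>lborel) / of_real (Gamma \<nu>)"
    by (subst (2) lborel_integral_real_affine[where c="- 3 / 2" and t=0]) (auto simp: scaleR_conv_of_real)
  also have "(\<integral>p. F p \<partial>lborel) = (\<integral>y. (\<integral>a. k 1 y a \<partial>lborel) \<partial>M) - (\<integral>y. (\<integral>a. k (- 1) y a \<partial>lborel) \<partial>M)"
    unfolding F_def right_diff_distrib
    by (subst Bochner_Integration.integral_diff) (simp_all only: L simp_thms)
  also have "\<dots> = (\<integral>y. (\<integral>a. k 1 y a \<partial>lborel) - (\<integral>a. k (- 1) y a \<partial>lborel) \<partial>M)"
    by (rule Bochner_Integration.integral_diff[symmetric]) (simp_all only: L simp_thms)
  also have "\<dots> = (\<integral>y. 4 * pi * \<i> / 3 * g (Complex (2 / 3 * ln (c / y)) (2 / 3 * \<theta>)) / w \<partial>M)"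
  proof (rule integral_cong_AE)
    show "AE y in M. (\<integral>a. k 1 y a \<partial>lborel) - (\<integral>a. k (- 1) y a \<partial>lborel) = 4 * pi * \<i> / 3 * g (Complex (2 / 3 * ln (c / y)) (2 / 3 * \<theta>)) / w"
      using pos
    proof eventually_elim
      case (elim y)
      show ?case unfolding k_def w_def g_def by (simp only: residue_kernel[OF \<theta> c elim \<nu>_pos] mult_1 mult_minus1)
    qed
  qed (use L(2)[of 1] L(2)[of "-1"] in \<open>simp_all add: g_def\<close>)
  also have "\<dots> = 4 * pi * \<i> / 3 * ((\<integral>y. g (Complex (2 / 3 * ln (c / y)) (2 / 3 * \<theta>)) \<partial>M) / w)" by simp
  finally show ?thesis by (simp add: mult_ac)
qed

section \<open>The density\<close>

text \<open>
  With \<open>Y = X^(-2/3)\<close> for \<open>X\<close> distributed according to \<open>M\<close>, \<open>G\<close> is the Laplace transform of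
  \<open>Y^\<nu> dP\<close>. Tilting this measure by \<open>exp (- \<xi> Y)\<close> and normalising gives a
  law on the line with characteristic function proportional to \<open>G (\<xi> - \<i>\<tau>)\<close>.
\<close>

lemma (in real_distribution) density_from_power_Laplace:
  fixes \<nu> \<xi> :: real
  assumes pos: "AE y in M. 0 < y" and \<nu>: "0 < \<nu>" and \<xi>: "0 < \<xi>"
  defines "G \<equiv> \<lambda>u. \<integral>y. of_real (y powr (- 2 * \<nu> / 3)) * exp (- u * of_real (y powr (-2/3))) \<partial>M"
  assumes int: "integrable lborel (\<lambda>\<tau>. G (of_real \<xi> - \<i> * of_real \<tau>))"
  defines "I \<equiv> \<lambda>x. 1 / (3 * pi) * x powr (2 * \<nu> / 3 - 5/3) *
      (\<integral>\<tau>. exp ((of_real \<xi> - \<i> * of_real \<tau>) * of_real (x powr (-2/3))) * G (of_real \<xi> - \<i> * of_real \<tau>) \<partial>lborel)"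
  defines "f \<equiv> \<lambda>x. if 0 < x then Re (I x) else 0"
  shows "\<And>x. 0 < x \<Longrightarrow> of_real (f x) = I x" and "\<And>x. 0 \<le> f x" and "continuous_on {0<..} f"
    and "M = density lborel (\<lambda>x. ennreal (f x))"
proof -
  define d where "d y = y powr (- 2 * \<nu> / 3) * exp (- \<xi> * y powr (-2/3))" for y :: real
  have [measurable]: "d \<in> borel_measurable borel" unfolding d_def by measurable
  have d0: "0 \<le> d y" for y by (simp add: d_def)
  have dpos: "0 < d y" if "0 < y" for y using that by (simp add: d_def)
  \<comment> \<open>The tilt makes the weight bounded, so the tilted measure is finite even where
    \<open>Y^\<nu>\<close> has infinite expectation.\<close>
  have dle: "d y \<le> \<nu> powr \<nu> * \<xi> powr (- \<nu>)" if "0 < y" for y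
  proof -
    define z where "z = y powr (-2/3)"
    have z: "0 < z" using that by (simp add: z_def)
    have zn: "z powr \<nu> = y powr (- 2 * \<nu> / 3)" by (simp add: z_def powr_powr)
    have "exp (- (\<xi> * z)) \<le> \<nu> powr \<nu> * (\<xi> * z) powr (- \<nu>)"
      using \<xi> z \<nu> by (intro exp_neg_le_powr) auto
    then have "z powr \<nu> * exp (- (\<xi> * z)) \<le> z powr \<nu> * (\<nu> powr \<nu> * (\<xi> * z) powr (- \<nu>))"
      by (intro mult_left_mono) auto
    also have "\<dots> = \<nu> powr \<nu> * \<xi> powr (- \<nu>) * (z powr \<nu> * z powr (- \<nu>))" by (simp add: powr_mult)
    also have "z powr \<nu> * z powr (- \<nu>) = 1" using z by (simp flip: powr_add)
    finally have "z powr \<nu> * exp (- (\<xi> * z)) \<le> \<nu> powr \<nu> * \<xi> powr (- \<nu>)" by simp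
    then show ?thesis unfolding d_def zn[symmetric] z_def by simp
  qed
  have intd: "integrable M d"
    by (rule Bochner_Integration.integrable_bound[where f="\<lambda>_. \<nu> powr \<nu> * \<xi> powr (- \<nu>)"])
       (use pos dle d0 in \<open>auto elim!: eventually_mono\<close>)
  define G0 where "G0 = (\<integral>y. d y \<partial>M)"
  have G0: "0 < G0"
  proof -
    have "G0 \<noteq> 0"
    proof
      assume "G0 = 0"
      then have "AE y in M. d y = 0"
        using integral_nonneg_eq_0_iff_AE[OF intd] d0 by (simp add: G0_def)
      with pos have "AE y in M. False" by eventually_elim (use dpos in force)
      then show False by simp
    qed
    moreover have "0 \<le> G0" unfolding G0_def using d0 by simp
    ultimately show ?thesis by simp
  qed
  define D where "D = density M (\<lambda>y. ennreal (d y / G0))"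
  define Q where "Q = distr D borel (\<lambda>y. y powr (-2/3))"
  have "(\<integral>\<^sup>+ y. ennreal (d y / G0) \<partial>M) = ennreal (\<integral>y. d y / G0 \<partial>M)"
    using intd d0 G0 by (intro nn_integral_eq_integral) auto
  also have "\<dots> = 1" using G0 by (simp flip: G0_def)
  finally have "emeasure D (space D) = 1" unfolding D_def by (simp add: emeasure_density)
  then interpret D: prob_space D by (rule prob_spaceI)
  interpret Q: real_distribution Q
    unfolding Q_def by (rule D.real_distribution_distr) (simp add: D_def)
  have char: "char Q \<tau> = G (of_real \<xi> - \<i> * of_real \<tau>) / of_real G0" for \<tau>
  proof -
    have "char Q \<tau> = (\<integral>y. iexp (\<tau> * y powr (-2/3)) \<partial>D)"
      unfolding char_def Q_def by (rule integral_distr) (auto simp: D_def)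
    also have "\<dots> = (\<integral>y. (d y / G0) *\<^sub>R iexp (\<tau> * y powr (-2/3)) \<partial>M)"
      unfolding D_def using d0 G0 by (intro integral_density) auto
    also have "\<dots> = (\<integral>y. of_real (y powr (- 2 * \<nu> / 3)) * exp (- (of_real \<xi> - \<i> * of_real \<tau>) * of_real (y powr (-2/3))) / of_real G0 \<partial>M)"
    proof (intro Bochner_Integration.integral_cong refl)
      fix y :: real
      have "- (of_real \<xi> - \<i> * of_real \<tau>) * of_real (y powr (-2/3)) = of_real (- \<xi> * y powr (-2/3)) + \<i> * of_real (\<tau> * y powr (-2/3))"
        by (simp add: algebra_simps)
      then have "exp (- (of_real \<xi> - \<i> * of_real \<tau>) * of_real (y powr (-2/3))) = of_real (exp (- \<xi> * y powr (-2/3))) * iexp (\<tau> * y powr (-2/3))"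
        by (simp only: exp_add exp_of_real)
      then show "(d y / G0) *\<^sub>R iexp (\<tau> * y powr (-2/3)) = of_real (y powr (- 2 * \<nu> / 3)) * exp (- (of_real \<xi> - \<i> * of_real \<tau>) * of_real (y powr (-2/3))) / of_real G0"
        unfolding d_def by (simp only:) (simp add: scaleR_conv_of_real)
    qed
    finally show ?thesis unfolding G_def by (simp only: integral_divide_zero)
  qed
  have intc: "integrable lborel (char Q)" unfolding char using int by simp
  define q where "q z = (\<integral>t. iexp (-(t * z)) * char Q t \<partial>lborel) / (2 * pi)" for z
  note q = Q.integrable_char_density[OF intc, folded q_def]
  have [measurable]: "(\<lambda>z. Re (q z)) \<in> borel_measurable borel"
    by (intro borel_measurable_continuous_onI continuous_intros q(1))
  \<comment> \<open>The 2 pi in the definition of \<open>q\<close> turns 1/(3 pi) into 2/3, the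
    factor in the derivative of \<open>x powr (-2/3)\<close>.\<close>
  have I_eq: "I x = of_real (2 / 3 * x powr (2 * \<nu> / 3 - 5/3) * exp (\<xi> * x powr (-2/3)) * G0) * q (x powr (-2/3))" for x
  proof -
    have "(\<integral>\<tau>. exp ((of_real \<xi> - \<i> * of_real \<tau>) * of_real (x powr (-2/3))) * G (of_real \<xi> - \<i> * of_real \<tau>) \<partial>lborel)
      = (\<integral>\<tau>. of_real (exp (\<xi> * x powr (-2/3)) * G0) * (iexp (-(\<tau> * x powr (-2/3))) * char Q \<tau>) \<partial>lborel)"
    proof (intro Bochner_Integration.integral_cong refl)
      fix \<tau> :: real
      have "(of_real \<xi> - \<i> * of_real \<tau>) * of_real (x powr (-2/3)) = of_real (\<xi> * x powr (-2/3)) + \<i> * of_real (- (\<tau> * x powr (-2/3)))"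
        by (simp add: algebra_simps)
      then have "exp ((of_real \<xi> - \<i> * of_real \<tau>) * of_real (x powr (-2/3))) = of_real (exp (\<xi> * x powr (-2/3))) * iexp (-(\<tau> * x powr (-2/3)))"
        by (simp only: exp_add exp_of_real)
      then show "exp ((of_real \<xi> - \<i> * of_real \<tau>) * of_real (x powr (-2/3))) * G (of_real \<xi> - \<i> * of_real \<tau>)
        = of_real (exp (\<xi> * x powr (-2/3)) * G0) * (iexp (-(\<tau> * x powr (-2/3))) * char Q \<tau>)"
        unfolding char using G0 by (simp only:) simp
    qed
    also have "\<dots> = of_real (exp (\<xi> * x powr (-2/3)) * G0) * (2 * pi * q (x powr (-2/3)))"
      unfolding q_def by simp
    finally show ?thesis unfolding I_def by simp
  qed
  define cf where "cf x = 2 / 3 * x powr (2 * \<nu> / 3 - 5/3) * exp (\<xi> * x powr (-2/3)) * G0" for x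
  have cf0: "0 \<le> cf x" for x using G0 by (simp add: cf_def)
  have ReI: "Re (I x) = cf x * Re (q (x powr (-2/3)))" for x
    unfolding I_eq cf_def by (simp only: Re_complex_of_real times_complex.sel Im_complex_of_real mult_zero_left diff_zero)
  show f_eq: "of_real (f x) = I x" if "0 < x" for x
    using that q(2)[of "x powr (-2/3)"] unfolding f_def ReI by (simp add: I_eq cf_def)
  show f0: "0 \<le> f x" for x unfolding f_def ReI using cf0 q(3) by simp
  have "continuous_on {0<..} (\<lambda>x. cf x * Re (q (x powr (-2/3))))"
    unfolding cf_def by (intro continuous_intros continuous_on_compose2[OF q(1)]) auto
  then show "continuous_on {0<..} f"
    by (rule continuous_on_eq) (simp add: f_def ReI)
  have [measurable]: "f \<in> borel_measurable borel"
    unfolding f_def ReI cf_def by measurable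
  show "M = density lborel (\<lambda>x. ennreal (f x))"
  proof (rule measure_eqI)
    fix A assume "A \<in> sets M"
    then have A [measurable]: "A \<in> sets borel" by simp
    \<comment> \<open>\<open>z powr (- \<nu>) * exp (\<xi> * z) * G0\<close> undoes tilt and
      normalisation, so on positive \<open>z\<close> this is the density of \<open>Y\<close>
      restricted to the event that \<open>X\<close> lies in \<open>A\<close>.\<close>
    define h where "h z = indicator A (z powr (-3/2)) * (z powr (- \<nu>) * exp (\<xi> * z) * G0 * Re (q z))" for z :: real
    have [measurable]: "h \<in> borel_measurable borel" unfolding h_def by measurable
    have h0: "0 \<le> h z" for z unfolding h_def using G0 q(3) by simp
    have "emeasure M A = (\<integral>\<^sup>+y. indicator A y \<partial>M)" by simp
    also have "\<dots> = (\<integral>\<^sup>+y. ennreal (d y / G0) * ennreal (indicator {0<..} (y powr (-2/3)) * indicator A ((y powr (-2/3)) powr (-3/2)) *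
         ((y powr (-2/3)) powr (- \<nu>) * exp (\<xi> * y powr (-2/3)) * G0)) \<partial>M)"
    proof (rule nn_integral_cong_AE)
      show "AE y in M. indicator A y = ennreal (d y / G0) * ennreal (indicator {0<..} (y powr (-2/3)) * indicator A ((y powr (-2/3)) powr (-3/2)) *
         ((y powr (-2/3)) powr (- \<nu>) * exp (\<xi> * y powr (-2/3)) * G0))"
        using pos
      proof eventually_elim
        case (elim y)
        have 1: "(y powr (-2/3)) powr (-3/2) = y" using elim by (simp add: powr_powr)
        have "d y / G0 * ((y powr (-2/3)) powr (- \<nu>) * exp (\<xi> * y powr (-2/3)) * G0)
          = (y powr (- 2 * \<nu> / 3) * (y powr (-2/3)) powr (- \<nu>)) * (exp (- \<xi> * y powr (-2/3)) * exp (\<xi> * y powr (-2/3)))"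
          using G0 by (simp add: d_def)
        also have "\<dots> = 1" using elim by (simp add: powr_powr flip: powr_add exp_add)
        finally have 2: "d y / G0 * ((y powr (-2/3)) powr (- \<nu>) * exp (\<xi> * y powr (-2/3)) * G0) = 1" .
        show ?case
        proof (cases "y \<in> A")
          case True
          then have "ennreal (d y / G0) * ennreal (indicator {0<..} (y powr (-2/3)) * indicator A ((y powr (-2/3)) powr (-3/2)) *
            ((y powr (-2/3)) powr (- \<nu>) * exp (\<xi> * y powr (-2/3)) * G0))
            = ennreal (d y / G0 * ((y powr (-2/3)) powr (- \<nu>) * exp (\<xi> * y powr (-2/3)) * G0))"
            unfolding 1 using elim d0[of y] G0 by (subst ennreal_mult) auto
          then show ?thesis unfolding 2 using True by simp
        next
          case False
          then show ?thesis unfolding 1 by simp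
        qed
      qed
    qed
    also have "\<dots> = (\<integral>\<^sup>+z. ennreal (indicator {0<..} z * indicator A (z powr (-3/2)) * (z powr (- \<nu>) * exp (\<xi> * z) * G0)) \<partial>Q)"
      unfolding Q_def D_def by (subst nn_integral_distr, simp, simp, subst nn_integral_density) auto
    also have "\<dots> = (\<integral>\<^sup>+z. ennreal (Re (q z)) * ennreal (indicator {0<..} z * indicator A (z powr (-3/2)) * (z powr (- \<nu>) * exp (\<xi> * z) * G0)) \<partial>lborel)"
      by (subst q(4), subst nn_integral_density) auto
    also have "\<dots> = (\<integral>\<^sup>+z. ennreal (indicator {0<..} z * h z) \<partial>lborel)"
      using q(3) G0 by (intro nn_integral_cong) (simp add: h_def mult_ac flip: ennreal_mult)
    finally have EA: "emeasure M A = (\<integral>\<^sup>+z. ennreal (indicator {0<..} z * h z) \<partial>lborel)" .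
    \<comment> \<open>Finiteness comes from the identity just proved: the integral is the
      probability of \<open>A\<close>.\<close>
    have inth: "integrable lborel (\<lambda>z. indicator {0<..} z * h z)"
    proof (rule integrableI_nonneg)
      show "(\<integral>\<^sup>+z. ennreal (indicator {0<..} z * h z) \<partial>lborel) < \<infinity>"
        unfolding EA[symmetric] by (simp add: emeasure_eq_measure)
    qed (use h0 in auto)
    define g g' where "g x = x powr (-2/3)" and "g' x = -2/3 * x powr (-5/3)" for x :: real
    have subst: "set_integrable lborel {0<..} (\<lambda>x. \<bar>g' x\<bar> *\<^sub>R h (g x)) \<longleftrightarrow> set_integrable lborel {0<..} h"
      "(LBINT x:{0<..}. \<bar>g' x\<bar> *\<^sub>R h (g x)) = (LBINT x:{0<..}. h x)"
    proof -
      have der: "(g has_real_derivative g' x) (at x)" if "x \<in> {0<..}" for x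
        unfolding g_def g'_def using that by (auto intro!: derivative_eq_intros)
      have inv: "(x powr a) powr b = x" if "0 < x" "a * b = 1" for x a b :: real
        using that by (simp add: powr_powr)
      have inj: "inj_on g {0<..}"
        by (rule inj_on_inverseI[where g="\<lambda>z. z powr (-3/2)"]) (simp add: g_def inv)
      have im: "g ` {0<..} = {0<..}"
      proof (intro set_eqI iffI)
        fix z :: real assume "z \<in> {0<..}"
        then have "z = g (z powr (-3/2))" "z powr (-3/2) \<in> {0<..}" by (auto simp: g_def inv)
        then show "z \<in> g ` {0<..}" by blast
      qed (auto simp: g_def)
      have m: "set_borel_measurable borel {0<..} h" "set_borel_measurable borel {0<..} (\<lambda>x. \<bar>g' x\<bar> *\<^sub>R h (g x))"
        unfolding set_borel_measurable_def g_def g'_def by measurable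
      note * = set_lborel_substitution[OF _ der inj im m]
      show "set_integrable lborel {0<..} (\<lambda>x. \<bar>g' x\<bar> *\<^sub>R h (g x)) \<longleftrightarrow> set_integrable lborel {0<..} h"
        "(LBINT x:{0<..}. \<bar>g' x\<bar> *\<^sub>R h (g x)) = (LBINT x:{0<..}. h x)"
        by (rule *; simp)+
    qed
    have pt: "indicator {0<..} x *\<^sub>R (\<bar>g' x\<bar> *\<^sub>R h (g x)) = f x * indicator A x" for x
    proof (cases "0 < x")
      case True
      have "(x powr (-2/3)) powr (-3/2) = x" "(x powr (-2/3)) powr (- \<nu>) = x powr (2 * \<nu> / 3)" using True by (simp_all add: powr_powr)
      moreover have "x powr (-5/3) * x powr (2 * \<nu> / 3) = x powr (2 * \<nu> / 3 - 5/3)" by (simp flip: powr_add)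
      ultimately have "\<bar>g' x\<bar> * h (g x) = indicator A x * (2 / 3 * (x powr (-5/3) * x powr (2 * \<nu> / 3)) * exp (\<xi> * x powr (-2/3)) * G0 * Re (q (x powr (-2/3))))"
        by (simp add: g'_def h_def g_def abs_mult)
      also have "x powr (-5/3) * x powr (2 * \<nu> / 3) = x powr (2 * \<nu> / 3 - 5/3)" by (simp flip: powr_add)
      finally show ?thesis using True by (simp add: f_def ReI cf_def)
    qed (simp add: f_def)
    have inth': "set_integrable lborel {0<..} h" using inth by (simp add: set_integrable_def)
    have intf: "integrable lborel (\<lambda>x. f x * indicator A x)"
      using subst(1) inth' unfolding set_integrable_def pt by blast
    have "(\<integral>\<^sup>+z. ennreal (indicator {0<..} z * h z) \<partial>lborel) = ennreal (\<integral>z. indicator {0<..} z * h z \<partial>lborel)"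
      using inth h0 by (intro nn_integral_eq_integral) auto
    also have "(\<integral>z. indicator {0<..} z * h z \<partial>lborel) = (\<integral>x. f x * indicator A x \<partial>lborel)"
      using subst(2) unfolding set_lebesgue_integral_def pt by simp
    also have "ennreal \<dots> = (\<integral>\<^sup>+x. ennreal (f x * indicator A x) \<partial>lborel)"
      using intf f0 by (intro nn_integral_eq_integral[symmetric]) auto
    also have "\<dots> = emeasure (density lborel (\<lambda>x. ennreal (f x))) A"
      by (simp add: emeasure_density ennreal_mult' ennreal_indicator f0)
    finally show "emeasure M A = emeasure (density lborel (\<lambda>x. ennreal (f x))) A" using EA by simp
  qed simp
qed

section \<open>Joint integrability over angle and radius\<close>

lemma ray_mem_sector:
  assumes "0 < r" "\<bar>\<phi>\<bar> < \<alpha>" "\<alpha> \<le> pi"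
  shows "of_real r * exp (\<i> * of_real \<phi>) \<in> sector \<alpha>"
proof -
  have "Arg (of_real r * exp (\<i> * of_real \<phi>)) = \<phi>" using assms by (intro Arg_unique[of r]) auto
  then show ?thesis using assms by (simp add: sector_def)
qed

lemma continuous_on_Psi_star:
  assumes "\<Psi> analytic_on sector (5 * pi / 6)"
  shows "continuous_on ({-pi/2<..<pi/2} \<times> {0<..}) (\<lambda>p. Psi_star \<nu> \<Psi> (of_real (snd p) * exp (\<i> * of_real (fst p / 3))))"
proof -
  have c: "continuous_on (sector (5 * pi / 6)) \<Psi>"
    using assms analytic_imp_holomorphic holomorphic_on_imp_continuous_on by blast
  have "continuous_on ({-pi/2<..<pi/2} \<times> {0<..}) (\<lambda>p. \<Psi> (exp (of_real (\<epsilon> * (2 * pi / 3)) * \<i>) * (of_real (snd p) * exp (\<i> * of_real (fst p / 3)))))"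
    if "\<epsilon> = 1 \<or> \<epsilon> = - 1" for \<epsilon>
    using sector_halfplane[OF that rotation_in_halfplane[OF that]]
    by (intro continuous_on_compose2[OF c] continuous_intros) (auto simp: abs_if)
  from this[of 1] this[of "-1"] show ?thesis
    unfolding Psi_star_def by (intro continuous_intros) auto
qed

lemma continuous_on_density_integrand:
  assumes "\<Psi> analytic_on sector (5 * pi / 6)" "0 < \<xi>"
  shows "continuous_on ({-pi/2<..<pi/2} \<times> {0<..}) (\<lambda>(\<theta>, r). density_integrand \<nu> \<Psi> \<xi> x \<theta> r)"
proof -
  have cpos: "0 < cos \<theta>" if "\<theta> \<in> {-pi/2<..<pi/2}" for \<theta> :: real using that by (intro cos_gt_zero_pi) auto
  have "continuous_on ({-pi/2<..<pi/2} \<times> {0::real<..}) (\<lambda>p. sec (fst p))"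
    unfolding sec_def using cpos by (intro continuous_intros) fastforce
  moreover have "sec \<theta> \<noteq> 0" if "\<theta> \<in> {-pi/2<..<pi/2}" for \<theta> :: real using cpos[OF that] by (simp add: sec_def)
  ultimately show ?thesis
    unfolding density_integrand_def case_prod_beta using assms(2)
    by (intro continuous_intros continuous_on_Psi_star[OF assms(1)]) auto
qed

text \<open>The decay hypothesis bounds \<open>Psi_star\<close> beyond some radius, the estimate of
  \<open>cut_integral\<close> bounds it everywhere. Together they give a majorant that is a product
  of a function of \<open>\<theta>\<close> and a function of \<open>r\<close>; the exponent
  \<open>1 - \<nu> / 3\<close> of the angular factor lies strictly between 0 and 1.\<close>

lemma (in gamma_Laplace_law) set_integrable_density_integrand:
  assumes \<nu>: "\<nu> < 3 / 2" and decay: "Psi_star \<nu> \<Psi> \<in> O[sector_at_infinity (pi / 6)](\<lambda>z. complex_of_real (norm z powr (-6)))"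
    and \<xi>: "0 < \<xi>"
  shows "set_integrable lborel ({-pi/2<..<pi/2} \<times> {0<..}) (\<lambda>(\<theta>, r). density_integrand \<nu> \<Psi> \<xi> x \<theta> r)"
proof -
  have \<Gamma>: "0 < Gamma \<nu>" by (rule Gamma_real_pos[OF \<nu>_pos])
  obtain C2 where C2: "0 < C2" "\<forall>\<^sub>F z in sector_at_infinity (pi / 6). norm (Psi_star \<nu> \<Psi> z) \<le> C2 * norm (complex_of_real (norm z powr (-6)))"
    using decay by (rule landau_o.bigE)
  then obtain R0 where R0: "\<And>z. R0 \<le> norm z \<Longrightarrow> z \<in> sector (pi / 6) \<Longrightarrow> norm (Psi_star \<nu> \<Psi> z) \<le> C2 * norm z powr (-6)"
    unfolding sector_at_infinity_def eventually_inf_principal eventually_at_infinity by auto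
  define R where "R = max R0 1"
  \<comment> \<open>The factor 2 accounts for the two cut integrals in
    \<open>Psi_star\<close>.\<close>
  define C1 where "C1 = 2 * (3 powr \<nu> * (\<integral>a. exp (- exp a + \<nu> * a) \<partial>lborel)) / Gamma \<nu>"
  define C where "C = max C1 C2"
  have C: "0 \<le> C" using C2 by (simp add: C_def)
  have P1: "norm (Psi_star \<nu> \<Psi> (of_real r * exp (\<i> * of_real (\<theta> / 3)))) \<le> C * (r powr (- \<nu>) * cos \<theta> powr (- \<nu>))"
    if "0 < r" "\<bar>\<theta>\<bar> < pi / 2" for r \<theta>
  proof -
    have "norm (Psi_star \<nu> \<Psi> (of_real r * exp (\<i> * of_real (\<theta> / 3)))) = norm (cut_integral M \<nu> \<theta> 1 r - cut_integral M \<nu> \<theta> (- 1) r) / Gamma \<nu>"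
      using Psi_star_eq_cut_integral[OF that] \<Gamma> by (simp add: norm_divide)
    also have "\<dots> \<le> (norm (cut_integral M \<nu> \<theta> 1 r) + norm (cut_integral M \<nu> \<theta> (- 1) r)) / Gamma \<nu>"
      using \<Gamma> by (intro divide_right_mono norm_triangle_ineq4) auto
    also have "\<dots> \<le> C1 * (r powr (- \<nu>) * cos \<theta> powr (- \<nu>))"
      using norm_cut_integral_le[OF \<nu>_pos that, of 1] norm_cut_integral_le[OF \<nu>_pos that, of "-1"] \<Gamma>
      by (simp add: C1_def divide_right_mono)
    also have "\<dots> \<le> C * (r powr (- \<nu>) * cos \<theta> powr (- \<nu>))" by (intro mult_right_mono) (auto simp: C_def)
    finally show ?thesis .
  qed
  have P2: "norm (Psi_star \<nu> \<Psi> (of_real r * exp (\<i> * of_real (\<theta> / 3)))) \<le> C * r powr (- 6)"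
    if "0 < r" "\<bar>\<theta>\<bar> < pi / 2" "R < r" for r \<theta>
  proof -
    have "of_real r * exp (\<i> * of_real (\<theta> / 3)) \<in> sector (pi / 6)" using that by (intro ray_mem_sector) auto
    moreover have n: "norm (of_real r * exp (\<i> * of_real (\<theta> / 3))) = r" unfolding norm_mult norm_exp_i_times using that by simp
    ultimately have "norm (Psi_star \<nu> \<Psi> (of_real r * exp (\<i> * of_real (\<theta> / 3)))) \<le> C2 * r powr (-6)"
      using R0[of "of_real r * exp (\<i> * of_real (\<theta> / 3))"] that unfolding n R_def by auto
    also have "\<dots> \<le> C * r powr (-6)" by (intro mult_right_mono) (auto simp: C_def)
    finally show ?thesis .
  qed
  define K where "K = exp (\<xi> * x powr (-2/3)) * C * (7 powr 7 * \<xi> powr (- 21 / 2) +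
     (5 - 4 * \<nu> / 3) powr (5 - 4 * \<nu> / 3) * \<xi> powr (- 3 * (5 - 4 * \<nu> / 3) / 2))"
  let ?S = "{-pi/2<..<pi/2} \<times> {0::real<..}"
  let ?A = "\<lambda>\<theta>. indicator {-pi/2<..<pi/2} \<theta> * cos \<theta> powr (- (1 - \<nu> / 3))"
  let ?B = "\<lambda>r. K * (indicator {0<..} r * (if r \<le> R then r powr 8 else r powr (- 1 - \<nu>)))"
  let ?F = "\<lambda>\<theta> r. indicator ?S (\<theta>, r) *\<^sub>R density_integrand \<nu> \<Psi> \<xi> x \<theta> r"
  have "integrable (lborel \<Otimes>\<^sub>M lborel) (case_prod ?F)"
  proof (rule lborel_pair.Fubini_dominated(1))
    have "(\<lambda>p. indicator ?S p *\<^sub>R (\<lambda>(\<theta>, r). density_integrand \<nu> \<Psi> \<xi> x \<theta> r) p) \<in> borel_measurable borel"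
      by (intro borel_measurable_continuous_on_indicator continuous_on_density_integrand analytic \<xi> borel_open open_Times) auto
    then show "case_prod ?F \<in> borel_measurable (lborel \<Otimes>\<^sub>M lborel)"
      by (simp add: lborel_prod split_beta')
    show "integrable lborel ?A" using integrable_cos_powr[of "1 - \<nu> / 3"] \<nu>_pos \<nu> by simp
    show "integrable lborel ?B" using integrable_powr_cutoff[of R \<nu>] \<nu>_pos by (intro integrable_mult_right) (simp add: R_def)
    show "norm (?F \<theta> r) \<le> ?A \<theta> * ?B r" for \<theta> r
    proof (cases "(\<theta>, r) \<in> ?S")
      case True
      then have "\<bar>\<theta>\<bar> < pi / 2" "0 < r" by (auto simp: abs_if)
      then have "norm (density_integrand \<nu> \<Psi> \<xi> x \<theta> r) \<le>
         cos \<theta> powr (- (1 - \<nu> / 3)) * (K * (if r \<le> R then r powr 8 else r powr (- 1 - \<nu>)))"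
        unfolding K_def by (intro norm_density_integrand_le[OF \<nu>_pos \<nu> _ _ \<xi> C] P1 P2)
      then show ?thesis using True by simp
    qed (auto simp: indicator_def)
  qed
  then show ?thesis
    by (simp add: set_integrable_def lborel_prod split_beta')
qed

section \<open>The inner integral as a value of a Laplace transform\<close>

definition power_Laplace :: "real measure \<Rightarrow> real \<Rightarrow> complex \<Rightarrow> complex" where
  "power_Laplace M \<nu> u = (\<integral>y. of_real (y powr (- 2 * \<nu> / 3)) * exp (- u * of_real (y powr (-2/3))) \<partial>M)"

text \<open>The angular factors of the integrand are tuned to this result. The phase
  \<open>(1 - 2 * \<nu> / 3) * \<theta>\<close> cancels \<open>2 * \<nu> / 3 * \<theta>\<close> from
  the power at the pole against \<open>\<theta>\<close> from \<open>1 / w\<close>, and the powers of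
  \<open>sec \<theta>\<close> collapse to the square, the derivative of \<open>tan\<close>, which
  turns \<open>d\<theta>\<close> into the line element in \<open>u\<close>.\<close>

lemma (in gamma_Laplace_law) inner_integral_density_integrand:
  assumes \<theta>: "\<bar>\<theta>\<bar> < pi / 2" and \<xi>: "0 < \<xi>"
  defines "u \<equiv> of_real \<xi> + \<i> * of_real (\<xi> * tan \<theta>)"
  shows "(LBINT r:{0<..}. density_integrand \<nu> \<Psi> \<xi> x \<theta> r) =
    8 * pi * \<i> / (9 * of_real (Gamma \<nu>)) * of_real (\<xi> powr (\<nu> - 3/2) * (sec \<theta>)\<^sup>2)
      * (exp (u * of_real (x powr (-2/3))) * power_Laplace M \<nu> u)"
proof -
  define S where "S = sec \<theta>"
  have cpos: "0 < cos \<theta>" using \<theta> by (intro cos_gt_zero_pi) auto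
  have S: "0 < S" using cpos by (simp add: S_def sec_def)
  \<comment> \<open>With this \<open>c\<close> the pole satisfies
    \<open>exp (p + \<i> * \<theta> / 3) = u * y powr (-2/3)\<close>, as needed for
    \<open>power_Laplace\<close> at \<open>u\<close>.\<close>
  define c where "c = (\<xi> * S) powr (3/2)"
  have c: "0 < c" using \<xi> S by (simp add: c_def)
  define e where "e = exp (\<i> * of_real \<theta>)"
  have e0: "e \<noteq> 0" by (simp add: e_def)
  have u: "u = of_real (\<xi> * S) * e"
    using cpos by (simp add: u_def S_def sec_def e_def complex_eq_iff Re_exp Im_exp tan_def)
  define K where "K = exp (u * of_real (x powr (-2/3))) * exp (of_real (1 - 2 * \<nu> / 3) * \<i> * of_real \<theta>) * of_real (S powr (7/2 - \<nu>))"
  have "density_integrand \<nu> \<Psi> \<xi> x \<theta> r = K * (exp (- (of_real c * e) * of_real (r powr (-3/2))) * of_real (r powr (\<nu> - 5/2))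
       * Psi_star \<nu> \<Psi> (of_real r * exp (\<i> * of_real (\<theta> / 3))))" for r
  proof -
    have "of_real (\<xi> * x powr (-2/3) * S) * e - e * of_real ((\<xi> * S) powr (3/2) * r powr (-3/2))
        = u * of_real (x powr (-2/3)) + - (of_real c * e) * of_real (r powr (-3/2))"
      by (simp add: u c_def algebra_simps)
    then show ?thesis
      unfolding density_integrand_def S_def[symmetric] e_def[symmetric] K_def by (simp only: exp_add of_real_mult mult_ac)
  qed
  then have "(LBINT r:{0<..}. density_integrand \<nu> \<Psi> \<xi> x \<theta> r) =
      K * (LBINT r:{0<..}. exp (- (of_real c * e) * of_real (r powr (-3/2))) * of_real (r powr (\<nu> - 5/2))
       * Psi_star \<nu> \<Psi> (of_real r * exp (\<i> * of_real (\<theta> / 3))))"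
    by (simp only: set_integral_mult_right)
  also have "\<dots> = K * (8 * pi * \<i> / (9 * of_real (Gamma \<nu>)) *
     ((\<integral>y. exp (- exp (Complex (2 / 3 * ln (c / y)) (2 / 3 * \<theta>) + \<i> * of_real (\<theta> / 3)) + of_real \<nu> * Complex (2 / 3 * ln (c / y)) (2 / 3 * \<theta>)) \<partial>M) / (of_real c * e)))"
    unfolding e_def by (subst Psi_star_Laplace[OF \<theta> c]) auto
  also have "(\<integral>y. exp (- exp (Complex (2 / 3 * ln (c / y)) (2 / 3 * \<theta>) + \<i> * of_real (\<theta> / 3)) + of_real \<nu> * Complex (2 / 3 * ln (c / y)) (2 / 3 * \<theta>)) \<partial>M)
     = (\<integral>y. of_real ((\<xi> * S) powr \<nu>) * exp (\<i> * of_real (2 * \<nu> / 3 * \<theta>)) * (of_real (y powr (- 2 * \<nu> / 3)) * exp (- u * of_real (y powr (-2/3)))) \<partial>M)"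
  proof (rule integral_cong_AE)
    show "AE y in M. exp (- exp (Complex (2 / 3 * ln (c / y)) (2 / 3 * \<theta>) + \<i> * of_real (\<theta> / 3)) + of_real \<nu> * Complex (2 / 3 * ln (c / y)) (2 / 3 * \<theta>))
      = of_real ((\<xi> * S) powr \<nu>) * exp (\<i> * of_real (2 * \<nu> / 3 * \<theta>)) * (of_real (y powr (- 2 * \<nu> / 3)) * exp (- u * of_real (y powr (-2/3))))"
      using pos
    proof eventually_elim
      case (elim y)
      have ln: "2 / 3 * ln (c / y) = ln (\<xi> * S) + (-2/3) * ln y"
        using elim \<xi> S by (simp add: c_def ln_div ln_powr)
      have "Complex (2 / 3 * ln (c / y)) (2 / 3 * \<theta>) + \<i> * of_real (\<theta> / 3) = of_real (ln (\<xi> * S)) + of_real ((-2/3) * ln y) + \<i> * of_real \<theta>"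
        unfolding ln by (simp add: complex_eq_iff)
      moreover have "exp (of_real (ln (\<xi> * S)) + of_real ((-2/3) * ln y) + \<i> * of_real \<theta>) = of_real (exp (ln (\<xi> * S))) * of_real (exp ((-2/3) * ln y)) * e"
        unfolding e_def by (simp only: exp_add exp_of_real)
      ultimately have 1: "- exp (Complex (2 / 3 * ln (c / y)) (2 / 3 * \<theta>) + \<i> * of_real (\<theta> / 3)) = - u * of_real (y powr (-2/3))"
        unfolding u using elim \<xi> S by (simp add: powr_def)
      have "of_real \<nu> * Complex (2 / 3 * ln (c / y)) (2 / 3 * \<theta>) = of_real (\<nu> * ln (\<xi> * S)) + of_real ((- 2 * \<nu> / 3) * ln y) + \<i> * of_real (2 * \<nu> / 3 * \<theta>)"
        unfolding ln by (simp add: complex_eq_iff algebra_simps)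
      then have 2: "exp (of_real \<nu> * Complex (2 / 3 * ln (c / y)) (2 / 3 * \<theta>)) = of_real ((\<xi> * S) powr \<nu>) * of_real (y powr (- 2 * \<nu> / 3)) * exp (\<i> * of_real (2 * \<nu> / 3 * \<theta>))"
        using elim \<xi> S by (simp only: exp_add exp_of_real powr_def) simp
      show ?case unfolding 1 unfolding exp_add 2 by (simp only: mult_ac)
    qed
  qed measurable
  also have "\<dots> = of_real ((\<xi> * S) powr \<nu>) * exp (\<i> * of_real (2 * \<nu> / 3 * \<theta>)) * power_Laplace M \<nu> u"
    unfolding power_Laplace_def by (simp only: integral_mult_right_zero)
  also have "K * (8 * pi * \<i> / (9 * of_real (Gamma \<nu>)) * (of_real ((\<xi> * S) powr \<nu>) * exp (\<i> * of_real (2 * \<nu> / 3 * \<theta>)) * power_Laplace M \<nu> u / (of_real c * e)))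
    = 8 * pi * \<i> / (9 * of_real (Gamma \<nu>)) * of_real (S powr (7/2 - \<nu>) * (\<xi> * S) powr \<nu> / c)
      * ((exp (of_real (1 - 2 * \<nu> / 3) * \<i> * of_real \<theta>) * exp (\<i> * of_real (2 * \<nu> / 3 * \<theta>))) / e)
      * (exp (u * of_real (x powr (-2/3))) * power_Laplace M \<nu> u)"
    unfolding K_def by (simp add: field_simps)
  also have "exp (of_real (1 - 2 * \<nu> / 3) * \<i> * of_real \<theta>) * exp (\<i> * of_real (2 * \<nu> / 3 * \<theta>)) = e"
    unfolding e_def exp_add[symmetric] by (rule arg_cong[where f=exp]) (simp add: algebra_simps)
  also have "e / e = 1" using e0 by simp
  also have "S powr (7/2 - \<nu>) * (\<xi> * S) powr \<nu> / c = \<xi> powr (\<nu> - 3/2) * S\<^sup>2"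
  proof -
    have "S powr (7/2 - \<nu>) * (\<xi> * S) powr \<nu> / c = (\<xi> powr \<nu> / \<xi> powr (3/2)) * (S powr (7/2 - \<nu>) * S powr \<nu> / S powr (3/2))"
      unfolding c_def using \<xi> S by (simp add: powr_mult)
    also have "S powr (7/2 - \<nu>) * S powr \<nu> / S powr (3/2) = S powr 2" by (simp flip: powr_add powr_diff)
    also have "S powr 2 = S\<^sup>2" using S by simp
    finally show ?thesis by (simp flip: powr_diff)
  qed
  finally show ?thesis by (simp only: S_def mult_1_right)
qed

section \<open>From the angular integral to the density formula\<close>

lemma tan_substitution:
  fixes F :: "real \<Rightarrow> complex"
  assumes [measurable]: "F \<in> borel_measurable borel" and \<xi>: "0 < \<xi>"
  shows "set_integrable lborel {-pi/2<..<pi/2} (\<lambda>\<theta>. (\<xi> * (sec \<theta>)\<^sup>2) *\<^sub>R F (- (\<xi> * tan \<theta>))) \<longleftrightarrow> integrable lborel F"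
    and "(LBINT \<theta>:{-pi/2<..<pi/2}. (\<xi> * (sec \<theta>)\<^sup>2) *\<^sub>R F (- (\<xi> * tan \<theta>))) = (\<integral>\<tau>. F \<tau> \<partial>lborel)"
proof -
  \<comment> \<open>The minus sign in \<open>?g\<close> matches the inversion, where the transform
    is evaluated at \<open>\<xi> - \<i>\<tau>\<close>; the absolute value of the derivative absorbs
    it.\<close>
  let ?S = "{-pi/2<..<pi/2}" and ?g = "\<lambda>\<theta>. - (\<xi> * tan \<theta>)" and ?g' = "\<lambda>\<theta>. - (\<xi> * (sec \<theta>)\<^sup>2)"
  have der: "(?g has_real_derivative ?g' \<theta>) (at \<theta>)" if "\<theta> \<in> ?S" for \<theta>
  proof -
    have "cos \<theta> \<noteq> 0" using that cos_gt_zero_pi[of \<theta>] by auto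
    then show ?thesis by (auto intro!: derivative_eq_intros simp: sec_def field_simps)
  qed
  have inj: "inj_on ?g ?S"
  proof (rule inj_onI)
    fix a b assume ab: "a \<in> ?S" "b \<in> ?S" "?g a = ?g b"
    then have "tan a = tan b" using \<xi> by simp
    then show "a = b" using ab tan_total[of "tan a"] by auto
  qed
  have im: "?g ` ?S = UNIV"
  proof (intro equalityI subset_UNIV subsetI)
    fix z :: real
    obtain a where "- (pi / 2) < a" "a < pi / 2" "tan a = - z / \<xi>" using tan_total[of "- z / \<xi>"] by blast
    then show "z \<in> ?g ` ?S" using \<xi> by (intro image_eqI[of _ _ a]) auto
  qed
  have abs: "\<bar>?g' \<theta>\<bar> = \<xi> * (sec \<theta>)\<^sup>2" for \<theta> using \<xi> by (simp add: abs_mult)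
  have [measurable]: "sec \<in> borel_measurable borel" "tan \<in> borel_measurable (borel :: real measure)"
    unfolding sec_def[abs_def] tan_def[abs_def] by measurable
  note * = set_lborel_substitution[OF _ der inj im, where f=F, unfolded abs]
  show "set_integrable lborel ?S (\<lambda>\<theta>. (\<xi> * (sec \<theta>)\<^sup>2) *\<^sub>R F (- (\<xi> * tan \<theta>))) \<longleftrightarrow> integrable lborel F"
    using *(1) by (simp add: set_borel_measurable_def set_integrable_def)
  show "(LBINT \<theta>:?S. (\<xi> * (sec \<theta>)\<^sup>2) *\<^sub>R F (- (\<xi> * tan \<theta>))) = (\<integral>\<tau>. F \<tau> \<partial>lborel)"
    using *(2) by (simp add: set_borel_measurable_def set_lebesgue_integral_def)
qed

text \<open>Densities of one measure agree almost everywhere. On a ball inside the positive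
  half-line the set of agreement is closed by continuity, so it contains the centre. This gives the
  independence of \<open>\<xi>\<close>.\<close>

lemma continuous_densities_eq:
  fixes f g :: "real \<Rightarrow> real"
  assumes eq: "density lborel (\<lambda>x. ennreal (f x)) = density lborel (\<lambda>x. ennreal (g x))"
    and [measurable]: "f \<in> borel_measurable borel" "g \<in> borel_measurable borel"
    and nn: "\<And>x. 0 \<le> f x" "\<And>x. 0 \<le> g x"
    and cont: "continuous_on {0<..} f" "continuous_on {0<..} g" and x: "0 < x"
  shows "f x = g x"
proof -
  have "AE x in lborel. ennreal (f x) = ennreal (g x)"
    by (rule sigma_finite_measure.density_unique[OF lborel.sigma_finite_measure_axioms]) (use eq in auto)
  then have "AE x in lborel. f x = g x" using nn by simp
  then have ae: "AE x in lebesgue. f x = g x" by (rule AE_completion)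
  define C where "C = {y \<in> cball x (x / 2). f y - g y = 0}"
  have sub: "cball x (x / 2) \<subseteq> {0<..}" using x by (auto simp: dist_real_def abs_if split: if_splits)
  have "closed C" unfolding C_def
  proof (rule continuous_closed_preimage_constant)
    show "continuous_on (cball x (x / 2)) (\<lambda>y. f y - g y)"
      using sub cont by (intro continuous_intros) (auto intro: continuous_on_subset)
  qed simp
  have "x \<in> C"
    by (rule mem_closed_if_AE_lebesgue_open[where S="ball x (x / 2)"])
       (use \<open>closed C\<close> ae x in \<open>auto simp: C_def elim!: eventually_mono\<close>)
  then show ?thesis by (simp add: C_def)
qed

text \<open>Joint integrability passes through Fubini to the angular integral and through the
  tangent substitution to the vertical line. That supplies the hypothesis of
  \<open>density_from_power_Laplace\<close>.\<close>

lemma (in gamma_Laplace_law) density_formula: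
  assumes \<nu>: "\<nu> < 3 / 2" and decay: "Psi_star \<nu> \<Psi> \<in> O[sector_at_infinity (pi / 6)](\<lambda>z. complex_of_real (norm z powr (-6)))"
    and \<xi>: "0 < \<xi>"
  shows "\<exists>f :: real \<Rightarrow> real. f \<in> borel_measurable borel \<and> (\<forall>x. 0 \<le> f x) \<and> (\<forall>x\<le>0. f x = 0) \<and>
     continuous_on {0<..} f \<and> M = density lborel (\<lambda>x. ennreal (f x)) \<and>
     (\<forall>x>0. complex_of_real (f x) =
        of_real (3 * Gamma \<nu>) / (of_real (8 * pi\<^sup>2) * \<i>)
        * of_real (\<xi> powr (5/2 - \<nu>) * x powr (2 * \<nu> / 3 - 5/3))
        * (LBINT \<theta>:{-pi/2<..<pi/2}. (LBINT r:{0<..}. density_integrand \<nu> \<Psi> \<xi> x \<theta> r)))"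
proof -
  have \<Gamma>: "0 < Gamma \<nu>" by (rule Gamma_real_pos[OF \<nu>_pos])
  let ?S = "{-pi/2<..<pi/2}"
  define G where "G = power_Laplace M \<nu>"
  have Gm [measurable]: "G \<in> borel_measurable borel" unfolding G_def power_Laplace_def by measurable
  define F where "F x \<tau> = exp ((of_real \<xi> - \<i> * of_real \<tau>) * of_real (x powr (-2/3))) * G (of_real \<xi> - \<i> * of_real \<tau>)" for x \<tau> :: real
  have Fm [measurable]: "F x \<in> borel_measurable borel" for x unfolding F_def by measurable
  define D where "D x \<theta> = (LBINT r:{0<..}. density_integrand \<nu> \<Psi> \<xi> x \<theta> r)" for x \<theta>
  \<comment> \<open>One factor \<open>\<xi>\<close> of \<open>\<xi> powr (\<nu> - 3/2)\<close> is
    split off, because the Jacobian of the substitution is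
    \<open>\<xi> * (sec \<theta>)\<^sup>2\<close>.\<close>
  define k where "k = 8 * pi * \<i> / (9 * of_real (Gamma \<nu>)) * of_real (\<xi> powr (\<nu> - 5/2))"
  have k0: "k \<noteq> 0" using \<Gamma> \<xi> by (simp add: k_def)
  have inner: "D x \<theta> = k * ((\<xi> * (sec \<theta>)\<^sup>2) *\<^sub>R F x (- (\<xi> * tan \<theta>)))" if "\<theta> \<in> ?S" for x \<theta>
  proof -
    have \<theta>: "\<bar>\<theta>\<bar> < pi / 2" using that by (auto simp: abs_if)
    have "\<xi> powr (\<nu> - 3/2) = \<xi> powr (\<nu> - 5/2) * \<xi> powr 1" unfolding powr_add[symmetric] by simp
    then have \<xi>p: "\<xi> powr (\<nu> - 3/2) = \<xi> powr (\<nu> - 5/2) * \<xi>" using \<xi> by simp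
    have u: "of_real \<xi> - \<i> * of_real (- (\<xi> * tan \<theta>)) = of_real \<xi> + \<i> * of_real (\<xi> * tan \<theta>)" by simp
    show ?thesis
      unfolding D_def F_def u inner_integral_density_integrand[OF \<theta> \<xi>] k_def G_def \<xi>p
      by (simp add: scaleR_conv_of_real mult_ac)
  qed
  have D_int: "set_integrable lborel ?S (D x)" for x
  proof -
    have "integrable (lborel \<Otimes>\<^sub>M lborel) (\<lambda>(\<theta>, r). indicator (?S \<times> {0<..}) (\<theta>, r) *\<^sub>R density_integrand \<nu> \<Psi> \<xi> x \<theta> r)"
      using set_integrable_density_integrand[OF \<nu> decay \<xi>, of x]
      by (simp add: set_integrable_def lborel_prod split_beta')
    then have "integrable lborel (\<lambda>\<theta>. \<integral>r. indicator (?S \<times> {0<..}) (\<theta>, r) *\<^sub>R density_integrand \<nu> \<Psi> \<xi> x \<theta> r \<partial>lborel)"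
      by (rule lborel_pair.integrable_fst)
    moreover have "(\<integral>r. indicator (?S \<times> {0<..}) (\<theta>, r) *\<^sub>R density_integrand \<nu> \<Psi> \<xi> x \<theta> r \<partial>lborel) = indicator ?S \<theta> *\<^sub>R D x \<theta>" for \<theta>
      by (cases "\<theta> \<in> ?S") (simp_all add: D_def set_lebesgue_integral_def indicator_times)
    ultimately show ?thesis by (simp add: set_integrable_def)
  qed
  have F_int: "integrable lborel (F x)" for x
  proof -
    have "set_integrable lborel ?S (\<lambda>\<theta>. k * ((\<xi> * (sec \<theta>)\<^sup>2) *\<^sub>R F x (- (\<xi> * tan \<theta>))))"
      using D_int[of x] inner by (subst (asm) set_integrable_cong[OF refl refl]) auto
    then have "set_integrable lborel ?S (\<lambda>\<theta>. (\<xi> * (sec \<theta>)\<^sup>2) *\<^sub>R F x (- (\<xi> * tan \<theta>)))"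
      using k0 by (subst (asm) set_integrable_mult_right_iff) auto
    then show ?thesis using tan_substitution(1)[OF Fm \<xi>] by blast
  qed
  have D_eq: "(LBINT \<theta>:?S. D x \<theta>) = k * (\<integral>\<tau>. F x \<tau> \<partial>lborel)" for x
  proof -
    have "(LBINT \<theta>:?S. D x \<theta>) = (LBINT \<theta>:?S. k * ((\<xi> * (sec \<theta>)\<^sup>2) *\<^sub>R F x (- (\<xi> * tan \<theta>))))"
      using inner by (intro set_lebesgue_integral_cong) auto
    also have "\<dots> = k * (LBINT \<theta>:?S. (\<xi> * (sec \<theta>)\<^sup>2) *\<^sub>R F x (- (\<xi> * tan \<theta>)))" by (rule set_integral_mult_right)
    finally show ?thesis by (simp only: tan_substitution(2)[OF Fm \<xi>])
  qed
  \<comment> \<open>At \<open>x = 1\<close> the exponential factor of \<open>F\<close> has constant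
    modulus \<open>exp \<xi> \<ge> 1\<close>, so \<open>F 1\<close> dominates the transform.\<close>
  have G_int: "integrable lborel (\<lambda>\<tau>. G (of_real \<xi> - \<i> * of_real \<tau>))"
  proof (rule Bochner_Integration.integrable_bound[OF F_int[of 1]])
    have "norm (G (of_real \<xi> - \<i> * of_real \<tau>)) \<le> norm (F 1 \<tau>)" for \<tau>
    proof -
      have "1 * norm (G (of_real \<xi> - \<i> * of_real \<tau>)) \<le> exp \<xi> * norm (G (of_real \<xi> - \<i> * of_real \<tau>))"
        using \<xi> by (intro mult_right_mono) auto
      then show ?thesis by (simp add: F_def norm_mult)
    qed
    then show "AE \<tau> in lborel. norm (G (of_real \<xi> - \<i> * of_real \<tau>)) \<le> norm (F 1 \<tau>)" by (intro AE_I2)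
  qed measurable
  define I where "I x = 1 / (3 * pi) * x powr (2 * \<nu> / 3 - 5/3) * (\<integral>\<tau>. F x \<tau> \<partial>lborel)" for x
  define f where "f x = (if 0 < x then Re (I x) else 0)" for x
  note dens = density_from_power_Laplace[OF pos \<nu>_pos \<xi>, folded power_Laplace_def, folded G_def, OF G_int,
      folded F_def, folded I_def, folded f_def]
  have I_eq: "I x = of_real (3 * Gamma \<nu>) / (of_real (8 * pi\<^sup>2) * \<i>)
        * of_real (\<xi> powr (5/2 - \<nu>) * x powr (2 * \<nu> / 3 - 5/3)) * (LBINT \<theta>:?S. D x \<theta>)" for x
  proof -
    have "\<xi> powr (5/2 - \<nu>) * \<xi> powr (\<nu> - 5/2) = 1" using \<xi> by (simp flip: powr_add)
    then have p: "of_real (\<xi> powr (5/2 - \<nu>)) * complex_of_real (\<xi> powr (\<nu> - 5/2)) = 1" by (simp flip: of_real_mult)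
    have "of_real (3 * Gamma \<nu>) / (of_real (8 * pi\<^sup>2) * \<i>)
        * of_real (\<xi> powr (5/2 - \<nu>) * x powr (2 * \<nu> / 3 - 5/3)) * (k * (\<integral>\<tau>. F x \<tau> \<partial>lborel))
      = (of_real (3 * Gamma \<nu>) / (of_real (8 * pi\<^sup>2) * \<i>) * (8 * pi * \<i> / (9 * of_real (Gamma \<nu>))))
        * (of_real (\<xi> powr (5/2 - \<nu>)) * of_real (\<xi> powr (\<nu> - 5/2))) * of_real (x powr (2 * \<nu> / 3 - 5/3)) * (\<integral>\<tau>. F x \<tau> \<partial>lborel)"
      unfolding k_def of_real_mult by (simp only: mult_ac)
    also have "of_real (3 * Gamma \<nu>) / (of_real (8 * pi\<^sup>2) * \<i>) * (8 * pi * \<i> / (9 * of_real (Gamma \<nu>))) = 1 / (3 * complex_of_real pi)"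
      using \<Gamma> by (simp add: field_simps power2_eq_square)
    finally show ?thesis unfolding p D_eq I_def by simp
  qed
  have "f \<in> borel_measurable borel"
    unfolding f_def[abs_def] I_def F_def by measurable
  moreover have "f x = 0" if "x \<le> 0" for x using that by (simp add: f_def)
  ultimately show ?thesis
    using dens I_eq unfolding D_def by (intro exI[of _ f]) auto
qed

theorem theorem3p1:
  fixes M :: "'a measure" and X :: "'a \<Rightarrow> real" and \<nu> :: real and \<Psi> :: "complex \<Rightarrow> complex"
  assumes "prob_space M"
    and "X \<in> borel_measurable M"
    and "AE \<omega> in M. 0 < X \<omega>"
    and "0 < \<nu>" "\<nu> < 3/2"
    and "\<And>x::real. 0 < x \<Longrightarrow>
           complex_of_real (1 / Gamma \<nu> *
             (LBINT s:{0<..}. exp (- x * s) * laplace_transform M X (s powr (3/2)) * s powr (\<nu> - 1)))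
           = \<Psi> (complex_of_real x)"
    and "\<Psi> analytic_on sector (5 * pi / 6)"
    and "\<Psi> \<in> o[at 0 within sector (5 * pi / 6)](\<lambda>z. complex_of_real (norm z powr (- \<nu>)))"
    and "\<Psi> \<in> O[sector_at_infinity (5 * pi / 6)](\<lambda>_. 1)"
    and "Psi_star \<nu> \<Psi> \<in> O[sector_at_infinity (pi / 6)](\<lambda>z. complex_of_real (norm z powr (-6)))"
  shows "\<exists>f :: real \<Rightarrow> real.
           (\<forall>x. 0 \<le> f x) \<and> (\<forall>x\<le>0. f x = 0) \<and>
           distributed M lborel X (\<lambda>x. ennreal (f x)) \<and>
           continuous_on {0<..} f \<and>
           (\<forall>x>0. \<forall>\<xi>>0.
              set_integrable lborel ({-pi/2<..<pi/2} \<times> {0<..})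
                (\<lambda>(\<theta>, r). density_integrand \<nu> \<Psi> \<xi> x \<theta> r) \<and>
              complex_of_real (f x) =
                of_real (3 * Gamma \<nu>) / (of_real (8 * pi\<^sup>2) * \<i>)
                * of_real (\<xi> powr (5/2 - \<nu>) * x powr (2 * \<nu> / 3 - 5/3))
                * (LBINT \<theta>:{-pi/2<..<pi/2}. (LBINT r:{0<..}. density_integrand \<nu> \<Psi> \<xi> x \<theta> r)))"
proof -
  interpret prob_space M by fact
  define N where "N = distr M borel X"
  interpret N: real_distribution N unfolding N_def by (rule real_distribution_distr) fact
  have laplace: "laplace_transform N (\<lambda>y. y) = laplace_transform M X"
    unfolding laplace_transform_def N_def using assms(2) by (intro ext integral_distr) auto
  interpret N: gamma_Laplace_law N \<nu> \<Psi>
  proof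
    show "AE y in N. 0 < y" unfolding N_def using assms(2,3) by (subst AE_distr_iff) auto
  qed (use assms(4,6,7) in \<open>simp_all only: laplace\<close>)
  note formula = N.density_formula[OF assms(5,10)]
  \<comment> \<open>The density is fixed at \<open>\<xi> = 1\<close>. Any other \<open>\<xi>\<close>
    gives a continuous density \<open>g\<close> of the same law, which equals \<open>f\<close> at
    every positive point.\<close>
  obtain f :: "real \<Rightarrow> real" where f: "f \<in> borel_measurable borel" "\<And>x. 0 \<le> f x" "\<And>x. x \<le> 0 \<Longrightarrow> f x = 0"
    "continuous_on {0<..} f" "N = density lborel (\<lambda>x. ennreal (f x))"
    using formula[of 1] by auto
  have "complex_of_real (f x) =
                of_real (3 * Gamma \<nu>) / (of_real (8 * pi\<^sup>2) * \<i>)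
                * of_real (\<xi> powr (5/2 - \<nu>) * x powr (2 * \<nu> / 3 - 5/3))
                * (LBINT \<theta>:{-pi/2<..<pi/2}. (LBINT r:{0<..}. density_integrand \<nu> \<Psi> \<xi> x \<theta> r))"
    if x: "0 < x" and \<xi>: "0 < \<xi>" for x \<xi>
  proof -
    obtain g :: "real \<Rightarrow> real" where g: "g \<in> borel_measurable borel" "\<And>x. 0 \<le> g x"
      "continuous_on {0<..} g" "N = density lborel (\<lambda>x. ennreal (g x))"
      and geq: "complex_of_real (g x) =
                of_real (3 * Gamma \<nu>) / (of_real (8 * pi\<^sup>2) * \<i>)
                * of_real (\<xi> powr (5/2 - \<nu>) * x powr (2 * \<nu> / 3 - 5/3))
                * (LBINT \<theta>:{-pi/2<..<pi/2}. (LBINT r:{0<..}. density_integrand \<nu> \<Psi> \<xi> x \<theta> r))"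
      using formula[OF \<xi>] x by blast
    have "f x = g x"
      using f g x by (intro continuous_densities_eq[of f g]) auto
    then show ?thesis using geq by simp
  qed
  moreover have "distributed M lborel X (\<lambda>x. ennreal (f x))"
    unfolding distributed_def using f assms(2) by (auto simp: N_def cong: distr_cong)
  moreover have "set_integrable lborel ({-pi/2<..<pi/2} \<times> {0<..}) (\<lambda>(\<theta>, r). density_integrand \<nu> \<Psi> \<xi> x \<theta> r)"
    if "0 < \<xi>" for x \<xi>
    by (rule N.set_integrable_density_integrand[OF assms(5,10) that])
  ultimately show ?thesis using f by (intro exI[of _ f]) blast
qed

end
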